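(* Let $X$ and $Y$ be sequence classes such that $X$ is polynomially stable and $X(\mathbb{K})^n\hookrightarrow Y(\mathbb{K})$ for every $n\in\mathbb{N}$. (a) If $Y$ is multilinearly stable, then $(\mathcal{P}_{X;Y},\|\cdot\|_{X;Y;1})$ is a $\left(1,\frac{n^n}{n!}\right)_{n=1}^\infty$-polynomial Banach two-sided ideal. (b) If $Y$ is polynomially stable, then $(\mathcal{P}_{X;Y},\|\cdot\|_{X;Y;1})$ is a polynomial Banach two-sided ideal (that is, a $(1,1)_{n=1}^\infty$-polynomial Banach two-sided ideal).
   Context: All Banach spaces are over $\mathbb{K} = \mathbb{R}$ or $\mathbb{C}$. $\mathcal{L}(E_1,\ldots,E_n;F)$ is the Banach space of continuous $n$-linear operators and $\mathcal{P}(^nE;F)$ the Banach space of continuous $n$-homogeneous polynomials, with their usual sup norms. **Sequence class.** $E \hookrightarrow F$ means that the Banach space $E$ is a linear subspace of the Banach space $F$ and $\|x\|_F \le \|x\|_E$ for all $x\in E$. $c_{00}(E)$ is the space of eventually null $E$-valued sequences, $\ell_\infty(E)$ the Banach space of bounded $E$-valued sequences with the sup norm, and $e_j$ the $j$-th canonical scalar sequence. A sequence class is a rule $E\mapsto X(E)$ assigning to each Banach space $E$ a Banach space $X(E)$ of $E$-valued sequences (coordinatewise operations) such that $c_{00}(E)\subseteq X(E)$, $X(E)\hookrightarrow \ell_\infty(E)$ and $\|e_j\|_{X(\mathbb{K})}=1$ for every $j\in\mathbb{N}$. **Multilinearly stable.** A sequence class $Y$ is multilinearly stable if for all $n\in\mathbb{N}$,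 Banach spaces $E_1,\ldots,E_n,F$ and $A\in\mathcal{L}(E_1,\ldots,E_n;F)$, $(A(x_j^1,\ldots,x_j^n))_{j=1}^\infty\in Y(F)$ whenever $(x_j^m)_{j=1}^\infty\in Y(E_m)$, $m=1,\ldots,n$, and the induced $n$-linear operator $\widetilde A\colon Y(E_1)\times\cdots\times Y(E_n)\to Y(F)$, $\widetilde A((x^1_j)_j,\ldots,(x^n_j)_j)=(A(x_j^1,\ldots,x_j^n))_j$, is continuous with $\|\widetilde A\|=\|A\|$. **Polynomially stable.** A sequence class $X$ is polynomially stable if for all $n\in\mathbb{N}$, Banach spaces $E,F$ and $P\in\mathcal{P}(^nE;F)$, $(P(x_j))_{j=1}^\infty\in X(F)$ whenever $(x_j)_{j=1}^\infty\in X(E)$, and $\widetilde P\colon X(E)\to X(F)$, $\widetilde P((x_j)_j)=(P(x_j))_j$, is an $n$-homogeneous polynomial with $\|\widetilde P\|=\|P\|$. **Compatibility.** $X(\mathbb{K})^n\hookrightarrow Y(\mathbb{K})$ means: whenever $(\lambda_j^m)_{j=1}^\infty\in X(\mathbb{K})$, $m=1,\ldots,n$, one has $(\lambda_j^1\cdots\lambda_j^n)_{j=1}^\infty\in Y(\mathbb{K})$ and $\|(\lambda_j^1\cdots\lambda_j^n)_j\|_{Y(\mathbb{K})}\le\prod_{m=1}^n\|(\lambda_j^m)_j\|_{X(\mathbb{K})}$. **$(X;Y)$-summing polynomials.** $P\in\mathcal{P}(^nE;F)$ belongs to $\mathcal{P}_{X;Y}(^nE;F)$ if $(P(x_j))_j\in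 Y(F)$ whenever $(x_j)_j\in X(E)$; equivalently, $\widetilde P\colon X(E)\to Y(F)$, $\widetilde P((x_j)_j)=(P(x_j))_j$, is a well defined continuous $n$-homogeneous polynomial. In this case $\|P\|_{X;Y;1}:=\|\widetilde P\colon X(E)\to Y(F)\|$. **$(C_n,K_n)_{n=1}^\infty$-polynomial Banach two-sided ideal.** Let $C_n,K_n\ge1$ for every $n$ and $C_1=K_1=1$. Let $\mathcal{Q}$ be a subclass of the class of continuous homogeneous polynomials between Banach spaces and $\|\cdot\|_{\mathcal{Q}}\colon\mathcal{Q}\to\mathbb{R}$ such that, for all $n$ and Banach spaces $E,F$, the component $\mathcal{Q}(^nE;F):=\mathcal{P}(^nE;F)\cap\mathcal{Q}$ is a linear subspace of $\mathcal{P}(^nE;F)$ containing the polynomials of finite type (linear combinations of $x\mapsto\varphi(x)^nb$, $\varphi\in E^*$, $b\in F$), on which $\|\cdot\|_{\mathcal{Q}}$ is a complete norm, and $\widehat I_n\colon\mathbb{K}\to\mathbb{K}$, $\widehat I_n(\lambda)=\lambda^n$, satisfies $\|\widehat I_n\|_{\mathcal{Q}}=1$. The pair $(\mathcal{Q},\|\cdot\|_{\mathcal{Q}})$ is a $(C_n,K_n)_{n=1}^\infty$-polynomial Banach two-sided ideal if for all $m,n,r\in\mathbb{N}$, Banach spaces $E,F,G,H$, $P\in\mathcal{Q}(^nE;F)$, $Q\in\mathcal{P}(^mG;E)$ and $R\in\mathcal{P}(^rF;H)$, one has $R\circ P\circ Q\in\mathcal{Q}(^{rmn}G;H)$ and $\|R\circ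 P\circ Q\|_{\mathcal{Q}}\le K_r\cdot C_m^{rn}\cdot\|R\|\cdot\|P\|_{\mathcal{Q}}^r\cdot\|Q\|^{rn}$. Thus in (a) $C_n=1$ and $K_n=n^n/n!$, and in (b) $C_n=K_n=1$ for all $n$. *)

theory Defs
  imports "HOL-Analysis.Analysis" "HOL-Algebra.Module"
begin

section \<open>Banach spaces with explicit carriers\<close>

text \<open>
  Sequence classes and polynomial ideals quantify over all Banach spaces, so Banach spaces
  are objects (carriers with operations) and not types. The scalar field \<open>\<K> = \<real>\<close> or
  \<open>\<K> = \<complex>\<close> is a type \<open>'k\<close> of class \<open>real_normed_field\<close> (and \<open>banach\<close>): \<open>real\<close> and \<open>complex\<close> are
  instances, and by the Gelfand-Mazur theorem there are no others up to isometric isomorphism.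
\<close>

definition scalars :: "'k::comm_ring_1 ring" where
  "scalars = \<lparr>carrier = UNIV, monoid.mult = (*), one = 1, zero = 0, add = (+)\<rparr>"

record ('k, 'v) nspace = "('k, 'v) Module.module" +
  nrm :: "'v \<Rightarrow> real"

text \<open>The fields \<open>mult\<close> and \<open>one\<close> of module records are irrelevant for modules.\<close>

definition mk_nspace ::
  "'v set \<Rightarrow> 'v \<Rightarrow> ('v \<Rightarrow> 'v \<Rightarrow> 'v) \<Rightarrow> ('k \<Rightarrow> 'v \<Rightarrow> 'v) \<Rightarrow> ('v \<Rightarrow> real) \<Rightarrow> ('k, 'v) nspace" where
  "mk_nspace S z a s N =
     \<lparr>carrier = S, monoid.mult = undefined, one = undefined, zero = z, add = a, smult = s, nrm = N\<rparr>"

text \<open>The locale \<open>Metric_space\<close> wants symmetry and nonnegativity also off the carrier.\<close>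

definition ndist :: "('k, 'v) nspace \<Rightarrow> 'v \<Rightarrow> 'v \<Rightarrow> real" where
  "ndist E x y = (if x \<in> carrier E \<and> y \<in> carrier E then nrm E (x \<ominus>\<^bsub>E\<^esub> y) else 0)"

definition ntopology :: "('k, 'v) nspace \<Rightarrow> 'v topology" where
  "ntopology E = Metric_space.mtopology (carrier E) (ndist E)"

locale banach_space = Module.module scalars E
  for E :: "('k::{real_normed_field,banach}, 'v) nspace" (structure) +
  assumes nrm_nonneg: "x \<in> carrier E \<Longrightarrow> 0 \<le> nrm E x"
    and nrm_eq_0_iff: "x \<in> carrier E \<Longrightarrow> nrm E x = 0 \<longleftrightarrow> x = \<zero>"
    and nrm_smult: "x \<in> carrier E \<Longrightarrow> nrm E (c \<odot> x) = norm c * nrm E x"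
    and nrm_triangle: "x \<in> carrier E \<Longrightarrow> y \<in> carrier E \<Longrightarrow> nrm E (x \<oplus> y) \<le> nrm E x + nrm E y"
    and complete: "Metric_space.mcomplete (carrier E) (ndist E)"

text \<open>\<open>E \<hookrightarrow> F\<close>\<close>

definition nembedded :: "('k, 'v) nspace \<Rightarrow> ('k, 'v) nspace \<Rightarrow> bool" where
  "nembedded E F \<longleftrightarrow>
     carrier E \<subseteq> carrier F \<and> \<zero>\<^bsub>E\<^esub> = \<zero>\<^bsub>F\<^esub> \<and>
     (\<forall>x\<in>carrier E. \<forall>y\<in>carrier E. x \<oplus>\<^bsub>E\<^esub> y = x \<oplus>\<^bsub>F\<^esub> y) \<and>
     (\<forall>c. \<forall>x\<in>carrier E. c \<odot>\<^bsub>E\<^esub> x = c \<odot>\<^bsub>F\<^esub> x) \<and>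
     (\<forall>x\<in>carrier E. nrm F x \<le> nrm E x)"

text \<open>
  The Banach spaces that the theorem is about have their carriers in the type \<open>'k + 'a\<close>, where
  \<open>'a\<close> is an arbitrary type playing the role of a universe. The summand \<open>'k\<close> makes the scalar
  field one of these Banach spaces.
\<close>

definition scalar_space :: "('k::real_normed_field, 'k + 'a) nspace" where
  "scalar_space = mk_nspace (range Inl) (Inl 0)
     (\<lambda>x y. Inl (projl x + projl y)) (\<lambda>c x. Inl (c * projl x)) (\<lambda>x. norm (projl x))"

lemma scalar_space_simps [simp]:
  "carrier scalar_space = range Inl"
  "\<zero>\<^bsub>scalar_space\<^esub> = Inl 0"
  "Inl a \<oplus>\<^bsub>scalar_space\<^esub> Inl b = Inl (a + b)"
  "c \<odot>\<^bsub>scalar_space\<^esub> Inl a = Inl (c * a)"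
  "nrm scalar_space (Inl a) = norm a"
  by (simp_all add: scalar_space_def mk_nspace_def)

lemma scalar_space_module:
  "Module.module scalars (scalar_space :: ('k::{real_normed_field,banach}, 'k + 'a) nspace)"
proof (rule moduleI)
  let ?S = "scalar_space :: ('k, 'k + 'a) nspace"
  show "cring (scalars::'k ring)"
  proof (rule cringI)
    show "abelian_group (scalars::'k ring)"
    proof (rule abelian_groupI)
      show "\<exists>y\<in>carrier scalars. y \<oplus>\<^bsub>scalars\<^esub> x = \<zero>\<^bsub>scalars\<^esub>" for x :: 'k
        by (rule bexI[of _ "- x"]) (auto simp: scalars_def)
    qed (auto simp: scalars_def)
    show "comm_monoid (scalars::'k ring)"
      by (rule comm_monoidI) (auto simp: scalars_def)
  qed (simp add: scalars_def ring_distribs)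
  show "abelian_group ?S"
  proof (rule abelian_groupI)
    show "\<exists>y\<in>carrier ?S. y \<oplus>\<^bsub>?S\<^esub> x = \<zero>\<^bsub>?S\<^esub>" if "x \<in> carrier ?S" for x
      by (rule bexI[of _ "Inl (- projl x)"]) (use that in auto)
  qed auto
qed (auto simp: scalars_def distrib_left distrib_right)

lemma scalar_space_banach:
  "banach_space (scalar_space :: ('k::{real_normed_field,banach}, 'k + 'a) nspace)"
proof -
  let ?E = "scalar_space :: ('k::{real_normed_field,banach}, 'k + 'a) nspace"
  interpret Module.module scalars ?E by (rule scalar_space_module)
  have mi: "\<ominus>\<^bsub>?E\<^esub> (Inl b) = Inl (- b)" for b
    by (rule M.minus_equality) auto
  have d: "ndist ?E (Inl a) (Inl b) = dist a b" for a b
    by (simp add: ndist_def a_minus_def mi dist_norm)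
  interpret Metric_space "range Inl" "ndist ?E"
  proof
    show "0 \<le> ndist ?E x y" for x y
    proof (cases "x \<in> range Inl \<and> y \<in> range Inl")
      case True then show ?thesis by (auto simp: d)
    qed (auto simp: ndist_def)
    show "ndist ?E x y = ndist ?E y x" for x y
    proof (cases "x \<in> range Inl \<and> y \<in> range Inl")
      case True then show ?thesis by (auto simp: d dist_commute)
    qed (auto simp: ndist_def)
    show "ndist ?E x y = 0 \<longleftrightarrow> x = y" if "x \<in> range Inl" "y \<in> range Inl" for x y
      using that by (elim rangeE) (simp add: d)
    show "ndist ?E x z \<le> ndist ?E x y + ndist ?E y z"
      if "x \<in> range Inl" "y \<in> range Inl" "z \<in> range Inl" for x y z
      using that by (elim rangeE) (simp add: d dist_triangle)
  qed
  show ?thesis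
  proof (intro banach_space.intro banach_space_axioms.intro scalar_space_module)
    show "Metric_space.mcomplete (carrier ?E) (ndist ?E)"
      unfolding scalar_space_simps mcomplete_def
    proof (intro allI impI)
      fix s assume s: "MCauchy s"
      define t where "t = projl \<circ> s"
      have st: "s = Inl \<circ> t"
      proof
        fix j
        have "s j \<in> range Inl" using s by (auto simp: MCauchy_def)
        then show "s j = (Inl \<circ> t) j" by (elim rangeE) (simp add: t_def)
      qed
      have "Cauchy t" using s unfolding MCauchy_def st Cauchy_def by (simp add: d)
      then obtain l where "t \<longlonglongrightarrow> l" using convergent_eq_Cauchy by blast
      then have "limitin mtopology s (Inl l) sequentially"
        unfolding limit_metric_sequentially st using lim_sequentially[of t l] by (simp add: d)
      then show "\<exists>x. limitin mtopology s x sequentially" by blast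
    qed
  qed (auto simp: norm_mult intro: norm_triangle_ineq)
qed

section \<open>Continuous multilinear operators and homogeneous polynomials\<close>

text \<open>
  Operators are extensional functions, so that equality of operators is equality on the domain.
  An \<open>n\<close>-tuple is an element of a product indexed by \<open>{..<n}\<close>.
\<close>

definition multilinear ::
  "nat \<Rightarrow> (nat \<Rightarrow> ('k, 'v) nspace) \<Rightarrow> ('k, 'w) nspace \<Rightarrow> ((nat \<Rightarrow> 'v) \<Rightarrow> 'w) set" where
  "multilinear n E F =
     {A \<in> (\<Pi>\<^sub>E i\<in>{..<n}. carrier (E i)) \<rightarrow>\<^sub>E carrier F.
        \<forall>x\<in>(\<Pi>\<^sub>E i\<in>{..<n}. carrier (E i)). \<forall>i<n. \<forall>y\<in>carrier (E i). \<forall>z\<in>carrier (E i). \<forall>c.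
          A (x(i := y \<oplus>\<^bsub>E i\<^esub> z)) = A (x(i := y)) \<oplus>\<^bsub>F\<^esub> A (x(i := z)) \<and>
          A (x(i := c \<odot>\<^bsub>E i\<^esub> y)) = c \<odot>\<^bsub>F\<^esub> A (x(i := y))}"

definition cont_multilinear ::
  "nat \<Rightarrow> (nat \<Rightarrow> ('k, 'v) nspace) \<Rightarrow> ('k, 'w) nspace \<Rightarrow> ((nat \<Rightarrow> 'v) \<Rightarrow> 'w) set" where
  "cont_multilinear n E F =
     {A \<in> multilinear n E F.
        continuous_map (product_topology (\<lambda>i. ntopology (E i)) {..<n}) (ntopology F) A}"

definition multilinear_norm ::
  "nat \<Rightarrow> (nat \<Rightarrow> ('k, 'v) nspace) \<Rightarrow> ('k, 'w) nspace \<Rightarrow> ((nat \<Rightarrow> 'v) \<Rightarrow> 'w) \<Rightarrow> real" where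
  "multilinear_norm n E F A =
     Sup {nrm F (A x) | x. x \<in> (\<Pi>\<^sub>E i\<in>{..<n}. carrier (E i)) \<and> (\<forall>i<n. nrm (E i) (x i) \<le> 1)}"

definition cont_poly ::
  "nat \<Rightarrow> ('k, 'v) nspace \<Rightarrow> ('k, 'w) nspace \<Rightarrow> ('v \<Rightarrow> 'w) set" where
  "cont_poly n E F =
     {P \<in> carrier E \<rightarrow>\<^sub>E carrier F.
        (\<exists>A\<in>multilinear n (\<lambda>_. E) F. \<forall>x\<in>carrier E. P x = A (\<lambda>i\<in>{..<n}. x)) \<and>
        continuous_map (ntopology E) (ntopology F) P}"

definition poly_norm :: "('k, 'v) nspace \<Rightarrow> ('k, 'w) nspace \<Rightarrow> ('v \<Rightarrow> 'w) \<Rightarrow> real" where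
  "poly_norm E F P = Sup {nrm F (P x) | x. x \<in> carrier E \<and> nrm E x \<le> 1}"

definition dual :: "('k::{real_normed_field,banach}, 'v) nspace \<Rightarrow> ('v \<Rightarrow> 'k) set" where
  "dual E =
     {\<phi>. (\<forall>x\<in>carrier E. \<forall>y\<in>carrier E. \<phi> (x \<oplus>\<^bsub>E\<^esub> y) = \<phi> x + \<phi> y) \<and>
         (\<forall>c. \<forall>x\<in>carrier E. \<phi> (c \<odot>\<^bsub>E\<^esub> x) = c * \<phi> x) \<and>
         continuous_map (ntopology E) euclidean \<phi>}"

definition finite_type_poly ::
  "nat \<Rightarrow> ('k::{real_normed_field,banach}, 'v) nspace \<Rightarrow> ('k, 'w) nspace \<Rightarrow> ('v \<Rightarrow> 'w) set" where
  "finite_type_poly n E F =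
     {(\<lambda>x\<in>carrier E. \<Oplus>\<^bsub>F\<^esub>i\<in>{..<l}. c i \<odot>\<^bsub>F\<^esub> ((\<phi> i x) ^ n \<odot>\<^bsub>F\<^esub> b i)) | (l::nat) c \<phi> b.
        \<forall>i<l. \<phi> i \<in> dual E \<and> b i \<in> carrier F}"

section \<open>Sequence classes\<close>

text \<open>Sequences are indexed from \<open>0\<close>.\<close>

definition c00 :: "('k, 'v) nspace \<Rightarrow> (nat \<Rightarrow> 'v) set" where
  "c00 E = {x. (\<forall>j. x j \<in> carrier E) \<and> (\<exists>N. \<forall>j\<ge>N. x j = \<zero>\<^bsub>E\<^esub>)}"

definition ell_infty :: "('k, 'v) nspace \<Rightarrow> ('k, nat \<Rightarrow> 'v) nspace" where
  "ell_infty E = mk_nspace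
     {x. (\<forall>j. x j \<in> carrier E) \<and> bdd_above (range (\<lambda>j. nrm E (x j)))}
     (\<lambda>_. \<zero>\<^bsub>E\<^esub>) (\<lambda>x y j. x j \<oplus>\<^bsub>E\<^esub> y j) (\<lambda>c x j. c \<odot>\<^bsub>E\<^esub> x j) (\<lambda>x. SUP j. nrm E (x j))"

type_synonym ('k, 'a) seq_rule = "('k, 'k + 'a) nspace \<Rightarrow> ('k, nat \<Rightarrow> 'k + 'a) nspace"

text \<open>
  That \<open>X E\<close> consists of \<open>E\<close>-valued sequences with coordinatewise operations is contained in
  \<open>X E \<hookrightarrow> \<ell>\<^sub>\<infinity>(E)\<close>.
\<close>

definition sequence_class :: "('k::{real_normed_field,banach}, 'a) seq_rule \<Rightarrow> bool" where
  "sequence_class X \<longleftrightarrow>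
     (\<forall>E. banach_space E \<longrightarrow>
        banach_space (X E) \<and> c00 E \<subseteq> carrier (X E) \<and> nembedded (X E) (ell_infty E)) \<and>
     (\<forall>j. nrm (X scalar_space) (\<lambda>i. Inl (if i = j then 1 else 0)) = 1)"

text \<open>
  The operators induced between spaces of sequences. Membership of an induced operator in
  \<open>cont_multilinear\<close> or \<open>cont_poly\<close> includes that it takes values in the carrier of the codomain.
\<close>

definition induced_multilinear ::
  "('k, 'a) seq_rule \<Rightarrow> nat \<Rightarrow> (nat \<Rightarrow> ('k, 'k + 'a) nspace) \<Rightarrow> ((nat \<Rightarrow> 'k + 'a) \<Rightarrow> 'k + 'a)
    \<Rightarrow> (nat \<Rightarrow> nat \<Rightarrow> 'k + 'a) \<Rightarrow> nat \<Rightarrow> 'k + 'a" where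
  "induced_multilinear Y n E A =
     (\<lambda>x\<in>(\<Pi>\<^sub>E m\<in>{..<n}. carrier (Y (E m))). \<lambda>j. A (\<lambda>m\<in>{..<n}. x m j))"

definition induced_poly ::
  "('k, 'a) seq_rule \<Rightarrow> ('k, 'k + 'a) nspace \<Rightarrow> ('k + 'a \<Rightarrow> 'k + 'a)
    \<Rightarrow> (nat \<Rightarrow> 'k + 'a) \<Rightarrow> nat \<Rightarrow> 'k + 'a" where
  "induced_poly X E P = (\<lambda>x\<in>carrier (X E). \<lambda>j. P (x j))"

definition multilinearly_stable :: "('k::{real_normed_field,banach}, 'a) seq_rule \<Rightarrow> bool" where
  "multilinearly_stable Y \<longleftrightarrow>
     (\<forall>n\<ge>1. \<forall>E F. (\<forall>m<n. banach_space (E m)) \<longrightarrow> banach_space F \<longrightarrow>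
        (\<forall>A\<in>cont_multilinear n E F.
           induced_multilinear Y n E A \<in> cont_multilinear n (\<lambda>m. Y (E m)) (Y F) \<and>
           multilinear_norm n (\<lambda>m. Y (E m)) (Y F) (induced_multilinear Y n E A)
             = multilinear_norm n E F A))"

definition polynomially_stable :: "('k::{real_normed_field,banach}, 'a) seq_rule \<Rightarrow> bool" where
  "polynomially_stable X \<longleftrightarrow>
     (\<forall>n\<ge>1. \<forall>E F. banach_space E \<longrightarrow> banach_space F \<longrightarrow>
        (\<forall>P\<in>cont_poly n E F.
           induced_poly X E P \<in> cont_poly n (X E) (X F) \<and>
           poly_norm (X E) (X F) (induced_poly X E P) = poly_norm E F P))"

text \<open>\<open>X(\<K>)\<^sup>n \<hookrightarrow> Y(\<K>)\<close>\<close>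

definition power_embedded ::
  "nat \<Rightarrow> ('k::{real_normed_field,banach}, 'a) seq_rule \<Rightarrow> ('k, 'a) seq_rule \<Rightarrow> bool" where
  "power_embedded n X Y \<longleftrightarrow>
     (\<forall>a :: nat \<Rightarrow> nat \<Rightarrow> 'k. (\<forall>m<n. (\<lambda>j. Inl (a m j)) \<in> carrier (X scalar_space)) \<longrightarrow>
        (\<lambda>j. Inl (\<Prod>m<n. a m j)) \<in> carrier (Y scalar_space) \<and>
        nrm (Y scalar_space) (\<lambda>j. Inl (\<Prod>m<n. a m j))
          \<le> (\<Prod>m<n. nrm (X scalar_space) (\<lambda>j. Inl (a m j))))"

section \<open>Classes of polynomials\<close>

text \<open>
  A class of polynomials is given by the sets of its members \<open>E \<rightarrow> F\<close> (of any degree), and a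
  function on it by its values on these sets.
\<close>

type_synonym ('k, 'a) poly_class =
  "('k, 'k + 'a) nspace \<Rightarrow> ('k, 'k + 'a) nspace \<Rightarrow> ('k + 'a \<Rightarrow> 'k + 'a) set"

type_synonym ('k, 'a) poly_class_norm =
  "('k, 'k + 'a) nspace \<Rightarrow> ('k, 'k + 'a) nspace \<Rightarrow> ('k + 'a \<Rightarrow> 'k + 'a) \<Rightarrow> real"

definition component ::
  "('k::{real_normed_field,banach}, 'a) poly_class \<Rightarrow> nat
    \<Rightarrow> ('k, 'k + 'a) nspace \<Rightarrow> ('k, 'k + 'a) nspace \<Rightarrow> ('k + 'a \<Rightarrow> 'k + 'a) set" where
  "component Q n E F = cont_poly n E F \<inter> Q E F"

definition pointwise_space ::
  "('k, 'v) nspace \<Rightarrow> ('k, 'w) nspace \<Rightarrow> ('v \<Rightarrow> 'w) set \<Rightarrow> (('v \<Rightarrow> 'w) \<Rightarrow> real)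
    \<Rightarrow> ('k, 'v \<Rightarrow> 'w) nspace" where
  "pointwise_space E F S N = mk_nspace S (\<lambda>x\<in>carrier E. \<zero>\<^bsub>F\<^esub>)
     (\<lambda>P Q. \<lambda>x\<in>carrier E. P x \<oplus>\<^bsub>F\<^esub> Q x) (\<lambda>c P. \<lambda>x\<in>carrier E. c \<odot>\<^bsub>F\<^esub> P x) N"

text \<open>
  That \<open>component Q n E F\<close> is a linear subspace of \<open>cont_poly n E F\<close> on which \<open>N E F\<close> is a complete
  norm is expressed as: with the pointwise operations and this norm it is a Banach space.
\<close>

definition polynomial_two_sided_ideal ::
  "(nat \<Rightarrow> real) \<Rightarrow> (nat \<Rightarrow> real) \<Rightarrow> ('k::{real_normed_field,banach}, 'a) poly_class
    \<Rightarrow> ('k, 'a) poly_class_norm \<Rightarrow> bool" where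
  "polynomial_two_sided_ideal C K Q N \<longleftrightarrow>
     (\<forall>n\<ge>1. C n \<ge> 1 \<and> K n \<ge> 1) \<and> C 1 = 1 \<and> K 1 = 1 \<and>
     (\<forall>E F. banach_space E \<longrightarrow> banach_space F \<longrightarrow> Q E F \<subseteq> (\<Union>n\<in>{1..}. cont_poly n E F)) \<and>
     (\<forall>n\<ge>1. \<forall>E F. banach_space E \<longrightarrow> banach_space F \<longrightarrow>
        banach_space (pointwise_space E F (component Q n E F) (N E F)) \<and>
        finite_type_poly n E F \<subseteq> component Q n E F) \<and>
     (\<forall>n\<ge>1. N scalar_space scalar_space (\<lambda>x\<in>carrier scalar_space. Inl (projl x ^ n)) = 1) \<and>
     (\<forall>m\<ge>1. \<forall>n\<ge>1. \<forall>r\<ge>1. \<forall>E F G H.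
        banach_space E \<longrightarrow> banach_space F \<longrightarrow> banach_space G \<longrightarrow> banach_space H \<longrightarrow>
        (\<forall>P\<in>component Q n E F. \<forall>S\<in>cont_poly m G E. \<forall>R\<in>cont_poly r F H.
           (\<lambda>x\<in>carrier G. R (P (S x))) \<in> component Q (r * m * n) G H \<and>
           N G H (\<lambda>x\<in>carrier G. R (P (S x)))
             \<le> K r * C m ^ (r * n) * poly_norm F H R * N E F P ^ r * poly_norm G E S ^ (r * n)))"

definition summing_poly ::
  "('k::{real_normed_field,banach}, 'a) seq_rule \<Rightarrow> ('k, 'a) seq_rule \<Rightarrow> ('k, 'a) poly_class" where
  "summing_poly X Y E F =
     {P \<in> (\<Union>n\<in>{1..}. cont_poly n E F). \<forall>x\<in>carrier (X E). (\<lambda>j. P (x j)) \<in> carrier (Y F)}"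

definition summing_norm ::
  "('k::{real_normed_field,banach}, 'a) seq_rule \<Rightarrow> ('k, 'a) seq_rule
    \<Rightarrow> ('k, 'a) poly_class_norm" where
  "summing_norm X Y E F P = poly_norm (X E) (Y F) (induced_poly X E P)"

end

theory Submission
  imports Defs
begin

text \<open>
  Everything reduces to an inequality for induced maps. Polarization recovers an \<open>n\<close>-linear map
  \<open>A\<close> from \<open>P\<close> by a sum over signs; this costs the factor \<open>n\<^sup>n / n!\<close>, and it exhibits the values
  of the map induced by \<open>A\<close> as linear combinations of values of the map induced by \<open>P\<close>. Hence, if
  \<open>P\<close> maps \<open>X(E)\<close> into \<open>Y(F)\<close>, the induced polynomial is the diagonal of an \<open>n\<close>-linear map
  \<open>X(E)\<^sup>n \<rightarrow> Y(F)\<close> with closed graph in each variable (coordinates are continuous), and Baire's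
  theorem makes it bounded. If \<open>Y\<close> is multilinearly stable, the map induced by \<open>R\<close> has norm at
  most \<open>r\<^sup>r / r!\<close> times \<open>\<parallel>R\<parallel>\<close>; if \<open>Y\<close> is polynomially stable, at most \<open>\<parallel>R\<parallel>\<close>. Composing the
  induced maps gives the ideal inequality. For completeness, limits are taken coordinatewise, the
  limit being a polynomial because polarization commutes with pointwise limits. Finally
  \<open>x \<mapsto> \<phi>(x)\<^sup>n b\<close> factors through \<open>\<lambda> \<mapsto> \<lambda>\<^sup>n\<close>, which is summing by the compatibility of \<open>X\<close> and \<open>Y\<close>.
\<close>

section \<open>Normed vector arithmetic with explicit carriers\<close>

text \<open>\<open>summing_poly\<close> asks only for membership, and \<open>poly_norm\<close> is a
  \<open>Sup\<close> of reals, which carries no information before the set is known to be bounded.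
  So boundedness of the induced map comes before every estimate of its norm. It is proved for the
  polarized map because the closed graph argument lives on additivity in each slot, which a
  polynomial does not have.

  The multilinear map that \<open>cont_poly\<close> provides is an arbitrary choice and need be
  neither symmetric nor continuous. It therefore serves the algebra alone; where a bounded or
  convergent multilinear map is wanted, \<open>polar\<close> takes its place, an explicit formula in
  the polynomial.

  A sequence class fixes norms only for the scalar sequences \<open>e_j\<close>; it gives no upper
  bound for the norm of \<open>(v, 0, 0, ...)\<close> in \<open>X(E)\<close>. Stability of
  \<open>X\<close> under the degree 1 maps \<open>t -> t v\<close> bounds it by the norm of
  \<open>v\<close>. This ties the summing norm to the values of \<open>P\<close>, hence makes it
  definite and keeps limits bounded.

  The constants are asymmetric because the inner polynomial acts on \<open>X\<close>-sequences,
  where stability is lossless, and only the outer one acts on \<open>Y\<close>-sequences.\<close>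

lemma scalars_simps [simp]:
  "carrier scalars = UNIV" "\<one>\<^bsub>scalars\<^esub> = 1" "\<zero>\<^bsub>scalars\<^esub> = 0"
  "a \<oplus>\<^bsub>scalars\<^esub> b = a + b" "a \<otimes>\<^bsub>scalars\<^esub> b = a * b"
  by (simp_all add: scalars_def)

lemma (in abelian_monoid) finsum_cong_in:
  "A = B \<Longrightarrow> (\<And>i. i \<in> B \<Longrightarrow> f i = g i) \<Longrightarrow> (\<And>i. i \<in> B \<Longrightarrow> g i \<in> carrier G) \<Longrightarrow> finsum G f A = finsum G g B"
  by (rule finsum_cong') auto

lemma (in abelian_monoid) finsum_swap:
  assumes "finite A" "finite B" and "\<And>a b. a \<in> A \<Longrightarrow> b \<in> B \<Longrightarrow> f a b \<in> carrier G"
  shows "(\<Oplus>a\<in>A. \<Oplus>b\<in>B. f a b) = (\<Oplus>b\<in>B. \<Oplus>a\<in>A. f a b)"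
  using assms(1,3)
proof (induction A rule: finite_induct)
  case empty
  then show ?case by simp
next
  case (insert x A)
  have "(\<Oplus>a\<in>insert x A. \<Oplus>b\<in>B. f a b) = (\<Oplus>b\<in>B. f x b) \<oplus> (\<Oplus>b\<in>B. \<Oplus>a\<in>A. f a b)"
    using insert by (subst finsum_insert) (auto intro!: finsum_closed)
  also have "\<dots> = (\<Oplus>b\<in>B. f x b \<oplus> (\<Oplus>a\<in>A. f a b))"
    using insert by (subst finsum_addf) (auto intro!: finsum_closed)
  also have "\<dots> = (\<Oplus>b\<in>B. \<Oplus>a\<in>insert x A. f a b)"
    using insert by (intro finsum_cong') (auto intro!: finsum_closed simp: Pi_def)
  finally show ?case .
qed

lemma (in abelian_monoid) finsum_Sigma:
  assumes "finite A" "\<And>a. a \<in> A \<Longrightarrow> finite (B a)"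
    and "\<And>a b. a \<in> A \<Longrightarrow> b \<in> B a \<Longrightarrow> f a b \<in> carrier G"
  shows "(\<Oplus>a\<in>A. \<Oplus>b\<in>B a. f a b) = (\<Oplus>p\<in>Sigma A B. f (fst p) (snd p))"
  using assms
proof (induction A rule: finite_induct)
  case empty
  then show ?case by simp
next
  case (insert x A)
  have eq: "Sigma (insert x A) B = Pair x ` B x \<union> Sigma A B" by auto
  have "(\<Oplus>a\<in>insert x A. \<Oplus>b\<in>B a. f a b) = (\<Oplus>b\<in>B x. f x b) \<oplus> (\<Oplus>p\<in>Sigma A B. f (fst p) (snd p))"
    using insert by (subst finsum_insert) (auto intro!: finsum_closed)
  also have "(\<Oplus>b\<in>B x. f x b) = (\<Oplus>p\<in>Pair x ` B x. f (fst p) (snd p))"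
    using insert by (subst finsum_reindex) (auto simp: inj_on_def)
  finally show ?case
    unfolding eq using insert by (subst finsum_Un_disjoint) auto
qed

text \<open>The locale \<open>banach_space\<close> without completeness: completeness of spaces of polynomials is proved inside it.\<close>

locale normed_carrier = Module.module scalars E
  for E :: "('k::{real_normed_field,banach}, 'v) nspace" (structure) +
  assumes nrm_nonneg: "x \<in> carrier E \<Longrightarrow> 0 \<le> nrm E x"
    and nrm_eq_0_iff: "x \<in> carrier E \<Longrightarrow> nrm E x = 0 \<longleftrightarrow> x = \<zero>"
    and nrm_smult: "x \<in> carrier E \<Longrightarrow> nrm E (c \<odot> x) = norm c * nrm E x"
    and nrm_triangle: "x \<in> carrier E \<Longrightarrow> y \<in> carrier E \<Longrightarrow> nrm E (x \<oplus> y) \<le> nrm E x + nrm E y"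

sublocale banach_space \<subseteq> normed_carrier
  by unfold_locales (rule nrm_nonneg nrm_eq_0_iff nrm_smult nrm_triangle; assumption)+

context normed_carrier
begin

lemma smult_in [simp, intro]: "x \<in> carrier E \<Longrightarrow> c \<odot> x \<in> carrier E"
  using smult_closed by simp

lemma smult_add_left: "x \<in> carrier E \<Longrightarrow> (a + b) \<odot> x = a \<odot> x \<oplus> b \<odot> x"
  using smult_l_distr[of a b x] by simp

lemma smult_add_right: "x \<in> carrier E \<Longrightarrow> y \<in> carrier E \<Longrightarrow> c \<odot> (x \<oplus> y) = c \<odot> x \<oplus> c \<odot> y"
  using smult_r_distr by simp

lemma smult_smult [simp]: "x \<in> carrier E \<Longrightarrow> a \<odot> (b \<odot> x) = (a * b) \<odot> x"
  using smult_assoc1[of a b x] by simp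

lemma smult_1 [simp]: "x \<in> carrier E \<Longrightarrow> 1 \<odot> x = x"
  using smult_one by simp

lemma smult_0_left [simp]: "x \<in> carrier E \<Longrightarrow> 0 \<odot> x = \<zero>"
  using smult_l_null by simp

lemma smult_0_right [simp]: "c \<odot> \<zero> = \<zero>"
  using smult_r_null by simp

lemma uminus_eq: "x \<in> carrier E \<Longrightarrow> \<ominus> x = (- 1) \<odot> x"
  using smult_add_left[of x "-1" 1] by (intro M.minus_equality) auto

lemma minus_eq': "x \<in> carrier E \<Longrightarrow> y \<in> carrier E \<Longrightarrow> x \<ominus> y = x \<oplus> (- 1) \<odot> y"
  by (simp add: a_minus_def uminus_eq)

lemma minus_zero_right [simp]: "x \<in> carrier E \<Longrightarrow> x \<ominus> \<zero> = x"
  by (simp add: minus_eq')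

lemma smult_uminus [simp]: "x \<in> carrier E \<Longrightarrow> c \<odot> (\<ominus> x) = \<ominus> (c \<odot> x)"
  by (simp add: uminus_eq)

lemma smult_minus: "x \<in> carrier E \<Longrightarrow> y \<in> carrier E \<Longrightarrow> c \<odot> (x \<ominus> y) = c \<odot> x \<ominus> c \<odot> y"
  by (simp add: a_minus_def smult_add_right)

lemma minus_self [simp]: "x \<in> carrier E \<Longrightarrow> x \<ominus> x = \<zero>"
  by (simp add: a_minus_def M.r_neg)

lemma minus_add_cancel [simp]: "x \<in> carrier E \<Longrightarrow> y \<in> carrier E \<Longrightarrow> (x \<ominus> y) \<oplus> y = x"
  by (simp add: a_minus_def M.a_assoc M.l_neg)

lemma minus_zero_iff: "x \<in> carrier E \<Longrightarrow> y \<in> carrier E \<Longrightarrow> x \<ominus> y = \<zero> \<longleftrightarrow> x = y"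
  by (metis M.l_zero minus_add_cancel minus_self)

lemma minus_trans: "x \<in> carrier E \<Longrightarrow> y \<in> carrier E \<Longrightarrow> z \<in> carrier E \<Longrightarrow> x \<ominus> z = (x \<ominus> y) \<oplus> (y \<ominus> z)"
  by (metis M.minus_closed a_minus_def M.a_assoc M.a_inv_closed minus_add_cancel)

lemma minus_add_distrib:
  assumes "x \<in> carrier E" "y \<in> carrier E" "z \<in> carrier E" "w \<in> carrier E"
  shows "(x \<oplus> y) \<ominus> (z \<oplus> w) = (x \<ominus> z) \<oplus> (y \<ominus> w)"
  using assms by (simp add: a_minus_def M.minus_add M.a_ac)

lemma smult_finsum: "finite A \<Longrightarrow> f \<in> A \<rightarrow> carrier E \<Longrightarrow> c \<odot> finsum E f A = (\<Oplus>i\<in>A. c \<odot> f i)"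
  by (rule finsum_smult_ldistr) auto

lemma finsum_smult_left: "finite A \<Longrightarrow> x \<in> carrier E \<Longrightarrow> (\<Oplus>i\<in>A. c i \<odot> x) = sum c A \<odot> x"
  by (induction A rule: finite_induct) (auto simp: smult_add_left)

lemma nrm_zero [simp]: "nrm E \<zero> = 0"
  by (simp add: nrm_eq_0_iff)

lemma nrm_uminus [simp]: "x \<in> carrier E \<Longrightarrow> nrm E (\<ominus> x) = nrm E x"
  by (simp add: uminus_eq nrm_smult)

lemma nrm_minus_commute: "x \<in> carrier E \<Longrightarrow> y \<in> carrier E \<Longrightarrow> nrm E (x \<ominus> y) = nrm E (y \<ominus> x)"
  using nrm_uminus[of "x \<ominus> y"] by (simp add: a_minus_def M.minus_add M.a_ac)

lemma nrm_minus_triangle: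
  "x \<in> carrier E \<Longrightarrow> y \<in> carrier E \<Longrightarrow> z \<in> carrier E \<Longrightarrow> nrm E (x \<ominus> z) \<le> nrm E (x \<ominus> y) + nrm E (y \<ominus> z)"
  by (metis M.minus_closed minus_trans nrm_triangle)

lemma nrm_minus_le: "x \<in> carrier E \<Longrightarrow> y \<in> carrier E \<Longrightarrow> nrm E (x \<ominus> y) \<le> nrm E x + nrm E y"
  by (metis M.a_inv_closed a_minus_def nrm_triangle nrm_uminus)

lemma nrm_le_minus_add: "x \<in> carrier E \<Longrightarrow> y \<in> carrier E \<Longrightarrow> nrm E x \<le> nrm E (x \<ominus> y) + nrm E y"
  by (metis M.minus_closed minus_add_cancel nrm_triangle)

lemma nrm_finsum: "finite A \<Longrightarrow> f \<in> A \<rightarrow> carrier E \<Longrightarrow> nrm E (finsum E f A) \<le> (\<Sum>i\<in>A. nrm E (f i))"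
proof (induction A rule: finite_induct)
  case (insert x A)
  then show ?case using nrm_triangle[of "f x" "finsum E f A"] by (auto simp: Pi_def)
qed simp

lemma normalize:
  assumes "x \<in> carrier E"
  obtains u where "u \<in> carrier E" "nrm E u \<le> 1" "x = of_real (nrm E x) \<odot> u"
proof
  \<comment> \<open>Since \<open>inverse 0 = 0\<close>, the zero vector gets \<open>u = 0\<close>,
    so uses of the lemma need no separate case for it.\<close>
  let ?u = "of_real (inverse (nrm E x)) \<odot> x"
  show "?u \<in> carrier E" using assms by simp
  show "nrm E ?u \<le> 1" using assms nrm_nonneg[OF assms]
    by (cases "nrm E x = 0") (simp_all add: nrm_smult norm_inverse)
  show "x = of_real (nrm E x) \<odot> ?u" using assms nrm_eq_0_iff[OF assms]
    by (cases "nrm E x = 0") (simp_all flip: of_real_mult)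
qed

sublocale Metric_space "carrier E" "ndist E"
proof
  show "0 \<le> ndist E x y" for x y by (simp add: ndist_def nrm_nonneg)
  show "ndist E x y = ndist E y x" for x y by (auto simp: ndist_def nrm_minus_commute)
  show "x \<in> carrier E \<Longrightarrow> y \<in> carrier E \<Longrightarrow> (ndist E x y = 0) = (x = y)" for x y
    by (simp add: ndist_def nrm_eq_0_iff minus_zero_iff)
  show "x \<in> carrier E \<Longrightarrow> y \<in> carrier E \<Longrightarrow> z \<in> carrier E \<Longrightarrow> ndist E x z \<le> ndist E x y + ndist E y z" for x y z
    by (simp add: ndist_def nrm_minus_triangle)
qed

lemma ntopology_eq: "ntopology E = mtopology"
  by (simp add: ntopology_def)

lemma topspace_ntopology [simp]: "topspace (ntopology E) = carrier E"
  by (simp add: ntopology_eq)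

end

section \<open>Convergence and Cauchy sequences in terms of the norm\<close>

definition nlim :: "('k, 'v) nspace \<Rightarrow> (nat \<Rightarrow> 'v) \<Rightarrow> 'v \<Rightarrow> bool" where
  "nlim E s x \<longleftrightarrow> (\<forall>k. s k \<in> carrier E) \<and> x \<in> carrier E \<and> (\<lambda>k. nrm E (s k \<ominus>\<^bsub>E\<^esub> x)) \<longlonglongrightarrow> 0"

definition ncauchy :: "('k, 'v) nspace \<Rightarrow> (nat \<Rightarrow> 'v) \<Rightarrow> bool" where
  "ncauchy E s \<longleftrightarrow> (\<forall>k. s k \<in> carrier E) \<and>
     (\<forall>e>0. \<exists>N. \<forall>k\<ge>N. \<forall>l\<ge>N. nrm E (s k \<ominus>\<^bsub>E\<^esub> s l) < e)"

context normed_carrier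
begin

lemma ncauchy_iff: "ncauchy E s \<longleftrightarrow> MCauchy s"
  by (auto simp: ncauchy_def MCauchy_def ndist_def image_subset_iff)

text \<open>\<open>limitin\<close> constrains only eventually all terms; \<open>nlim\<close> places
  every term in the carrier, so that the norms of differences make sense from the start.\<close>

lemma nlim_iff: "nlim E s x \<longleftrightarrow> range s \<subseteq> carrier E \<and> limitin mtopology s x sequentially"
proof -
  have "(\<lambda>k. nrm E (s k \<ominus> x)) \<longlonglongrightarrow> 0 \<longleftrightarrow> (\<forall>e>0. \<exists>N. \<forall>k\<ge>N. nrm E (s k \<ominus> x) < e)"
    if "\<forall>k. s k \<in> carrier E" "x \<in> carrier E"
    using that by (simp add: lim_sequentially nrm_nonneg)
  then show ?thesis
    by (auto simp: nlim_def limit_metric_sequentially ndist_def image_subset_iff)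
qed

lemma banach_spaceI:
  assumes "\<And>s. ncauchy E s \<Longrightarrow> \<exists>x. nlim E s x"
  shows "banach_space E"
proof (intro banach_space.intro banach_space_axioms.intro)
  show "Module.module scalars E" ..
  show "mcomplete" unfolding mcomplete_def using assms by (auto simp: ncauchy_iff nlim_iff)
qed (auto simp: nrm_nonneg nrm_eq_0_iff nrm_smult nrm_triangle)

lemma nlim_unique: "nlim E s x \<Longrightarrow> nlim E s y \<Longrightarrow> x = y"
  by (meson limitin_metric_unique nlim_iff trivial_limit_sequentially)

lemma nlimI:
  assumes "\<And>k. s k \<in> carrier E" "x \<in> carrier E" "\<And>k. nrm E (s k \<ominus> x) \<le> b k" "b \<longlonglongrightarrow> 0"
  shows "nlim E s x"
  unfolding nlim_def
  using assms by (auto intro: tendsto_sandwich[of "\<lambda>_. 0" _ _ b] simp: nrm_nonneg)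

lemma nlim_add:
  assumes "nlim E s x" "nlim E t y"
  shows "nlim E (\<lambda>k. s k \<oplus> t k) (x \<oplus> y)"
proof (rule nlimI)
  show "(\<lambda>k. nrm E (s k \<ominus> x) + nrm E (t k \<ominus> y)) \<longlonglongrightarrow> 0"
    using assms by (auto simp: nlim_def intro: tendsto_eq_intros)
qed (use assms in \<open>auto simp: nlim_def minus_add_distrib nrm_triangle\<close>)

lemma nlim_smult:
  assumes "nlim E s x"
  shows "nlim E (\<lambda>k. c \<odot> s k) (c \<odot> x)"
proof (rule nlimI)
  show "(\<lambda>k. norm c * nrm E (s k \<ominus> x)) \<longlonglongrightarrow> 0"
    using assms by (auto simp: nlim_def intro: tendsto_eq_intros)
qed (use assms in \<open>auto simp: nlim_def nrm_smult simp flip: smult_minus\<close>)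

lemma nlim_minus:
  assumes "nlim E s x" "nlim E t y"
  shows "nlim E (\<lambda>k. s k \<ominus> t k) (x \<ominus> y)"
proof -
  have "(\<lambda>k. s k \<ominus> t k) = (\<lambda>k. s k \<oplus> (- 1) \<odot> t k)" "x \<ominus> y = x \<oplus> (- 1) \<odot> y"
    using assms by (auto simp: nlim_def minus_eq')
  then show ?thesis using nlim_add[OF assms(1) nlim_smult[OF assms(2), of "- 1"]] by (simp only:)
qed

lemma nlim_shift: "nlim E s x \<Longrightarrow> nlim E (\<lambda>k. s (k + N)) x"
  using LIMSEQ_ignore_initial_segment[of "\<lambda>k. nrm E (s k \<ominus> x)" 0 N] by (simp add: nlim_def)

lemma nlim_const: "x \<in> carrier E \<Longrightarrow> nlim E (\<lambda>_. x) x"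
  by (simp add: nlim_def)

lemma nlim_finsum:
  assumes "finite A" "\<And>i. i \<in> A \<Longrightarrow> nlim E (\<lambda>k. s k i) (x i)"
  shows "nlim E (\<lambda>k. \<Oplus>i\<in>A. s k i) (\<Oplus>i\<in>A. x i)"
  using assms
proof (induction A rule: finite_induct)
  case (insert a A)
  then have "nlim E (\<lambda>k. s k a \<oplus> (\<Oplus>i\<in>A. s k i)) (x a \<oplus> (\<Oplus>i\<in>A. x i))"
    by (intro nlim_add) auto
  moreover have "(\<lambda>k. \<Oplus>i\<in>insert a A. s k i) = (\<lambda>k. s k a \<oplus> (\<Oplus>i\<in>A. s k i))"
    using insert by (intro ext M.finsum_insert) (auto simp: nlim_def)
  moreover have "(\<Oplus>i\<in>insert a A. x i) = x a \<oplus> (\<Oplus>i\<in>A. x i)"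
    using insert by (intro M.finsum_insert) (auto simp: nlim_def)
  ultimately show ?case by simp
qed (simp add: nlim_const)

lemma nlim_nrm: "nlim E s x \<Longrightarrow> (\<lambda>k. nrm E (s k)) \<longlonglongrightarrow> nrm E x"
proof -
  assume s: "nlim E s x"
  have "norm (nrm E (s k) - nrm E x) \<le> nrm E (s k \<ominus> x)" for k
    using s nrm_le_minus_add[of "s k" x] nrm_le_minus_add[of x "s k"] nrm_minus_commute[of x "s k"]
    by (auto simp: nlim_def)
  moreover have "(\<lambda>k. nrm E (s k \<ominus> x)) \<longlonglongrightarrow> 0" using s by (simp add: nlim_def)
  ultimately have "(\<lambda>k. nrm E (s k) - nrm E x) \<longlonglongrightarrow> 0"
    by (rule Lim_null_comparison[OF always_eventually, OF allI])
  then show ?thesis by (simp add: LIM_zero_iff)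
qed

lemma nlim_nrm_le: "nlim E s x \<Longrightarrow> (\<And>k. nrm E (s k) \<le> C) \<Longrightarrow> nrm E x \<le> C"
  using nlim_nrm by (rule LIMSEQ_le_const2) auto

end

lemma (in banach_space) ncauchy_nlim: "ncauchy E s \<Longrightarrow> \<exists>x. nlim E s x"
  using complete by (auto simp: ncauchy_iff nlim_iff mcomplete_def MCauchy_def)

section \<open>Multilinear maps and polarization\<close>

text \<open>The carrier types are arbitrary so that the same facts serve for \<open>E\<close>,
  \<open>F\<close> and for the sequence spaces \<open>X E\<close>, \<open>Y F\<close>.\<close>

locale banach_pair = E: banach_space E + F: banach_space F
  for E :: "('k::{real_normed_field,banach}, 'v) nspace" and F :: "('k, 'w) nspace"

abbreviation tuples :: "nat \<Rightarrow> ('k, 'v) nspace \<Rightarrow> (nat \<Rightarrow> 'v) set" where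
  "tuples n E \<equiv> {..<n} \<rightarrow>\<^sub>E carrier E"

lemma tuples_upd: "x \<in> tuples n E \<Longrightarrow> i < n \<Longrightarrow> y \<in> carrier E \<Longrightarrow> x(i := y) \<in> tuples n E"
  by (auto simp: PiE_iff extensional_def)

lemma tuples_mem [simp]: "x \<in> tuples n E \<Longrightarrow> i < n \<Longrightarrow> x i \<in> carrier E"
  by auto

text \<open>All arguments come from one space, the case that polynomials and their polarizations
  produce.\<close>

locale multilinear_map = banach_pair E F
  for E :: "('k::{real_normed_field,banach}, 'v) nspace" and F :: "('k, 'w) nspace" +
  fixes n :: nat and A :: "(nat \<Rightarrow> 'v) \<Rightarrow> 'w"
  assumes multilinear: "A \<in> multilinear n (\<lambda>_. E) F"
begin

lemma closed [simp]: "x \<in> tuples n E \<Longrightarrow> A x \<in> carrier F"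
  using multilinear by (auto simp: multilinear_def)

lemma slot_closed: "x \<in> tuples n E \<Longrightarrow> i < n \<Longrightarrow> y \<in> carrier E \<Longrightarrow> A (x(i := y)) \<in> carrier F"
  by (rule closed, rule tuples_upd)

lemma slot_add:
  "x \<in> tuples n E \<Longrightarrow> i < n \<Longrightarrow> y \<in> carrier E \<Longrightarrow> z \<in> carrier E \<Longrightarrow>
    A (x(i := y \<oplus>\<^bsub>E\<^esub> z)) = A (x(i := y)) \<oplus>\<^bsub>F\<^esub> A (x(i := z))"
  using multilinear by (auto simp: multilinear_def)

lemma slot_smult:
  "x \<in> tuples n E \<Longrightarrow> i < n \<Longrightarrow> y \<in> carrier E \<Longrightarrow> A (x(i := c \<odot>\<^bsub>E\<^esub> y)) = c \<odot>\<^bsub>F\<^esub> A (x(i := y))"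
  using multilinear by (auto simp: multilinear_def)

lemma slot_zero: "x \<in> tuples n E \<Longrightarrow> i < n \<Longrightarrow> A (x(i := \<zero>\<^bsub>E\<^esub>)) = \<zero>\<^bsub>F\<^esub>"
  using slot_smult[of x i "\<zero>\<^bsub>E\<^esub>" 0] by (simp add: tuples_upd)

lemma slot_minus:
  assumes "x \<in> tuples n E" "i < n" "y \<in> carrier E" "z \<in> carrier E"
  shows "A (x(i := y \<ominus>\<^bsub>E\<^esub> z)) = A (x(i := y)) \<ominus>\<^bsub>F\<^esub> A (x(i := z))"
  using assms by (simp add: E.minus_eq' F.minus_eq' slot_add slot_smult tuples_upd)

lemma slot_finsum:
  assumes "finite J" "x \<in> tuples n E" "i < n" "\<And>j. j \<in> J \<Longrightarrow> f j \<in> carrier E"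
  shows "A (x(i := \<Oplus>\<^bsub>E\<^esub>j\<in>J. f j)) = (\<Oplus>\<^bsub>F\<^esub>j\<in>J. A (x(i := f j)))"
  using assms(1,4)
proof (induction J rule: finite_induct)
  case empty
  show ?case using slot_zero[OF assms(2,3)] by (simp only: E.M.finsum_empty F.M.finsum_empty)
next
  case (insert j J)
  have "(\<Oplus>\<^bsub>E\<^esub>j\<in>insert j J. f j) = f j \<oplus>\<^bsub>E\<^esub> (\<Oplus>\<^bsub>E\<^esub>j\<in>J. f j)"
    using insert by (intro E.M.finsum_insert) auto
  moreover have "(\<Oplus>\<^bsub>F\<^esub>j\<in>insert j J. A (x(i := f j))) = A (x(i := f j)) \<oplus>\<^bsub>F\<^esub> (\<Oplus>\<^bsub>F\<^esub>j\<in>J. A (x(i := f j)))"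
    using insert assms(2,3) by (intro F.M.finsum_insert) (auto intro!: closed tuples_upd)
  moreover have "A (x(i := f j \<oplus>\<^bsub>E\<^esub> (\<Oplus>\<^bsub>E\<^esub>j\<in>J. f j))) = A (x(i := f j)) \<oplus>\<^bsub>F\<^esub> A (x(i := \<Oplus>\<^bsub>E\<^esub>j\<in>J. f j))"
    using insert assms(2,3) by (intro slot_add E.M.finsum_closed) auto
  ultimately show ?case using insert.IH insert.prems by (metis insertCI)
qed

text \<open>Induction over the slots: those below \<open>k\<close> are expanded, the others are
  frozen at \<open>w\<close>. In the step, slot \<open>k\<close> first counts as frozen with the
  whole sum as its value, which is why \<open>w\<close> is arbitrary in the induction; afterwards
  this slot is expanded by additivity.\<close>

lemma expand_partial:
  assumes J: "finite J" "\<And>j. j \<in> J \<Longrightarrow> x j \<in> carrier E" and "k \<le> n" "w \<in> tuples n E"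
  shows "A (\<lambda>i\<in>{..<n}. if i < k then \<Oplus>\<^bsub>E\<^esub>j\<in>J. c j \<odot>\<^bsub>E\<^esub> x j else w i) =
    (\<Oplus>\<^bsub>F\<^esub>f\<in>{..<k} \<rightarrow>\<^sub>E J. (\<Prod>i<k. c (f i)) \<odot>\<^bsub>F\<^esub> A (\<lambda>i\<in>{..<n}. if i < k then x (f i) else w i))"
  using assms(3,4)
proof (induction k arbitrary: w)
  case 0
  have "restrict w {..<n} = w" using 0 by (auto simp: PiE_iff extensional_restrict)
  then show ?case using 0 by (simp add: F.M.finsum_insert)
next
  case (Suc k)
  let ?v = "\<Oplus>\<^bsub>E\<^esub>j\<in>J. c j \<odot>\<^bsub>E\<^esub> x j"
  let ?P = "{..<k} \<rightarrow>\<^sub>E J"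
  let ?T = "\<lambda>f. \<lambda>i\<in>{..<n}. if i < k then x (f i) else w i"
  define G where "G = (\<lambda>g. (\<Prod>i<Suc k. c (g i)) \<odot>\<^bsub>F\<^esub> A (\<lambda>i\<in>{..<n}. if i < Suc k then x (g i) else w i))"
  have k: "k < n" and w: "w \<in> tuples n E" using Suc by auto
  have v: "?v \<in> carrier E" using J by (intro E.M.finsum_closed) auto
  have fin: "finite ?P" using J by (intro finite_PiE) auto
  have T: "?T f \<in> tuples n E" if "f \<in> ?P" for f
    using that w J by (auto simp: PiE_iff)
  have g: "G f \<in> carrier F" if "f \<in> {..<Suc k} \<rightarrow>\<^sub>E J" for f
    unfolding G_def using that w J by (intro F.smult_in closed) (auto simp: PiE_iff)
  have upd: "f(k := j) \<in> {..<Suc k} \<rightarrow>\<^sub>E J" if "f \<in> ?P" "j \<in> J" for f j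
    using that by (auto simp: PiE_iff extensional_def)
  have "(\<lambda>i\<in>{..<n}. if i < Suc k then ?v else w i) = (\<lambda>i\<in>{..<n}. if i < k then ?v else (w(k := ?v)) i)"
    by (auto simp: less_Suc_eq)
  then have "A (\<lambda>i\<in>{..<n}. if i < Suc k then ?v else w i) =
    (\<Oplus>\<^bsub>F\<^esub>f\<in>?P. (\<Prod>i<k. c (f i)) \<odot>\<^bsub>F\<^esub> A (\<lambda>i\<in>{..<n}. if i < k then x (f i) else (w(k := ?v)) i))"
    using Suc.IH[OF less_imp_le[OF k] tuples_upd[OF w k v]] by (simp only:)
  also have "\<dots> = (\<Oplus>\<^bsub>F\<^esub>f\<in>?P. \<Oplus>\<^bsub>F\<^esub>j\<in>J. G (f(k := j)))"
  proof (rule F.M.finsum_cong')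
    fix f assume f: "f \<in> ?P"
    have "(\<lambda>i\<in>{..<n}. if i < k then x (f i) else (w(k := ?v)) i) = (?T f)(k := ?v)"
      using k by auto
    then have "A (\<lambda>i\<in>{..<n}. if i < k then x (f i) else (w(k := ?v)) i) = (\<Oplus>\<^bsub>F\<^esub>j\<in>J. A ((?T f)(k := c j \<odot>\<^bsub>E\<^esub> x j)))"
      using slot_finsum[OF J(1) T[OF f] k, of "\<lambda>j. c j \<odot>\<^bsub>E\<^esub> x j"] J by simp
    also have "(\<Prod>i<k. c (f i)) \<odot>\<^bsub>F\<^esub> \<dots> = (\<Oplus>\<^bsub>F\<^esub>j\<in>J. (\<Prod>i<k. c (f i)) \<odot>\<^bsub>F\<^esub> A ((?T f)(k := c j \<odot>\<^bsub>E\<^esub> x j)))"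
      by (intro F.smult_finsum J(1) Pi_I slot_closed T f k E.smult_in J(2))
    also have "\<dots> = (\<Oplus>\<^bsub>F\<^esub>j\<in>J. G (f(k := j)))"
    proof (rule F.M.finsum_cong')
      fix j assume j: "j \<in> J"
      have "(\<lambda>i\<in>{..<n}. if i < Suc k then x ((f(k := j)) i) else w i) = (?T f)(k := x j)"
        using k by (auto simp: less_Suc_eq)
      then show "(\<Prod>i<k. c (f i)) \<odot>\<^bsub>F\<^esub> A ((?T f)(k := c j \<odot>\<^bsub>E\<^esub> x j)) = G (f(k := j))"
        using slot_smult[OF T[OF f] k J(2)[OF j], of "c j"] slot_closed[OF T[OF f] k J(2)[OF j]]
        by (simp add: mult.commute G_def)
    next
      show "(\<lambda>j. G (f(k := j))) \<in> J \<rightarrow> carrier F" by (intro Pi_I g upd f)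
    qed simp
    finally show "(\<Prod>i<k. c (f i)) \<odot>\<^bsub>F\<^esub> A (\<lambda>i\<in>{..<n}. if i < k then x (f i) else (w(k := ?v)) i) =
      (\<Oplus>\<^bsub>F\<^esub>j\<in>J. G (f(k := j)))" .
  next
    show "(\<lambda>f. \<Oplus>\<^bsub>F\<^esub>j\<in>J. G (f(k := j))) \<in> ?P \<rightarrow> carrier F"
      by (intro Pi_I F.M.finsum_closed g upd)
  qed simp
  also have "\<dots> = (\<Oplus>\<^bsub>F\<^esub>j\<in>J. \<Oplus>\<^bsub>F\<^esub>f\<in>?P. G (f(k := j)))"
    by (intro F.M.finsum_swap J fin g upd)
  also have "\<dots> = (\<Oplus>\<^bsub>F\<^esub>p\<in>J \<times> ?P. G ((snd p)(k := fst p)))"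
    by (intro F.M.finsum_Sigma J fin g upd)
  also have "\<dots> = (\<Oplus>\<^bsub>F\<^esub>p\<in>J \<times> ?P. G ((\<lambda>(y, f). f(k := y)) p))"
    by (simp only: case_prod_unfold)
  \<comment> \<open>A function on \<open>{..<Suc k}\<close> is one on \<open>{..<k}\<close> together
    with its value at \<open>k\<close>, so the double sum is a single sum over the larger function
    space.\<close>
  also have "\<dots> = (\<Oplus>\<^bsub>F\<^esub>f\<in>(\<lambda>(y, f). f(k := y)) ` (J \<times> ?P). G f)"
    using g upd inj_combinator[of k "{..<k}" "\<lambda>_. J"]
    by (intro F.M.finsum_reindex[symmetric]) auto
  also have "(\<lambda>(y, f). f(k := y)) ` (J \<times> ?P) = {..<Suc k} \<rightarrow>\<^sub>E J"
    by (simp add: lessThan_Suc PiE_insert_eq)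
  finally show ?case unfolding G_def .
qed

lemma expand:
  assumes "finite J" "\<And>j. j \<in> J \<Longrightarrow> x j \<in> carrier E"
  shows "A (\<lambda>i\<in>{..<n}. \<Oplus>\<^bsub>E\<^esub>j\<in>J. c j \<odot>\<^bsub>E\<^esub> x j) =
    (\<Oplus>\<^bsub>F\<^esub>f\<in>{..<n} \<rightarrow>\<^sub>E J. (\<Prod>i<n. c (f i)) \<odot>\<^bsub>F\<^esub> A (\<lambda>i\<in>{..<n}. x (f i)))"
proof -
  have *: "(\<lambda>i\<in>{..<n}. if i < n then a i else b i) = (\<lambda>i\<in>{..<n}. a i)" for a b :: "nat \<Rightarrow> 'v"
    by auto
  show ?thesis
    using expand_partial[OF assms order.refl, where w = "\<lambda>i\<in>{..<n}. \<zero>\<^bsub>E\<^esub>" and c = c] unfolding * by simp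
qed

lemma scale:
  assumes x: "x \<in> tuples n E"
  shows "A (\<lambda>i\<in>{..<n}. c i \<odot>\<^bsub>E\<^esub> x i) = (\<Prod>i<n. c i) \<odot>\<^bsub>F\<^esub> A x"
proof -
  have "A (\<lambda>i\<in>{..<n}. if i < k then c i \<odot>\<^bsub>E\<^esub> x i else x i) = (\<Prod>i<k. c i) \<odot>\<^bsub>F\<^esub> A x" if "k \<le> n" for k
    using that
  proof (induction k)
    case 0
    have "restrict x {..<n} = x" using x by (auto simp: PiE_iff extensional_restrict)
    then show ?case using x by simp
  next
    case (Suc k)
    let ?m = "\<lambda>k. \<lambda>i\<in>{..<n}. if i < k then c i \<odot>\<^bsub>E\<^esub> x i else x i"
    have m: "?m k \<in> tuples n E" using x by auto
    have k: "k < n" "x k \<in> carrier E" using Suc.prems x by auto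
    have "A (?m (Suc k)) = A ((?m k)(k := c k \<odot>\<^bsub>E\<^esub> x k))"
      using k by (intro arg_cong[of _ _ A]) (auto simp: less_Suc_eq)
    also have "\<dots> = c k \<odot>\<^bsub>F\<^esub> A ((?m k)(k := x k))"
      by (rule slot_smult[OF m k])
    also have "(?m k)(k := x k) = ?m k"
      using k by auto
    also have "A (?m k) = (\<Prod>i<k. c i) \<odot>\<^bsub>F\<^esub> A x"
      using k by (intro Suc.IH) simp
    finally show ?case using x by (simp add: mult.commute)
  qed
  from this[of n] have "A (\<lambda>i\<in>{..<n}. if i < n then c i \<odot>\<^bsub>E\<^esub> x i else x i) = (\<Prod>i<n. c i) \<odot>\<^bsub>F\<^esub> A x"
    by simp
  also have "(\<lambda>i\<in>{..<n}. if i < n then c i \<odot>\<^bsub>E\<^esub> x i else x i) = (\<lambda>i\<in>{..<n}. c i \<odot>\<^bsub>E\<^esub> x i)"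
    by auto
  finally show ?thesis .
qed

text \<open>Follows from multilinearity alone by pulling the norms out of the slots, so it is
  available before continuity is known, in particular for the map delivered by the closed graph
  argument.\<close>

lemma bound_from_ball:
  assumes C: "\<And>x. x \<in> tuples n E \<Longrightarrow> (\<And>i. i < n \<Longrightarrow> nrm E (x i) \<le> 1) \<Longrightarrow> nrm F (A x) \<le> C"
    and x: "x \<in> tuples n E"
  shows "nrm F (A x) \<le> C * (\<Prod>i<n. nrm E (x i))"
proof -
  have "\<exists>u. u \<in> carrier E \<and> nrm E u \<le> 1 \<and> x i = of_real (nrm E (x i)) \<odot>\<^bsub>E\<^esub> u" if "i < n" for i
    using E.normalize[of "x i"] x that by (metis tuples_mem)
  then obtain u where u: "\<And>i. i < n \<Longrightarrow> u i \<in> carrier E \<and> nrm E (u i) \<le> 1 \<and> x i = of_real (nrm E (x i)) \<odot>\<^bsub>E\<^esub> u i"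
    by metis
  let ?u = "\<lambda>i\<in>{..<n}. u i"
  have uin: "?u \<in> tuples n E" using u by auto
  have "x = (\<lambda>i\<in>{..<n}. of_real (nrm E (x i)) \<odot>\<^bsub>E\<^esub> ?u i)"
    using x u by (intro extensionalityI[of _ "{..<n}"]) (auto simp: PiE_iff)
  then have "nrm F (A x) = nrm F ((\<Prod>i<n. of_real (nrm E (x i))) \<odot>\<^bsub>F\<^esub> A ?u)"
    using scale[OF uin, of "\<lambda>i. of_real (nrm E (x i))"] by simp
  also have "\<dots> = (\<Prod>i<n. nrm E (x i)) * nrm F (A ?u)"
    using x by (subst F.nrm_smult[OF closed[OF uin]])
      (auto simp: E.nrm_nonneg simp flip: prod_norm intro!: prod.cong)
  also have "\<dots> \<le> (\<Prod>i<n. nrm E (x i)) * C"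
    using x u C[OF uin] by (intro mult_left_mono prod_nonneg) (auto simp: E.nrm_nonneg)
  finally show ?thesis by (simp add: mult.commute)
qed

end

section \<open>The polarization formula\<close>

abbreviation diag :: "nat \<Rightarrow> 'v \<Rightarrow> nat \<Rightarrow> 'v" where
  "diag n x \<equiv> \<lambda>i\<in>{..<n}. x"

text \<open>Sign vectors are encoded by the set of their negative entries, so that a sum over all
  signs is a sum over \<open>Pow {..<n}\<close>.\<close>

definition subset_sign :: "nat set \<Rightarrow> nat \<Rightarrow> 'k::ring_1" where
  "subset_sign S i = (if i \<in> S then - 1 else 1)"

text \<open>The polarization formula. As a finite sum of values of \<open>P\<close>, and not a
  chosen multilinear map, it passes to pointwise limits and can be computed coordinatewise for maps
  between sequence spaces.\<close>

definition polar :: "nat \<Rightarrow> ('k::{real_normed_field,banach}, 'v) nspace \<Rightarrow> ('k, 'w) nspace \<Rightarrow> ('v \<Rightarrow> 'w) \<Rightarrow> (nat \<Rightarrow> 'v) \<Rightarrow> 'w" where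
  "polar n E F P = (\<lambda>x\<in>tuples n E. inverse (2 ^ n * fact n) \<odot>\<^bsub>F\<^esub>
     (\<Oplus>\<^bsub>F\<^esub>S\<in>Pow {..<n}. (\<Prod>i<n. subset_sign S i) \<odot>\<^bsub>F\<^esub> P (\<Oplus>\<^bsub>E\<^esub>i\<in>{..<n}. subset_sign S i \<odot>\<^bsub>E\<^esub> x i)))"

lemma subset_sign_mult_self [simp]: "subset_sign S i * subset_sign S i = 1"
  by (simp add: subset_sign_def)

lemma norm_subset_sign [simp]: "norm (subset_sign S i :: 'k::real_normed_div_algebra) = 1"
  by (simp add: subset_sign_def)

text \<open>Orthogonality of the sign characters. For a permutation \<open>f\<close> the two
  products agree, so every summand is 1; in all other cases the summands cancel in pairs. In the
  expansion of the polarization formula this singles out the permutations.\<close>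

lemma sum_subset_sign_prod:
  assumes f: "f \<in> {..<n} \<rightarrow> {..<n}"
  shows "(\<Sum>S\<in>Pow {..<n}. (\<Prod>i<n. subset_sign S i) * (\<Prod>i<n. subset_sign S (f i))) =
    (if f ` {..<n} = {..<n} then 2 ^ n else 0 :: 'k::{idom,ring_char_0})"
proof (cases "f ` {..<n} = {..<n}")
  case True
  then have inj: "inj_on f {..<n}" by (intro eq_card_imp_inj_on) auto
  have "(\<Prod>i<n. subset_sign S (f i)) = (\<Prod>i<n. subset_sign S i :: 'k)" for S
    using prod.reindex[OF inj, of "subset_sign S :: nat \<Rightarrow> 'k"] True by simp
  then have "(\<Prod>i<n. subset_sign S i) * (\<Prod>i<n. subset_sign S (f i)) = (1 :: 'k)" for S
    by (simp flip: prod.distrib)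
  then show ?thesis using True by (simp add: card_Pow)
next
  case False
  then obtain j where j: "j < n" "j \<notin> f ` {..<n}" using f by blast
  \<comment> \<open>Toggling a point outside the range of \<open>f\<close> is an involution that reverses the sign of the summand.\<close>
  define g where "g S = (if j \<in> S then S - {j} else insert j S)" for S
  let ?t = "\<lambda>S. (\<Prod>i<n. subset_sign S i) * (\<Prod>i<n. subset_sign S (f i)) :: 'k"
  have "(\<Prod>i<n. subset_sign (g S) i) = - (\<Prod>i<n. subset_sign S i :: 'k)" for S
  proof -
    have "(\<Prod>i\<in>{..<n} - {j}. subset_sign (g S) i) = (\<Prod>i\<in>{..<n} - {j}. subset_sign S i :: 'k)"
      by (intro prod.cong) (auto simp: subset_sign_def g_def)
    moreover have "subset_sign (g S) j = - (subset_sign S j :: 'k)" by (simp add: subset_sign_def g_def)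
    ultimately show ?thesis using j by (simp add: prod.remove[of "{..<n}" j])
  qed
  moreover have "(\<Prod>i<n. subset_sign (g S) (f i)) = (\<Prod>i<n. subset_sign S (f i) :: 'k)" for S
    using j by (intro prod.cong) (auto simp: subset_sign_def g_def)
  ultimately have "?t (g S) = - ?t S" for S by simp
  moreover have "(\<Sum>S\<in>Pow {..<n}. ?t S) = (\<Sum>S\<in>Pow {..<n}. ?t (g S))"
    using j by (intro sum.reindex_bij_witness[of _ g g]) (auto simp: g_def insert_absorb split: if_splits)
  ultimately have "(\<Sum>S\<in>Pow {..<n}. ?t S) = - (\<Sum>S\<in>Pow {..<n}. ?t S)"
    by (simp add: sum_negf)
  then show ?thesis using False by (simp add: eq_neg_iff_add_eq_0 flip: mult_2)
qed

text \<open>Extensional surjections and permutations differ only in their values outside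
  \<open>{..<n}\<close>, namely \<open>undefined\<close> against the identity. Restriction is
  therefore a bijection, and the permutations are counted by \<open>n!\<close>.\<close>

lemma card_surj_funcset:
  "card {f \<in> {..<n} \<rightarrow>\<^sub>E {..<n}. f ` {..<n} = {..<n}} = fact n"
proof -
  have "{f \<in> {..<n} \<rightarrow>\<^sub>E {..<n}. f ` {..<n} = {..<n}} = (\<lambda>p. restrict p {..<n}) ` {p. p permutes {..<n}}"
    (is "?L = ?R")
  proof
    show "?R \<subseteq> ?L"
    proof (rule image_subsetI)
      fix p assume "p \<in> {p. p permutes {..<n}}"
      then have "p permutes {..<n}" by simp
      from permutes_image[OF this] show "restrict p {..<n} \<in> ?L" by fastforce
    qed
    show "?L \<subseteq> ?R"
    proof
      fix f assume f: "f \<in> ?L"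
      then have inj: "inj_on f {..<n}" by (intro eq_card_imp_inj_on) auto
      let ?p = "\<lambda>i. if i < n then f i else i"
      have "bij_betw f {..<n} {..<n}" using f inj by (simp add: bij_betw_def)
      then have "bij_betw ?p {..<n} {..<n}"
        using bij_betw_cong[of "{..<n}" f ?p] by simp
      then have "?p permutes {..<n}"
        by (intro bij_imp_permutes) auto
      moreover have "f = restrict ?p {..<n}" using f by (auto simp: PiE_iff extensional_def)
      ultimately show "f \<in> ?R" by blast
    qed
  qed
  moreover have "inj_on (\<lambda>p. restrict p {..<n}) {p. p permutes {..<n}}"
  proof (rule inj_onI, rule ext)
    fix p q i assume pq: "p \<in> {p. p permutes {..<n}}" "q \<in> {p. p permutes {..<n}}" "restrict p {..<n} = restrict q {..<n}"
    show "p i = q i"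
    proof (cases "i < n")
      case True then show ?thesis using pq(3) by (metis lessThan_iff restrict_apply')
    next
      case False then show ?thesis using pq by (simp add: permutes_not_in)
    qed
  qed
  ultimately show ?thesis
    by (simp add: card_image card_permutations)
qed


context multilinear_map
begin

abbreviation "perms \<equiv> {f \<in> {..<n} \<rightarrow>\<^sub>E {..<n}. f ` {..<n} = {..<n}}"

lemma permute_tuple: "x \<in> tuples n E \<Longrightarrow> f \<in> {..<n} \<rightarrow>\<^sub>E {..<n} \<Longrightarrow> (\<lambda>i\<in>{..<n}. x (f i)) \<in> tuples n E"
  by (auto simp: PiE_iff)

lemma finite_perms: "finite perms"
  by (rule finite_subset[of _ "{..<n} \<rightarrow>\<^sub>E {..<n}"]) (auto intro: finite_PiE)

text \<open>Expand \<open>P\<close> at every signed sum, exchange the sums over signs and over maps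
  \<open>f\<close>, and apply orthogonality of signs. What remains is the symmetrization of
  \<open>A\<close>; \<open>A\<close> itself need not be symmetric.\<close>

lemma polar_eq:
  assumes P: "\<And>x. x \<in> carrier E \<Longrightarrow> P x = A (diag n x)" and x: "x \<in> tuples n E"
  shows "polar n E F P x = inverse (fact n) \<odot>\<^bsub>F\<^esub> (\<Oplus>\<^bsub>F\<^esub>f\<in>perms. A (\<lambda>i\<in>{..<n}. x (f i)))"
proof -
  let ?Q = "{..<n} \<rightarrow>\<^sub>E {..<n}"
  define B where "B f = A (\<lambda>i\<in>{..<n}. x (f i))" for f
  have B: "B f \<in> carrier F" if "f \<in> ?Q" for f
    unfolding B_def using that x by (intro closed permute_tuple)
  have Q: "finite ?Q" by (intro finite_PiE) auto
  have s: "(\<Oplus>\<^bsub>E\<^esub>i\<in>{..<n}. subset_sign S i \<odot>\<^bsub>E\<^esub> x i) \<in> carrier E" for S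
    using x by (intro E.M.finsum_closed) auto
  have PS: "P (\<Oplus>\<^bsub>E\<^esub>i\<in>{..<n}. subset_sign S i \<odot>\<^bsub>E\<^esub> x i) = (\<Oplus>\<^bsub>F\<^esub>f\<in>?Q. (\<Prod>i<n. subset_sign S (f i)) \<odot>\<^bsub>F\<^esub> B f)" for S
    unfolding P[OF s] B_def using x by (intro expand) auto
  have "(\<Oplus>\<^bsub>F\<^esub>S\<in>Pow {..<n}. (\<Prod>i<n. subset_sign S i) \<odot>\<^bsub>F\<^esub> P (\<Oplus>\<^bsub>E\<^esub>i\<in>{..<n}. subset_sign S i \<odot>\<^bsub>E\<^esub> x i)) =
    (\<Oplus>\<^bsub>F\<^esub>S\<in>Pow {..<n}. \<Oplus>\<^bsub>F\<^esub>f\<in>?Q. ((\<Prod>i<n. subset_sign S i) * (\<Prod>i<n. subset_sign S (f i))) \<odot>\<^bsub>F\<^esub> B f)"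
    unfolding PS using B Q by (intro F.M.finsum_cong_in) (auto simp: F.smult_finsum intro!: F.M.finsum_cong_in F.M.finsum_closed)
  also have "\<dots> = (\<Oplus>\<^bsub>F\<^esub>f\<in>?Q. \<Oplus>\<^bsub>F\<^esub>S\<in>Pow {..<n}. ((\<Prod>i<n. subset_sign S i) * (\<Prod>i<n. subset_sign S (f i))) \<odot>\<^bsub>F\<^esub> B f)"
    using B Q by (intro F.M.finsum_swap) auto
  also have "\<dots> = (\<Oplus>\<^bsub>F\<^esub>f\<in>?Q. (if f ` {..<n} = {..<n} then 2 ^ n else 0) \<odot>\<^bsub>F\<^esub> B f)"
  proof (rule F.M.finsum_cong_in[OF refl])
    fix f assume f: "f \<in> ?Q"
    then have f': "f \<in> {..<n} \<rightarrow> {..<n}" by auto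
    show "(\<Oplus>\<^bsub>F\<^esub>S\<in>Pow {..<n}. ((\<Prod>i<n. subset_sign S i) * (\<Prod>i<n. subset_sign S (f i))) \<odot>\<^bsub>F\<^esub> B f) =
      (if f ` {..<n} = {..<n} then 2 ^ n else 0) \<odot>\<^bsub>F\<^esub> B f"
      by (subst F.finsum_smult_left) (simp_all only: B[OF f] sum_subset_sign_prod[OF f'] finite_Pow_iff finite_lessThan)
  qed (use B in auto)
  also have "\<dots> = (\<Oplus>\<^bsub>F\<^esub>f\<in>perms. 2 ^ n \<odot>\<^bsub>F\<^esub> B f)"
    using B Q by (intro F.M.add.finprod_mono_neutral_cong_right) auto
  also have "\<dots> = 2 ^ n \<odot>\<^bsub>F\<^esub> (\<Oplus>\<^bsub>F\<^esub>f\<in>perms. B f)"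
    using B finite_perms by (intro F.smult_finsum[symmetric]) auto
  finally have "polar n E F P x = inverse (2 ^ n * fact n) \<odot>\<^bsub>F\<^esub> (2 ^ n \<odot>\<^bsub>F\<^esub> (\<Oplus>\<^bsub>F\<^esub>f\<in>perms. B f))"
    unfolding polar_def using x by simp
  moreover have "(\<Oplus>\<^bsub>F\<^esub>f\<in>perms. B f) \<in> carrier F" using B by (intro F.M.finsum_closed) auto
  moreover have "inverse (2 ^ n * fact n) * 2 ^ n = (inverse (fact n) :: 'k)" by (simp add: field_simps)
  ultimately show ?thesis unfolding B_def by (simp only: F.smult_smult)
qed

text \<open>All \<open>n!\<close> rearrangements of a constant tuple agree, which is what the factor
  \<open>1 / n!\<close> compensates.\<close>

lemma polar_diag:
  assumes P: "\<And>x. x \<in> carrier E \<Longrightarrow> P x = A (diag n x)" and x: "x \<in> carrier E"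
  shows "polar n E F P (diag n x) = P x"
proof -
  have d: "diag n x \<in> tuples n E" using x by auto
  have "(\<Oplus>\<^bsub>F\<^esub>f\<in>perms. A (\<lambda>i\<in>{..<n}. diag n x (f i))) = (\<Oplus>\<^bsub>F\<^esub>f\<in>perms. 1 \<odot>\<^bsub>F\<^esub> A (diag n x))"
  proof (rule F.M.finsum_cong_in[OF refl])
    fix f assume "f \<in> perms"
    then have "(\<lambda>i\<in>{..<n}. diag n x (f i)) = diag n x" by (auto simp: PiE_iff)
    then show "A (\<lambda>i\<in>{..<n}. diag n x (f i)) = 1 \<odot>\<^bsub>F\<^esub> A (diag n x)"
      using closed[OF d] by (simp only: F.smult_1)
  qed (use closed[OF d] in auto)
  also have "\<dots> = fact n \<odot>\<^bsub>F\<^esub> A (diag n x)"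
    using closed[OF d] finite_perms by (subst F.finsum_smult_left) (simp_all add: card_surj_funcset)
  finally show ?thesis
    using closed[OF d] by (simp only: polar_eq[OF P d] F.smult_smult P[OF x]) simp
qed

text \<open>Each rearrangement of \<open>A\<close> is multilinear in the original slots, hence so is
  the symmetrization.\<close>

lemma polar_multilinear:
  assumes P: "\<And>x. x \<in> carrier E \<Longrightarrow> P x = A (diag n x)"
  shows "polar n E F P \<in> multilinear n (\<lambda>_. E) F"
proof -
  define B where "B x = (\<Oplus>\<^bsub>F\<^esub>f\<in>perms. A (\<lambda>i\<in>{..<n}. x (f i)))" for x
  have summand: "A (\<lambda>i\<in>{..<n}. x (f i)) \<in> carrier F" if "x \<in> tuples n E" "f \<in> perms" for x f
    using that by (intro closed permute_tuple) auto
  have B: "B x \<in> carrier F" if "x \<in> tuples n E" for x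
    unfolding B_def using summand[OF that] by (intro F.M.finsum_closed) auto
  have polar: "polar n E F P x = inverse (fact n) \<odot>\<^bsub>F\<^esub> B x" if "x \<in> tuples n E" for x
    unfolding B_def by (rule polar_eq[OF P that])
  \<comment> \<open>A permutation takes the value \<open>i\<close> at exactly one place
    \<open>k\<close>, so changing slot \<open>i\<close> of \<open>x\<close> changes just slot
    \<open>k\<close> of the rearranged tuple.\<close>
  have slot: "\<exists>k<n. \<forall>y. (\<lambda>j\<in>{..<n}. (x(i := y)) (f j)) = (\<lambda>j\<in>{..<n}. x (f j))(k := y)"
    if "f \<in> perms" "i < n" for f i and x :: "nat \<Rightarrow> 'v"
  proof -
    have "i \<in> f ` {..<n}" using that by simp
    then obtain k where k: "k < n" "f k = i" by auto
    have "inj_on f {..<n}" using that by (intro eq_card_imp_inj_on) auto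
    then have "f j = i \<longleftrightarrow> j = k" if "j < n" for j using that k by (auto dest: inj_onD)
    then show ?thesis using k by (intro exI[of _ k]) auto
  qed
  have add: "B (x(i := y \<oplus>\<^bsub>E\<^esub> z)) = B (x(i := y)) \<oplus>\<^bsub>F\<^esub> B (x(i := z))"
    if "x \<in> tuples n E" "i < n" "y \<in> carrier E" "z \<in> carrier E" for x i y z
  proof -
    have "B (x(i := y \<oplus>\<^bsub>E\<^esub> z)) =
      (\<Oplus>\<^bsub>F\<^esub>f\<in>perms. A (\<lambda>j\<in>{..<n}. (x(i := y)) (f j)) \<oplus>\<^bsub>F\<^esub> A (\<lambda>j\<in>{..<n}. (x(i := z)) (f j)))"
      unfolding B_def
    proof (rule F.M.finsum_cong_in[OF refl])
      fix f assume f: "f \<in> perms"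
      from slot[OF f that(2)] obtain k where k: "k < n"
        and u: "\<And>y. (\<lambda>j\<in>{..<n}. (x(i := y)) (f j)) = (\<lambda>j\<in>{..<n}. x (f j))(k := y)" by blast
      have T: "(\<lambda>j\<in>{..<n}. x (f j)) \<in> tuples n E" using f that by (intro permute_tuple) auto
      show "A (\<lambda>j\<in>{..<n}. (x(i := y \<oplus>\<^bsub>E\<^esub> z)) (f j)) =
        A (\<lambda>j\<in>{..<n}. (x(i := y)) (f j)) \<oplus>\<^bsub>F\<^esub> A (\<lambda>j\<in>{..<n}. (x(i := z)) (f j))"
        unfolding u by (rule slot_add[OF T k that(3,4)])
      show "A (\<lambda>j\<in>{..<n}. (x(i := y)) (f j)) \<oplus>\<^bsub>F\<^esub> A (\<lambda>j\<in>{..<n}. (x(i := z)) (f j)) \<in> carrier F"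
        by (intro F.M.a_closed summand tuples_upd that f)
    qed
    also have "\<dots> = B (x(i := y)) \<oplus>\<^bsub>F\<^esub> B (x(i := z))"
      unfolding B_def by (intro F.M.finsum_addf Pi_I summand tuples_upd that)
    finally show ?thesis .
  qed
  have smult: "B (x(i := c \<odot>\<^bsub>E\<^esub> y)) = c \<odot>\<^bsub>F\<^esub> B (x(i := y))"
    if "x \<in> tuples n E" "i < n" "y \<in> carrier E" for x i y c
  proof -
    have "B (x(i := c \<odot>\<^bsub>E\<^esub> y)) = (\<Oplus>\<^bsub>F\<^esub>f\<in>perms. c \<odot>\<^bsub>F\<^esub> A (\<lambda>j\<in>{..<n}. (x(i := y)) (f j)))"
      unfolding B_def
    proof (rule F.M.finsum_cong_in[OF refl])
      fix f assume f: "f \<in> perms"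
      from slot[OF f that(2)] obtain k where k: "k < n"
        and u: "\<And>y. (\<lambda>j\<in>{..<n}. (x(i := y)) (f j)) = (\<lambda>j\<in>{..<n}. x (f j))(k := y)" by blast
      have T: "(\<lambda>j\<in>{..<n}. x (f j)) \<in> tuples n E" using f that by (intro permute_tuple) auto
      show "A (\<lambda>j\<in>{..<n}. (x(i := c \<odot>\<^bsub>E\<^esub> y)) (f j)) = c \<odot>\<^bsub>F\<^esub> A (\<lambda>j\<in>{..<n}. (x(i := y)) (f j))"
        unfolding u by (rule slot_smult[OF T k that(3)])
      show "c \<odot>\<^bsub>F\<^esub> A (\<lambda>j\<in>{..<n}. (x(i := y)) (f j)) \<in> carrier F"
        by (intro F.smult_in summand tuples_upd that f)
    qed
    also have "\<dots> = c \<odot>\<^bsub>F\<^esub> B (x(i := y))"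
      unfolding B_def by (intro F.smult_finsum[symmetric] finite_perms Pi_I summand tuples_upd that)
    finally show ?thesis .
  qed
  show ?thesis
    unfolding multilinear_def
  proof (intro CollectI conjI ballI allI impI)
    show "polar n E F P \<in> tuples n E \<rightarrow>\<^sub>E carrier F"
      using B polar by (intro PiE_I) (auto simp: polar_def)
  next
    fix x i y z c
    assume xy: "x \<in> tuples n E" "i < n" "y \<in> carrier E" "z \<in> carrier E"
    have t: "x(i := y) \<in> tuples n E" "x(i := z) \<in> tuples n E" "x(i := y \<oplus>\<^bsub>E\<^esub> z) \<in> tuples n E" "x(i := c \<odot>\<^bsub>E\<^esub> y) \<in> tuples n E"
      by (intro tuples_upd xy E.smult_in E.M.a_closed)+
    show "polar n E F P (x(i := y \<oplus>\<^bsub>E\<^esub> z)) = polar n E F P (x(i := y)) \<oplus>\<^bsub>F\<^esub> polar n E F P (x(i := z))"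
      unfolding polar[OF t(1)] polar[OF t(2)] polar[OF t(3)] add[OF xy]
      by (intro F.smult_add_right B t)
    show "polar n E F P (x(i := c \<odot>\<^bsub>E\<^esub> y)) = c \<odot>\<^bsub>F\<^esub> polar n E F P (x(i := y))"
      unfolding polar[OF t(1)] polar[OF t(4)] smult[OF xy(1-3)] using B[OF t(1)] by (simp add: mult.commute)
  qed
qed

end

context banach_pair
begin

text \<open>Origin of the constant: each signed sum of \<open>n\<close> vectors of the unit ball has
  norm at most \<open>n\<close>, so its image has norm at most \<open>C * n ^ n\<close>. There are
  \<open>2 ^ n\<close> such terms, which cancels the power of 2 in the denominator and leaves
  \<open>n ^ n / n!\<close>.\<close>

lemma polar_bound:
  assumes P: "P \<in> carrier E \<rightarrow> carrier F" and C: "\<And>x. x \<in> carrier E \<Longrightarrow> nrm F (P x) \<le> C * nrm E x ^ n" "0 \<le> C"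
    and x: "x \<in> tuples n E" "\<And>i. i < n \<Longrightarrow> nrm E (x i) \<le> 1"
  shows "nrm F (polar n E F P x) \<le> real n ^ n / fact n * C"
proof -
  let ?s = "\<lambda>S. \<Oplus>\<^bsub>E\<^esub>i\<in>{..<n}. subset_sign S i \<odot>\<^bsub>E\<^esub> x i"
  have s: "?s S \<in> carrier E" for S
    using x by (intro E.M.finsum_closed) auto
  have "nrm E (?s S) \<le> real n" for S
  proof -
    have "nrm E (?s S) \<le> (\<Sum>i<n. nrm E (subset_sign S i \<odot>\<^bsub>E\<^esub> x i))"
      using x by (intro E.nrm_finsum) auto
    also have "\<dots> \<le> (\<Sum>i<n. 1)"
      using x by (intro sum_mono) (auto simp: E.nrm_smult)
    finally show ?thesis by simp
  qed
  then have "nrm F (P (?s S)) \<le> C * real n ^ n" for S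
    using C(1)[OF s, of S] C(2) E.nrm_nonneg[OF s] by (meson mult_left_mono order_trans power_mono)
  then have "nrm F ((\<Prod>i<n. subset_sign S i) \<odot>\<^bsub>F\<^esub> P (?s S)) \<le> C * real n ^ n" for S
    using P s[of S] by (subst F.nrm_smult) (auto simp flip: prod_norm)
  then have "(\<Sum>S\<in>Pow {..<n}. nrm F ((\<Prod>i<n. subset_sign S i) \<odot>\<^bsub>F\<^esub> P (?s S))) \<le> (\<Sum>S\<in>Pow {..<n}. C * real n ^ n)"
    by (intro sum_mono)
  moreover have "nrm F (\<Oplus>\<^bsub>F\<^esub>S\<in>Pow {..<n}. (\<Prod>i<n. subset_sign S i) \<odot>\<^bsub>F\<^esub> P (?s S)) \<le>
      (\<Sum>S\<in>Pow {..<n}. nrm F ((\<Prod>i<n. subset_sign S i) \<odot>\<^bsub>F\<^esub> P (?s S)))"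
    using P s by (intro F.nrm_finsum) auto
  ultimately have *: "nrm F (\<Oplus>\<^bsub>F\<^esub>S\<in>Pow {..<n}. (\<Prod>i<n. subset_sign S i) \<odot>\<^bsub>F\<^esub> P (?s S)) \<le> 2 ^ n * (C * real n ^ n)"
    by (simp add: card_Pow)
  have "(\<Oplus>\<^bsub>F\<^esub>S\<in>Pow {..<n}. (\<Prod>i<n. subset_sign S i) \<odot>\<^bsub>F\<^esub> P (?s S)) \<in> carrier F"
    using P s by (intro F.M.finsum_closed) auto
  then have "nrm F (polar n E F P x) = inverse (2 ^ n * fact n) * nrm F (\<Oplus>\<^bsub>F\<^esub>S\<in>Pow {..<n}. (\<Prod>i<n. subset_sign S i) \<odot>\<^bsub>F\<^esub> P (?s S))"
    unfolding polar_def using x by (simp add: F.nrm_smult norm_inverse norm_mult norm_power)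
  also have "\<dots> \<le> inverse (2 ^ n * fact n) * (2 ^ n * (C * real n ^ n))"
    using * by (intro mult_left_mono) auto
  finally show ?thesis by (simp add: field_simps)
qed

end

section \<open>Continuity and boundedness\<close>

context banach_pair
begin

lemma continuous_at_zero:
  assumes "continuous_map (ntopology E) (ntopology F) f" "f \<zero>\<^bsub>E\<^esub> = \<zero>\<^bsub>F\<^esub>" "e > 0"
  shows "\<exists>d>0. \<forall>y\<in>carrier E. nrm E y < d \<longrightarrow> nrm F (f y) < e"
proof -
  obtain U where U: "openin E.mtopology U" "\<zero>\<^bsub>E\<^esub> \<in> U" "\<And>y. y \<in> U \<Longrightarrow> f y \<in> F.mball \<zero>\<^bsub>F\<^esub> e"
    using assms unfolding E.ntopology_eq F.ntopology_eq F.continuous_map_to_metric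
    by (metis E.M.zero_closed E.topspace_mtopology)
  then obtain d where d: "d > 0" "E.mball \<zero>\<^bsub>E\<^esub> d \<subseteq> U" using E.openin_mtopology by blast
  have "nrm F (f y) < e" if "y \<in> carrier E" "nrm E y < d" for y
  proof -
    have "y \<in> E.mball \<zero>\<^bsub>E\<^esub> d" using that by (simp add: ndist_def a_minus_def)
    then have "f y \<in> F.mball \<zero>\<^bsub>F\<^esub> e" using d U by blast
    then show ?thesis by (auto simp: ndist_def a_minus_def)
  qed
  with d show ?thesis by blast
qed

end

context multilinear_map
begin

text \<open>Telescoping from \<open>x\<close> to \<open>y\<close> one slot at a time. Each step
  changes \<open>A\<close> by its value at a tuple with \<open>y k - x k\<close> in slot
  \<open>k\<close> and entries bounded by \<open>M\<close> elsewhere.\<close>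

lemma diff_bound:
  assumes C: "\<And>x. x \<in> tuples n E \<Longrightarrow> nrm F (A x) \<le> C * (\<Prod>i<n. nrm E (x i))" "0 \<le> C"
    and x: "x \<in> tuples n E" "\<And>i. i < n \<Longrightarrow> nrm E (x i) \<le> M"
    and y: "y \<in> tuples n E" "\<And>i. i < n \<Longrightarrow> nrm E (y i) \<le> M"
    and d: "\<And>i. i < n \<Longrightarrow> nrm E (y i \<ominus>\<^bsub>E\<^esub> x i) \<le> d" and M: "1 \<le> M"
  shows "nrm F (A y \<ominus>\<^bsub>F\<^esub> A x) \<le> real n * (C * (d * M ^ n))"
proof -
  define m where "m k = (\<lambda>i\<in>{..<n}. if i < k then y i else x i)" for k
  have m: "m k \<in> tuples n E" for k using x y by (auto simp: m_def)
  have mx: "m 0 = x" "m n = y"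
    using x y by (auto simp: m_def PiE_iff extensional_def fun_eq_iff)
  have "nrm F (A (m k) \<ominus>\<^bsub>F\<^esub> A x) \<le> real k * (C * (d * M ^ n))" if "k \<le> n" for k
    using that
  proof (induction k)
    case 0
    then show ?case using x by (simp add: mx)
  next
    case (Suc k)
    then have k: "k < n" by simp
    have xy: "x k \<in> carrier E" "y k \<in> carrier E" using x y k by auto
    have up: "m (Suc k) = (m k)(k := y k)" "m k = (m k)(k := x k)"
      using k by (auto simp: m_def less_Suc_eq)
    let ?z = "(m k)(k := y k \<ominus>\<^bsub>E\<^esub> x k)"
    have z: "?z \<in> tuples n E" using xy by (intro tuples_upd m k) auto
    have "A (m (Suc k)) \<ominus>\<^bsub>F\<^esub> A (m k) = A ?z"
      unfolding slot_minus[OF m k xy(2,1)] up(1) using up(2) by simp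
    also have "nrm F \<dots> \<le> C * (\<Prod>i<n. nrm E (?z i))" by (rule C(1)[OF z])
    also have "(\<Prod>i<n. nrm E (?z i)) = nrm E (y k \<ominus>\<^bsub>E\<^esub> x k) * (\<Prod>i\<in>{..<n} - {k}. nrm E (m k i))"
      using k by (subst prod.remove[of _ k]) auto
    also have "\<dots> \<le> d * M ^ (n - 1)"
    proof (rule mult_mono)
      have "(\<Prod>i\<in>{..<n} - {k}. nrm E (m k i)) \<le> (\<Prod>i\<in>{..<n} - {k}. M)"
        using x y by (intro prod_mono) (auto simp: m_def E.nrm_nonneg)
      then show "(\<Prod>i\<in>{..<n} - {k}. nrm E (m k i)) \<le> M ^ (n - 1)" using k by simp
      show "0 \<le> d" using d[OF k] xy E.nrm_nonneg[of "y k \<ominus>\<^bsub>E\<^esub> x k"] by simp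
      show "0 \<le> (\<Prod>i\<in>{..<n} - {k}. nrm E (m k i))"
        using m[of k] by (intro prod_nonneg) (auto intro!: E.nrm_nonneg)
    qed (rule d[OF k])
    also have "\<dots> \<le> d * M ^ n"
      using d[OF k] xy E.nrm_nonneg[of "y k \<ominus>\<^bsub>E\<^esub> x k"] M by (intro mult_left_mono power_increasing) auto
    finally have "nrm F (A (m (Suc k)) \<ominus>\<^bsub>F\<^esub> A (m k)) \<le> C * (d * M ^ n)"
      using C(2) by (simp add: mult_left_mono)
    with Suc k F.nrm_minus_triangle[of "A (m (Suc k))" "A (m k)" "A x"] m x
    show ?case by (simp add: algebra_simps)
  qed
  from this[of n] show ?thesis by (simp add: mx)
qed

lemma continuous_from_bound:
  assumes C: "\<And>x. x \<in> tuples n E \<Longrightarrow> nrm F (A x) \<le> C * (\<Prod>i<n. nrm E (x i))" "0 \<le> C"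
  shows "A \<in> cont_multilinear n (\<lambda>_. E) F"
proof -
  have "\<exists>U. openin (product_topology (\<lambda>_. ntopology E) {..<n}) U \<and> x \<in> U \<and> (\<forall>y\<in>U. A y \<in> F.mball (A x) e)"
    if x: "x \<in> tuples n E" and e: "e > 0" for x e
  proof -
    \<comment> \<open>\<open>M\<close> must bound the norm of each \<open>x i\<close> and of all
      vectors within distance 1 of it, and be at least 1 even if there are no slots.\<close>
    define M where "M = 2 + (\<Sum>i<n. nrm E (x i))"
    have M: "nrm E (x i) + 1 \<le> M" if "i < n" for i
    proof -
      have "nrm E (x i) \<le> (\<Sum>i<n. nrm E (x i))"
        using that x by (intro member_le_sum) (auto simp: E.nrm_nonneg)
      then show ?thesis by (simp add: M_def)
    qed
    have "0 \<le> (\<Sum>i<n. nrm E (x i))" using x by (intro sum_nonneg E.nrm_nonneg) auto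
    then have M1: "1 \<le> M" by (simp add: M_def)
    define K where "K = real n * (C * M ^ n) + 1"
    have "0 \<le> real n * (C * M ^ n)" using C(2) M1 by (intro mult_nonneg_nonneg) auto
    then have K: "K > 0" by (simp add: K_def)
    \<comment> \<open>The minimum with 1 keeps the entries of \<open>y\<close> within the range of
      \<open>M\<close>; the 2 makes the final estimate strict. The summand 1 in \<open>K\<close>
      keeps the denominator positive.\<close>
    define d where "d = min 1 (e / (2 * K))"
    have d: "0 < d" "d \<le> 1" using e K by (auto simp: d_def)
    let ?U = "PiE {..<n} (\<lambda>i. E.mball (x i) d)"
    have "openin (product_topology (\<lambda>_. ntopology E) {..<n}) ?U"
      by (auto simp: openin_PiE E.ntopology_eq)
    moreover have "x \<in> ?U" using x d by (auto simp: PiE_iff)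
    moreover have "A y \<in> F.mball (A x) e" if y: "y \<in> ?U" for y
    proof -
      have yt: "y \<in> tuples n E" using y by (auto simp: PiE_iff)
      have yd: "nrm E (y i \<ominus>\<^bsub>E\<^esub> x i) \<le> d" if "i < n" for i
      proof -
        have "y i \<in> E.mball (x i) d" using y that by (auto simp: PiE_iff)
        then have "nrm E (x i \<ominus>\<^bsub>E\<^esub> y i) < d" by (auto simp: ndist_def)
        then show ?thesis using that x yt E.nrm_minus_commute[of "x i" "y i"] by simp
      qed
      have "nrm F (A y \<ominus>\<^bsub>F\<^esub> A x) \<le> real n * (C * (d * M ^ n))"
      proof (rule diff_bound[OF C x _ yt _ yd M1])
        show "nrm E (x i) \<le> M" if "i < n" for i using M[OF that] by simp
        show "nrm E (y i) \<le> M" if "i < n" for i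
          using M[OF that] yd[OF that] d E.nrm_le_minus_add[of "y i" "x i"] x yt that by simp
      qed
      also have "\<dots> \<le> d * K" using d by (simp add: K_def algebra_simps)
      also have "\<dots> \<le> (e / (2 * K)) * K" using K by (intro mult_right_mono) (auto simp: d_def)
      also have "\<dots> < e" using K e by simp
      finally show ?thesis using x yt F.nrm_minus_commute[of "A x" "A y"] by (simp add: ndist_def)
    qed
    ultimately show ?thesis by blast
  qed
  then have "continuous_map (product_topology (\<lambda>_. ntopology E) {..<n}) (ntopology F) A"
    unfolding F.ntopology_eq F.continuous_map_to_metric by simp
  then show ?thesis using multilinear by (simp add: cont_multilinear_def)
qed

text \<open>Continuity at the zero tuple provides a box around zero that is mapped into the unit
  ball. Shrinking a tuple of the unit ball by \<open>d\<close> moves it into this box and multiplies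
  its value by \<open>d ^ n\<close>.\<close>

lemma bound_from_continuous:
  assumes n: "n \<ge> 1" and cont: "continuous_map (product_topology (\<lambda>_. ntopology E) {..<n}) (ntopology F) A"
  shows "\<exists>C\<ge>0. \<forall>x\<in>tuples n E. nrm F (A x) \<le> C * (\<Prod>i<n. nrm E (x i))"
proof -
  define z where "z = (\<lambda>i\<in>{..<n}. \<zero>\<^bsub>E\<^esub>)"
  have z: "z \<in> tuples n E" by (auto simp: z_def)
  have "z = z(0 := \<zero>\<^bsub>E\<^esub>)" using n by (auto simp: z_def)
  then have Az: "A z = \<zero>\<^bsub>F\<^esub>" using slot_zero[OF z, of 0] n by simp
  have zt: "z \<in> topspace (product_topology (\<lambda>_. ntopology E) {..<n})" using z by simp
  have "\<forall>x\<in>topspace (product_topology (\<lambda>_. ntopology E) {..<n}). \<forall>e>0.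
      \<exists>U. openin (product_topology (\<lambda>_. ntopology E) {..<n}) U \<and> x \<in> U \<and> (\<forall>y\<in>U. A y \<in> F.mball (A x) e)"
    using cont unfolding F.ntopology_eq by (simp only: F.continuous_map_to_metric)
  then have "\<forall>e>0. \<exists>U. openin (product_topology (\<lambda>_. ntopology E) {..<n}) U \<and> z \<in> U \<and> (\<forall>y\<in>U. A y \<in> F.mball (A z) e)"
    using zt by (rule bspec)
  from this[rule_format, OF zero_less_one] obtain U where
    U: "openin (product_topology (\<lambda>_. ntopology E) {..<n}) U" "z \<in> U" "\<forall>y\<in>U. A y \<in> F.mball (A z) 1"
    by (elim exE conjE)
  obtain V where V: "\<And>i. i < n \<Longrightarrow> openin (ntopology E) (V i)" "z \<in> PiE {..<n} V" "PiE {..<n} V \<subseteq> U"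
    using U(1,2) unfolding openin_product_topology_alt by (metis lessThan_iff)
  have "\<exists>r>0. E.mball \<zero>\<^bsub>E\<^esub> r \<subseteq> V i" if "i < n" for i
  proof -
    have "\<zero>\<^bsub>E\<^esub> \<in> V i" using V(2) that by (auto simp: PiE_iff z_def)
    then show ?thesis using V(1)[OF that] by (auto simp: E.ntopology_eq E.openin_mtopology)
  qed
  then obtain r where r: "\<And>i. i < n \<Longrightarrow> r i > 0 \<and> E.mball \<zero>\<^bsub>E\<^esub> (r i) \<subseteq> V i" by metis
  \<comment> \<open>Halving makes \<open>d\<close> strictly smaller than every radius, so that the
    closed unit ball scaled by \<open>d\<close> fits into the open balls.\<close>
  define d where "d = Min (r ` {..<n}) / 2"
  have "0 \<in> {..<n}" using n by simp
  then have "Min (r ` {..<n}) > 0" using r by (subst Min_gr_iff) auto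
  then have d: "d > 0" by (simp add: d_def)
  have dr: "d < r i" if "i < n" for i
  proof -
    have "2 * d \<le> r i" using that by (auto simp: d_def)
    with d show ?thesis by simp
  qed
  have ball: "nrm F (A x) \<le> inverse d ^ n" if x: "x \<in> tuples n E" "\<And>i. i < n \<Longrightarrow> nrm E (x i) \<le> 1" for x
  proof -
    let ?y = "\<lambda>i\<in>{..<n}. of_real d \<odot>\<^bsub>E\<^esub> x i"
    have "of_real d \<odot>\<^bsub>E\<^esub> x i \<in> V i" if "i < n" for i
    proof -
      have "d * nrm E (x i) \<le> d * 1" using d x(2)[OF that] by (intro mult_left_mono) auto
      with dr[OF that] have "d * nrm E (x i) < r i" by simp
      then have "of_real d \<odot>\<^bsub>E\<^esub> x i \<in> E.mball \<zero>\<^bsub>E\<^esub> (r i)"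
        using d x that by (simp add: ndist_def a_minus_def E.nrm_smult)
      then show ?thesis using r that by blast
    qed
    then have "?y \<in> U" by (intro subsetD[OF V(3)] PiE_I) auto
    then have "A ?y \<in> F.mball \<zero>\<^bsub>F\<^esub> 1" using bspec[OF U(3)] unfolding Az by blast
    then have "nrm F (A ?y) < 1" by (auto simp: ndist_def a_minus_def)
    moreover have "nrm F (A ?y) = d ^ n * nrm F (A x)"
      using scale[OF x(1), of "\<lambda>_. of_real d"] x(1) d by (simp add: F.nrm_smult norm_power)
    ultimately show ?thesis using d by (simp add: field_simps)
  qed
  have "\<forall>x\<in>tuples n E. nrm F (A x) \<le> inverse d ^ n * (\<Prod>i<n. nrm E (x i))"
    by (intro ballI bound_from_ball ball)
  then show ?thesis using d by (intro exI[of _ "inverse d ^ n"]) auto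
qed

end

context banach_pair
begin

lemma multilinear_mapI: "A \<in> multilinear n (\<lambda>_. E) F \<Longrightarrow> multilinear_map E F n A"
  by unfold_locales

text \<open>The supremum defining \<open>multilinear_norm\<close> is an upper bound only if the set
  is bounded, and this is what continuity provides.\<close>

lemma multilinear_norm_bound:
  assumes A: "A \<in> cont_multilinear n (\<lambda>_. E) F" and n: "n \<ge> 1" and x: "x \<in> tuples n E"
  shows "nrm F (A x) \<le> multilinear_norm n (\<lambda>_. E) F A * (\<Prod>i<n. nrm E (x i))"
proof -
  interpret multilinear_map E F n A
    using A by (intro multilinear_mapI) (simp add: cont_multilinear_def)
  obtain C where C: "C \<ge> 0" "\<And>x. x \<in> tuples n E \<Longrightarrow> nrm F (A x) \<le> C * (\<Prod>i<n. nrm E (x i))"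
    using bound_from_continuous[OF n] A by (auto simp: cont_multilinear_def)
  have "bdd_above {nrm F (A x) | x. x \<in> tuples n E \<and> (\<forall>i<n. nrm E (x i) \<le> 1)}"
  proof (rule bdd_aboveI, clarify)
    fix x assume x: "x \<in> tuples n E" "\<forall>i<n. nrm E (x i) \<le> 1"
    have "(\<Prod>i<n. nrm E (x i)) \<le> 1" using x by (intro prod_le_1) (auto simp: E.nrm_nonneg)
    then have "C * (\<Prod>i<n. nrm E (x i)) \<le> C * 1" using C(1) by (intro mult_left_mono) auto
    with C(2)[OF x(1)] show "nrm F (A x) \<le> C" by simp
  qed
  then have "nrm F (A x) \<le> multilinear_norm n (\<lambda>_. E) F A" if "x \<in> tuples n E" "\<And>i. i < n \<Longrightarrow> nrm E (x i) \<le> 1" for x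
    unfolding multilinear_norm_def using that by (intro cSup_upper) auto
  then show ?thesis by (rule bound_from_ball[OF _ x])
qed

lemma multilinear_norm_le:
  assumes "\<And>x. x \<in> tuples n E \<Longrightarrow> (\<And>i. i < n \<Longrightarrow> nrm E (x i) \<le> 1) \<Longrightarrow> nrm F (A x) \<le> C"
  shows "multilinear_norm n (\<lambda>_. E) F A \<le> C"
  unfolding multilinear_norm_def
proof (rule cSup_least)
  have "(\<lambda>i\<in>{..<n}. \<zero>\<^bsub>E\<^esub>) \<in> tuples n E \<and> (\<forall>i<n. nrm E ((\<lambda>i\<in>{..<n}. \<zero>\<^bsub>E\<^esub>) i) \<le> 1)" by auto
  then show "{nrm F (A x) | x. x \<in> tuples n E \<and> (\<forall>i<n. nrm E (x i) \<le> 1)} \<noteq> {}" by blast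
qed (use assms in auto)

section \<open>Continuous homogeneous polynomials\<close>

lemma cont_poly_mem: "P \<in> cont_poly n E F \<Longrightarrow> P \<in> carrier E \<rightarrow>\<^sub>E carrier F"
  by (simp add: cont_poly_def)

lemma cont_poly_closed [simp]: "P \<in> cont_poly n E F \<Longrightarrow> x \<in> carrier E \<Longrightarrow> P x \<in> carrier F"
  using cont_poly_mem by blast

lemma cont_poly_multilinear:
  assumes "P \<in> cont_poly n E F"
  obtains A where "multilinear_map E F n A" "\<And>x. x \<in> carrier E \<Longrightarrow> P x = A (diag n x)"
  using assms by (auto simp: cont_poly_def intro: multilinear_mapI)

lemma cont_poly_smult:
  assumes "P \<in> cont_poly n E F" "x \<in> carrier E"
  shows "P (c \<odot>\<^bsub>E\<^esub> x) = (c ^ n) \<odot>\<^bsub>F\<^esub> P x"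
proof -
  obtain A where A: "multilinear_map E F n A" "\<And>x. x \<in> carrier E \<Longrightarrow> P x = A (diag n x)"
    using cont_poly_multilinear[OF assms(1)] by blast
  interpret multilinear_map E F n A by (rule A(1))
  have "(\<lambda>i\<in>{..<n}. c \<odot>\<^bsub>E\<^esub> diag n x i) = diag n (c \<odot>\<^bsub>E\<^esub> x)" by auto
  then show ?thesis using scale[of "diag n x" "\<lambda>_. c"] assms(2) A(2) by auto
qed

lemma cont_poly_zero:
  assumes "P \<in> cont_poly n E F" "n \<ge> 1"
  shows "P \<zero>\<^bsub>E\<^esub> = \<zero>\<^bsub>F\<^esub>"
  using cont_poly_smult[OF assms(1) E.M.zero_closed, of 0] assms by (simp add: power_0_left)

text \<open>Continuity at zero plus homogeneity. The result gives meaning to the supremum in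
  \<open>poly_norm\<close>.\<close>

lemma cont_poly_bounded:
  assumes P: "P \<in> cont_poly n E F" and n: "n \<ge> 1"
  shows "\<exists>C. \<forall>x\<in>carrier E. nrm E x \<le> 1 \<longrightarrow> nrm F (P x) \<le> C"
proof -
  obtain d where d: "d > 0" "\<And>y. y \<in> carrier E \<Longrightarrow> nrm E y < d \<Longrightarrow> nrm F (P y) < 1"
    using continuous_at_zero[of P 1] cont_poly_zero[OF P n] P by (auto simp: cont_poly_def)
  have "nrm F (P x) \<le> inverse (d / 2) ^ n" if x: "x \<in> carrier E" "nrm E x \<le> 1" for x
  proof -
    have "d / 2 * nrm E x \<le> d / 2 * 1" using x d by (intro mult_left_mono) auto
    then have "nrm F (P (of_real (d / 2) \<odot>\<^bsub>E\<^esub> x)) < 1"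
      using d x by (intro d(2)) (auto simp: E.nrm_smult simp del: of_real_divide)
    then have "(d / 2) ^ n * nrm F (P x) < 1"
      using d x P by (simp add: cont_poly_smult[OF P] F.nrm_smult norm_power del: of_real_divide)
    then show ?thesis using d by (simp add: field_simps)
  qed
  then show ?thesis by blast
qed

lemma poly_norm_upper:
  assumes P: "P \<in> cont_poly n E F" and n: "n \<ge> 1" and x: "x \<in> carrier E" "nrm E x \<le> 1"
  shows "nrm F (P x) \<le> poly_norm E F P"
  unfolding poly_norm_def
proof (rule cSup_upper)
  show "bdd_above {nrm F (P x) | x. x \<in> carrier E \<and> nrm E x \<le> 1}"
    using cont_poly_bounded[OF P n] by (auto simp: bdd_above_def)
qed (use x in blast)

lemma poly_norm_nonneg: "P \<in> cont_poly n E F \<Longrightarrow> n \<ge> 1 \<Longrightarrow> 0 \<le> poly_norm E F P"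
  using poly_norm_upper[of P n "\<zero>\<^bsub>E\<^esub>"] by (simp add: cont_poly_zero)

lemma poly_norm_le:
  assumes "\<And>x. x \<in> carrier E \<Longrightarrow> nrm E x \<le> 1 \<Longrightarrow> nrm F (P x) \<le> C"
  shows "poly_norm E F P \<le> C"
  unfolding poly_norm_def
proof (rule cSup_least)
  show "{nrm F (P x) | x. x \<in> carrier E \<and> nrm E x \<le> 1} \<noteq> {}"
    using E.M.zero_closed E.nrm_zero by fastforce
qed (use assms in auto)

lemma poly_norm_bound:
  assumes P: "P \<in> cont_poly n E F" and n: "n \<ge> 1" and x: "x \<in> carrier E"
  shows "nrm F (P x) \<le> poly_norm E F P * nrm E x ^ n"
proof -
  obtain u where u: "u \<in> carrier E" "nrm E u \<le> 1" "x = of_real (nrm E x) \<odot>\<^bsub>E\<^esub> u"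
    by (rule E.normalize[OF x])
  have "P x = of_real (nrm E x) ^ n \<odot>\<^bsub>F\<^esub> P u" using cont_poly_smult[OF P u(1)] u(3) by metis
  then have "nrm F (P x) = nrm E x ^ n * nrm F (P u)"
    using P u x by (simp add: F.nrm_smult norm_power E.nrm_nonneg)
  also have "\<dots> \<le> nrm E x ^ n * poly_norm E F P"
    using poly_norm_upper[OF P n u(1,2)] x by (intro mult_left_mono) (auto simp: E.nrm_nonneg)
  finally show ?thesis by (simp add: mult.commute)
qed

text \<open>No continuity of \<open>A\<close> is assumed. The polarization is nevertheless bounded,
  as its values are combinations of values of \<open>P\<close>.\<close>

lemma polar_cont_multilinear:
  assumes A: "A \<in> multilinear n (\<lambda>_. E) F" and P: "P \<in> carrier E \<rightarrow> carrier F"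
    "\<And>x. x \<in> carrier E \<Longrightarrow> P x = A (diag n x)"
    and C: "\<And>x. x \<in> carrier E \<Longrightarrow> nrm F (P x) \<le> C * nrm E x ^ n" "0 \<le> C"
  shows "polar n E F P \<in> cont_multilinear n (\<lambda>_. E) F"
proof -
  interpret A: multilinear_map E F n A by (rule multilinear_mapI[OF A])
  interpret B: multilinear_map E F n "polar n E F P"
    by (rule multilinear_mapI[OF A.polar_multilinear[OF P(2)]])
  show ?thesis
  proof (rule B.continuous_from_bound)
    show "nrm F (polar n E F P x) \<le> real n ^ n / fact n * C * (\<Prod>i<n. nrm E (x i))" if "x \<in> tuples n E" for x
      by (rule B.bound_from_ball[OF polar_bound[OF P(1) C] that])
    show "0 \<le> real n ^ n / fact n * C" using C(2) by simp
  qed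
qed

text \<open>\<open>P\<close> is the continuous polarization composed with the diagonal embedding.
  Thus a bound on \<open>P\<close> together with any algebraic representation suffices, and no
  modulus of continuity has to be produced in applications.\<close>

lemma cont_polyI:
  assumes A: "A \<in> multilinear n (\<lambda>_. E) F" and P: "P \<in> carrier E \<rightarrow>\<^sub>E carrier F"
    "\<And>x. x \<in> carrier E \<Longrightarrow> P x = A (diag n x)"
    and C: "\<And>x. x \<in> carrier E \<Longrightarrow> nrm F (P x) \<le> C * nrm E x ^ n" "0 \<le> C"
  shows "P \<in> cont_poly n E F"
proof -
  interpret A: multilinear_map E F n A by (rule multilinear_mapI[OF A])
  let ?B = "polar n E F P"
  have P': "P \<in> carrier E \<rightarrow> carrier F" using P by auto
  have "continuous_map (ntopology E) (product_topology (\<lambda>_. ntopology E) {..<n}) (diag n)"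
    by (auto simp: continuous_map_componentwise)
  moreover have "continuous_map (product_topology (\<lambda>_. ntopology E) {..<n}) (ntopology F) ?B"
    using polar_cont_multilinear[OF A P' P(2) C] by (simp add: cont_multilinear_def)
  ultimately have "continuous_map (ntopology E) (ntopology F) (?B \<circ> diag n)"
    by (rule continuous_map_compose)
  then have "continuous_map (ntopology E) (ntopology F) P"
    by (rule continuous_map_eq) (simp add: A.polar_diag[OF P(2)])
  then show ?thesis using A P by (auto simp: cont_poly_def)
qed

lemma polar_cont_poly:
  assumes P: "P \<in> cont_poly n E F" and n: "n \<ge> 1"
  shows "polar n E F P \<in> cont_multilinear n (\<lambda>_. E) F"
    and "multilinear_norm n (\<lambda>_. E) F (polar n E F P) \<le> real n ^ n / fact n * poly_norm E F P"
    and "x \<in> carrier E \<Longrightarrow> polar n E F P (diag n x) = P x"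
proof -
  obtain A where A: "multilinear_map E F n A" "\<And>x. x \<in> carrier E \<Longrightarrow> P x = A (diag n x)"
    using cont_poly_multilinear[OF P] by blast
  interpret multilinear_map E F n A by (rule A(1))
  have P': "P \<in> carrier E \<rightarrow> carrier F" using P by auto
  show "polar n E F P \<in> cont_multilinear n (\<lambda>_. E) F"
    by (rule polar_cont_multilinear[OF multilinear P' A(2) poly_norm_bound[OF P n] poly_norm_nonneg[OF P n]])
  show "multilinear_norm n (\<lambda>_. E) F (polar n E F P) \<le> real n ^ n / fact n * poly_norm E F P"
    by (intro multilinear_norm_le polar_bound P' poly_norm_bound[OF P n] poly_norm_nonneg[OF P n])
  show "x \<in> carrier E \<Longrightarrow> polar n E F P (diag n x) = P x"
    by (rule polar_diag[OF A(2)])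
qed

end

section \<open>The closed graph theorem for families and for multilinear maps\<close>

context banach_space
begin

text \<open>The factor \<open>1 - (1 / 2) ^ j\<close> is the exact value of the partial geometric
  sum; the bound without it would not carry through the induction.\<close>

lemma geometric_partial_bound:
  assumes s: "\<And>m. s m \<in> carrier E" and d: "\<And>m. nrm E (s (Suc m) \<ominus> s m) \<le> K * (1 / 2) ^ m"
  shows "nrm E (s (m + j) \<ominus> s m) \<le> 2 * K * (1 / 2) ^ m * (1 - (1 / 2) ^ j)"
proof (induction j)
  case 0
  then show ?case using s by simp
next
  case (Suc j)
  have "nrm E (s (m + Suc j) \<ominus> s m) \<le> nrm E (s (Suc (m + j)) \<ominus> s (m + j)) + nrm E (s (m + j) \<ominus> s m)"
    using nrm_minus_triangle[OF s s s] by simp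
  also have "\<dots> \<le> K * (1 / 2) ^ (m + j) + 2 * K * (1 / 2) ^ m * (1 - (1 / 2) ^ j)"
    by (intro add_mono d Suc)
  also have "\<dots> = 2 * K * (1 / 2) ^ m * (1 - (1 / 2) ^ Suc j)"
    by (simp add: power_add algebra_simps)
  finally show ?case .
qed

lemma geometric_bound:
  assumes s: "\<And>m. s m \<in> carrier E" and d: "\<And>m. nrm E (s (Suc m) \<ominus> s m) \<le> K * (1 / 2) ^ m"
  shows "m \<le> l \<Longrightarrow> nrm E (s l \<ominus> s m) \<le> 2 * K * (1 / 2) ^ m"
proof -
  assume "m \<le> l"
  then obtain j where l: "l = m + j" using le_Suc_ex by blast
  have "0 \<le> K" using d[of 0] nrm_nonneg[OF M.minus_closed[OF s s], of "Suc 0" 0] by simp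
  then have "2 * K * (1 / 2) ^ m * (1 - (1 / 2) ^ j) \<le> 2 * K * (1 / 2) ^ m * 1"
    by (intro mult_left_mono) auto
  with geometric_partial_bound[of s, OF s d, of m j] show ?thesis by (simp add: l)
qed

lemma geometric_ncauchy:
  assumes s: "\<And>m. s m \<in> carrier E" and d: "\<And>m. nrm E (s (Suc m) \<ominus> s m) \<le> K * (1 / 2) ^ m"
  shows "ncauchy E s"
  unfolding ncauchy_def
proof (intro conjI allI impI s)
  fix e :: real assume e: "e > 0"
  have "(\<lambda>m. 2 * K * (1 / 2) ^ m) \<longlonglongrightarrow> 2 * K * 0" by (intro tendsto_mult tendsto_const LIMSEQ_power_zero) auto
  then have "\<forall>\<^sub>F m in sequentially. 2 * K * (1 / 2) ^ m < e" using e by (intro order_tendstoD(2)) auto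
  then obtain N where N: "\<And>m. m \<ge> N \<Longrightarrow> 2 * K * (1 / 2) ^ m < e" by (auto simp: eventually_sequentially)
  have "nrm E (s k \<ominus> s l) < e" if "k \<ge> N" "l \<ge> N" for k l
  proof (cases "k \<le> l")
    case True
    then show ?thesis
      using geometric_bound[of s, OF s d True] N[OF that(1)] nrm_minus_commute[OF s s, of k l] by simp
  next
    case False
    then show ?thesis using geometric_bound[of s K l k, OF s d] N[OF that(2)] by simp
  qed
  then show "\<exists>N. \<forall>k\<ge>N. \<forall>l\<ge>N. nrm E (s k \<ominus> s l) < e" by blast
qed

end

context banach_pair
begin

text \<open>Closed graph theorem and uniform boundedness principle in one statement, as the induction on the number of variables below needs both.\<close>

lemma closed_graph_family:
  assumes T: "\<And>i x. i \<in> I \<Longrightarrow> x \<in> carrier E \<Longrightarrow> T i x \<in> carrier F"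
    and add: "\<And>i x y. i \<in> I \<Longrightarrow> x \<in> carrier E \<Longrightarrow> y \<in> carrier E \<Longrightarrow> T i (x \<oplus>\<^bsub>E\<^esub> y) = T i x \<oplus>\<^bsub>F\<^esub> T i y"
    and smult: "\<And>i x c. i \<in> I \<Longrightarrow> x \<in> carrier E \<Longrightarrow> T i (c \<odot>\<^bsub>E\<^esub> x) = c \<odot>\<^bsub>F\<^esub> T i x"
    and graph: "\<And>i s x y. i \<in> I \<Longrightarrow> nlim E s x \<Longrightarrow> nlim F (\<lambda>k. T i (s k)) y \<Longrightarrow> y = T i x"
    and pointwise: "\<And>x. x \<in> carrier E \<Longrightarrow> \<exists>C. \<forall>i\<in>I. nrm F (T i x) \<le> C"
  shows "\<exists>C. \<forall>i\<in>I. \<forall>x\<in>carrier E. nrm E x \<le> 1 \<longrightarrow> nrm F (T i x) \<le> C"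
proof -
  have minus: "T i (x \<ominus>\<^bsub>E\<^esub> y) = T i x \<ominus>\<^bsub>F\<^esub> T i y" if "i \<in> I" "x \<in> carrier E" "y \<in> carrier E" for i x y
    using that T by (simp add: E.minus_eq' F.minus_eq' add smult)
  \<comment> \<open>By the pointwise bounds these sets cover the space. They are not known to be
    closed, since no \<open>T i\<close> is known to be continuous, so Baire's theorem is applied to
    their closures.\<close>
  define B where "B k = {x \<in> carrier E. \<forall>i\<in>I. nrm F (T i x) \<le> real k}" for k
  have "\<exists>k. E.mtopology interior_of (E.mtopology closure_of B k) \<noteq> {}"
  proof (rule ccontr)
    assume none: "\<not> ?thesis"
    have "E.mtopology interior_of \<Union> (range (\<lambda>k. E.mtopology closure_of B k)) = {}"
      using none by (intro E.metric_Baire_category_alt E.complete) auto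
    moreover have "\<Union> (range (\<lambda>k. E.mtopology closure_of B k)) = carrier E"
    proof
      show "\<Union> (range (\<lambda>k. E.mtopology closure_of B k)) \<subseteq> carrier E"
        using closure_of_subset_topspace[of E.mtopology] by auto
      show "carrier E \<subseteq> \<Union> (range (\<lambda>k. E.mtopology closure_of B k))"
      proof
        fix x assume x: "x \<in> carrier E"
        obtain C where C: "\<forall>i\<in>I. nrm F (T i x) \<le> C" using pointwise[OF x] by blast
        obtain k where "C \<le> real k" using real_arch_simple by blast
        then have "x \<in> B k" using C x by (auto simp: B_def intro: order_trans)
        moreover have "B k \<subseteq> E.mtopology closure_of B k"
          by (intro closure_of_subset) (auto simp: B_def)
        ultimately show "x \<in> \<Union> (range (\<lambda>k. E.mtopology closure_of B k))" by blast
      qed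
    qed
    ultimately have "E.mtopology interior_of topspace E.mtopology = {}"
      by (simp only: E.topspace_mtopology)
    then have "carrier E = {}" by (metis interior_of_topspace E.topspace_mtopology)
    then show False using E.M.zero_closed by blast
  qed
  then obtain k a e where a: "a \<in> carrier E" "e > 0" "E.mball a e \<subseteq> E.mtopology closure_of B k"
  proof -
    assume *: "\<exists>k. E.mtopology interior_of (E.mtopology closure_of B k) \<noteq> {}"
    then obtain k a where ka: "a \<in> E.mtopology interior_of (E.mtopology closure_of B k)" by blast
    then obtain e where e: "e > 0" "E.mball a e \<subseteq> E.mtopology interior_of (E.mtopology closure_of B k)"
      by (meson E.openin_mtopology openin_interior_of)
    have "E.mball a e \<subseteq> E.mtopology closure_of B k"
      using e(2) interior_of_subset[of E.mtopology "E.mtopology closure_of B k"] by blast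
    moreover have "a \<in> carrier E"
      using ka interior_of_subset_topspace[of E.mtopology "E.mtopology closure_of B k"] by auto
    ultimately show thesis using that e(1) by blast
  qed
  \<comment> \<open>Bound for the images of differences of two points of \<open>B k\<close>.\<close>
  define K where "K = 2 * real k"
  have near: "\<exists>b\<in>B k. nrm E (x \<ominus>\<^bsub>E\<^esub> b) < r" if "x \<in> carrier E" "nrm E (x \<ominus>\<^bsub>E\<^esub> a) < e" "r > 0" for x r
  proof -
    have "x \<in> E.mball a e" using that a by (simp add: ndist_def E.nrm_minus_commute)
    then have "x \<in> E.mtopology closure_of B k" using a(3) by blast
    then have "\<exists>b\<in>B k. b \<in> E.mball x r" using that(3) by (auto simp: E.metric_closure_of)
    then show ?thesis by (auto simp: ndist_def)
  qed
  \<comment> \<open>The ball about \<open>a\<close> is moved to the origin by writing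
    \<open>x = (x + a) - a\<close> and approximating both terms from \<open>B k\<close>.\<close>
  have approx1: "\<exists>z\<in>carrier E. nrm E (x \<ominus>\<^bsub>E\<^esub> z) < r \<and> (\<forall>i\<in>I. nrm F (T i z) \<le> K)"
    if x: "x \<in> carrier E" "nrm E x < e" and r: "r > 0" for x r
  proof -
    have eq: "(x \<oplus>\<^bsub>E\<^esub> a) \<ominus>\<^bsub>E\<^esub> a = x" using x a by (simp add: a_minus_def E.M.a_assoc E.M.r_neg)
    obtain b where b: "b \<in> B k" "nrm E ((x \<oplus>\<^bsub>E\<^esub> a) \<ominus>\<^bsub>E\<^esub> b) < r / 2"
      using near[of "x \<oplus>\<^bsub>E\<^esub> a" "r / 2"] x a r unfolding eq by auto
    obtain c where c: "c \<in> B k" "nrm E (a \<ominus>\<^bsub>E\<^esub> c) < r / 2"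
      using near[of a "r / 2"] a r by auto
    have bc: "b \<in> carrier E" "c \<in> carrier E" using b c by (auto simp: B_def)
    have "x \<ominus>\<^bsub>E\<^esub> (b \<ominus>\<^bsub>E\<^esub> c) = ((x \<oplus>\<^bsub>E\<^esub> a) \<ominus>\<^bsub>E\<^esub> b) \<ominus>\<^bsub>E\<^esub> (a \<ominus>\<^bsub>E\<^esub> c)"
    proof -
      have "((x \<oplus>\<^bsub>E\<^esub> a) \<ominus>\<^bsub>E\<^esub> b) \<ominus>\<^bsub>E\<^esub> (a \<ominus>\<^bsub>E\<^esub> c) = ((x \<oplus>\<^bsub>E\<^esub> a) \<ominus>\<^bsub>E\<^esub> a) \<ominus>\<^bsub>E\<^esub> (b \<ominus>\<^bsub>E\<^esub> c)"
        using x a bc by (simp add: a_minus_def E.M.minus_add E.M.a_ac)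
      then show ?thesis by (simp add: eq)
    qed
    then have "nrm E (x \<ominus>\<^bsub>E\<^esub> (b \<ominus>\<^bsub>E\<^esub> c)) \<le> nrm E ((x \<oplus>\<^bsub>E\<^esub> a) \<ominus>\<^bsub>E\<^esub> b) + nrm E (a \<ominus>\<^bsub>E\<^esub> c)"
      using x a bc E.nrm_minus_le[of "(x \<oplus>\<^bsub>E\<^esub> a) \<ominus>\<^bsub>E\<^esub> b" "a \<ominus>\<^bsub>E\<^esub> c"] by simp
    then have "nrm E (x \<ominus>\<^bsub>E\<^esub> (b \<ominus>\<^bsub>E\<^esub> c)) < r" using b c by simp
    moreover have "nrm F (T i (b \<ominus>\<^bsub>E\<^esub> c)) \<le> K" if i: "i \<in> I" for i
    proof -
      have "nrm F (T i b \<ominus>\<^bsub>F\<^esub> T i c) \<le> nrm F (T i b) + nrm F (T i c)"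
        using T[OF i] bc by (intro F.nrm_minus_le)
      moreover have "nrm F (T i b) \<le> real k" "nrm F (T i c) \<le> real k"
        using b(1) c(1) i by (auto simp: B_def)
      ultimately show ?thesis using minus[OF i bc] by (simp add: K_def)
    qed
    ultimately show ?thesis using bc by (intro bexI[of _ "b \<ominus>\<^bsub>E\<^esub> c"]) auto
  qed
  \<comment> \<open>The same at scale \<open>t\<close>: shrinking the ball by \<open>t\<close>
    shrinks the bound on the images by \<open>t\<close>.\<close>
  have approx: "\<exists>z\<in>carrier E. nrm E (x \<ominus>\<^bsub>E\<^esub> z) < r \<and> (\<forall>i\<in>I. nrm F (T i z) \<le> K * t)"
    if x: "x \<in> carrier E" "nrm E x < e * t" and r: "r > 0" and t: "t > 0" for x r t
  proof -
    let ?c = "of_real (inverse t)"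
    have "nrm E (?c \<odot>\<^bsub>E\<^esub> x) < e" using x t by (simp add: E.nrm_smult norm_inverse norm_divide field_simps)
    then obtain z where z: "z \<in> carrier E" "nrm E (?c \<odot>\<^bsub>E\<^esub> x \<ominus>\<^bsub>E\<^esub> z) < r / t" "\<forall>i\<in>I. nrm F (T i z) \<le> K"
      using approx1[of "?c \<odot>\<^bsub>E\<^esub> x" "r / t"] x r t by auto
    have one: "of_real t * ?c = (1 :: 'k)" using t by (simp flip: of_real_mult)
    have "x \<ominus>\<^bsub>E\<^esub> of_real t \<odot>\<^bsub>E\<^esub> z = of_real t \<odot>\<^bsub>E\<^esub> (?c \<odot>\<^bsub>E\<^esub> x \<ominus>\<^bsub>E\<^esub> z)"
      using x z t by (simp only: E.smult_minus E.smult_in E.smult_smult one E.smult_1)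
    then have "nrm E (x \<ominus>\<^bsub>E\<^esub> of_real t \<odot>\<^bsub>E\<^esub> z) = t * nrm E (?c \<odot>\<^bsub>E\<^esub> x \<ominus>\<^bsub>E\<^esub> z)"
      using x z t by (simp only: E.nrm_smult E.M.minus_closed E.smult_in norm_of_real abs_of_pos)
    also have "\<dots> < t * (r / t)" using z t by (intro mult_strict_left_mono) auto
    finally have "nrm E (x \<ominus>\<^bsub>E\<^esub> of_real t \<odot>\<^bsub>E\<^esub> z) < r" using t by simp
    moreover have "nrm F (T i (of_real t \<odot>\<^bsub>E\<^esub> z)) \<le> K * t" if "i \<in> I" for i
      using that z t T by (simp add: smult F.nrm_smult mult.commute mult_left_mono)
    ultimately show ?thesis using z by (intro bexI[of _ "of_real t \<odot>\<^bsub>E\<^esub> z"]) auto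
  qed
  \<comment> \<open>Successive approximation: \<open>x\<close> is a limit of partial sums whose images under every \<open>T i\<close> form a geometrically convergent series.\<close>
  have main: "nrm F (T i x) \<le> 2 * K" if x: "x \<in> carrier E" "nrm E x < e" and i: "i \<in> I" for x i
  proof -
    \<comment> \<open>The clause for \<open>m = 0\<close> starts the sequence at zero, so that
      bounds on the increments become bounds on the images of the partial sums.\<close>
    have "\<exists>s. \<forall>m. (s m \<in> carrier E \<and> nrm E (x \<ominus>\<^bsub>E\<^esub> s m) < e * (1 / 2) ^ m \<and> (m = 0 \<longrightarrow> s m = \<zero>\<^bsub>E\<^esub>)) \<and>
      nrm F (T i (s (Suc m)) \<ominus>\<^bsub>F\<^esub> T i (s m)) \<le> K * (1 / 2) ^ m"
    proof (rule dependent_nat_choice)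
      show "\<exists>y. y \<in> carrier E \<and> nrm E (x \<ominus>\<^bsub>E\<^esub> y) < e * (1 / 2) ^ 0 \<and> ((0::nat) = 0 \<longrightarrow> y = \<zero>\<^bsub>E\<^esub>)"
        using x by (intro exI[of _ "\<zero>\<^bsub>E\<^esub>"]) simp
    next
      fix y m assume y: "y \<in> carrier E \<and> nrm E (x \<ominus>\<^bsub>E\<^esub> y) < e * (1 / 2) ^ m \<and> (m = 0 \<longrightarrow> y = \<zero>\<^bsub>E\<^esub>)"
      then obtain z where z: "z \<in> carrier E" "nrm E ((x \<ominus>\<^bsub>E\<^esub> y) \<ominus>\<^bsub>E\<^esub> z) < e * (1 / 2) ^ Suc m"
        "\<forall>i\<in>I. nrm F (T i z) \<le> K * (1 / 2) ^ m"
        using approx[of "x \<ominus>\<^bsub>E\<^esub> y" "(1 / 2) ^ m" "e * (1 / 2) ^ Suc m"] x a by auto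
      have "x \<ominus>\<^bsub>E\<^esub> (y \<oplus>\<^bsub>E\<^esub> z) = (x \<ominus>\<^bsub>E\<^esub> y) \<ominus>\<^bsub>E\<^esub> z"
        using x y z by (simp add: a_minus_def E.M.minus_add E.M.a_assoc)
      moreover have "T i (y \<oplus>\<^bsub>E\<^esub> z) \<ominus>\<^bsub>F\<^esub> T i y = T i z"
      proof -
        have "(y \<oplus>\<^bsub>E\<^esub> z) \<ominus>\<^bsub>E\<^esub> y = z" using y z by (simp add: a_minus_def E.M.a_comm[of y z] E.M.a_assoc E.M.r_neg)
        then show ?thesis using y z minus[OF i, of "y \<oplus>\<^bsub>E\<^esub> z" y] by simp
      qed
      ultimately show "\<exists>w. (w \<in> carrier E \<and> nrm E (x \<ominus>\<^bsub>E\<^esub> w) < e * (1 / 2) ^ Suc m \<and> (Suc m = 0 \<longrightarrow> w = \<zero>\<^bsub>E\<^esub>)) \<and>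
          nrm F (T i w \<ominus>\<^bsub>F\<^esub> T i y) \<le> K * (1 / 2) ^ m"
        using y z i by (intro exI[of _ "y \<oplus>\<^bsub>E\<^esub> z"]) auto
    qed
    then obtain s where s: "\<And>m. s m \<in> carrier E" "\<And>m. nrm E (x \<ominus>\<^bsub>E\<^esub> s m) < e * (1 / 2) ^ m" "s 0 = \<zero>\<^bsub>E\<^esub>"
      "\<And>m. nrm F (T i (s (Suc m)) \<ominus>\<^bsub>F\<^esub> T i (s m)) \<le> K * (1 / 2) ^ m" by blast
    have lim: "nlim E s x"
    proof (rule E.nlimI)
      show "nrm E (s m \<ominus>\<^bsub>E\<^esub> x) \<le> e * (1 / 2) ^ m" for m
        using s(2)[of m] E.nrm_minus_commute[OF s(1) x(1), of m] by simp
      have "(\<lambda>m. e * (1 / 2) ^ m) \<longlonglongrightarrow> e * 0" by (intro tendsto_mult tendsto_const LIMSEQ_power_zero) auto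
      then show "(\<lambda>m. e * (1 / 2) ^ m) \<longlonglongrightarrow> 0" by simp
    qed (use s x in auto)
    note Ts = T[OF i s(1)]
    \<comment> \<open>Completeness of \<open>F\<close> yields some limit; only the closed graph
      identifies it as \<open>T i x\<close>.\<close>
    obtain y where y: "nlim F (\<lambda>m. T i (s m)) y"
      using F.ncauchy_nlim[OF F.geometric_ncauchy[of "\<lambda>m. T i (s m)", OF Ts s(4)]] by blast
    have "T i (s 0) = \<zero>\<^bsub>F\<^esub>" using smult[OF i E.M.zero_closed, of 0] T[OF i E.M.zero_closed] by (simp add: s(3))
    then have "nrm F (T i (s m)) \<le> 2 * K" for m
      using F.geometric_bound[of "\<lambda>m. T i (s m)", OF Ts s(4), of 0 m] Ts[of m] by simp
    then have "nrm F y \<le> 2 * K" by (rule F.nlim_nrm_le[OF y])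
    then show ?thesis using graph[OF i lim y] by simp
  qed
  show ?thesis
  proof (intro exI ballI impI)
    fix i x assume i: "i \<in> I" and x: "x \<in> carrier E" "nrm E x \<le> 1"
    \<comment> \<open>Multiplication by \<open>e / 2\<close> takes the closed unit ball into the
      open ball of radius \<open>e\<close>; hence the constant \<open>4 * K / e\<close>.\<close>
    have "e / 2 * nrm E x \<le> e / 2 * 1" using x a by (intro mult_left_mono) auto
    then have "nrm F (T i (of_real (e / 2) \<odot>\<^bsub>E\<^esub> x)) \<le> 2 * K"
      using x a by (intro main i) (auto simp: E.nrm_smult simp del: of_real_divide)
    then have "e / 2 * nrm F (T i x) \<le> 2 * K"
      using x a i T by (simp add: smult F.nrm_smult del: of_real_divide)
    then show "nrm F (T i x) \<le> 4 * K / e" using a by (simp add: field_simps)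
  qed
qed

end

text \<open>Induction on the number \<open>k\<close> of slots that range over the unit ball, the
  others being frozen. The maps in slot \<open>k\<close>, indexed by the entries below it, form a
  family with closed graphs; its pointwise boundedness is the induction hypothesis at
  \<open>x(k := z)\<close>, and the family principle makes the bound uniform over the unit ball in
  slot \<open>k\<close>.\<close>

lemma (in multilinear_map) closed_graph_multilinear:
  assumes graph: "\<And>x i s z y. x \<in> tuples n E \<Longrightarrow> i < n \<Longrightarrow> nlim E s z \<Longrightarrow>
      nlim F (\<lambda>k. A (x(i := s k))) y \<Longrightarrow> y = A (x(i := z))"
  shows "\<exists>C. \<forall>x\<in>tuples n E. (\<forall>i<n. nrm E (x i) \<le> 1) \<longrightarrow> nrm F (A x) \<le> C"
proof -
  define I where "I k x = {u \<in> tuples n E. (\<forall>i<k. nrm E (u i) \<le> 1) \<and> (\<forall>i<n. k \<le> i \<longrightarrow> u i = x i)}" for k x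
  have "\<exists>C. \<forall>u\<in>I k x. nrm F (A u) \<le> C" if "k \<le> n" "x \<in> tuples n E" for k x
    using that
  proof (induction k arbitrary: x)
    case 0
    have "u = x" if "u \<in> I 0 x" for u
      using that 0 by (intro PiE_ext[of u "{..<n}" "\<lambda>_. carrier E" x]) (auto simp: I_def)
    then show ?case by (intro exI[of _ "nrm F (A x)"]) auto
  next
    case (Suc k)
    then have k: "k < n" and x: "x \<in> tuples n E" by auto
    \<comment> \<open>Nothing but carrier membership is required of \<open>u k\<close>, since the
      variable \<open>z\<close> overwrites it.\<close>
    let ?J = "{u \<in> tuples n E. (\<forall>i<k. nrm E (u i) \<le> 1) \<and> (\<forall>i<n. k < i \<longrightarrow> u i = x i)}"
    have "\<exists>C. \<forall>u\<in>?J. \<forall>z\<in>carrier E. nrm E z \<le> 1 \<longrightarrow> nrm F (A (u(k := z))) \<le> C"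
    proof (rule closed_graph_family)
      fix z assume z: "z \<in> carrier E"
      obtain C where C: "\<forall>u\<in>I k (x(k := z)). nrm F (A u) \<le> C"
        using Suc.IH[OF less_imp_le[OF k] tuples_upd[OF x k z]] by blast
      have "u(k := z) \<in> I k (x(k := z))" if "u \<in> ?J" for u
        unfolding I_def
      proof (intro CollectI conjI allI impI)
        show "u(k := z) \<in> tuples n E" using that by (intro tuples_upd k z) simp
      qed (use that in auto)
      then show "\<exists>C. \<forall>u\<in>?J. nrm F (A (u(k := z))) \<le> C" using C by blast
    qed (use k slot_closed slot_add slot_smult graph in \<open>simp_all only: mem_Collect_eq\<close>)
    then obtain C where C: "\<And>u z. u \<in> ?J \<Longrightarrow> z \<in> carrier E \<Longrightarrow> nrm E z \<le> 1 \<Longrightarrow> nrm F (A (u(k := z))) \<le> C"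
      by blast
    have "nrm F (A u) \<le> C" if "u \<in> I (Suc k) x" for u
    proof -
      have "u \<in> ?J" "u k \<in> carrier E" "nrm E (u k) \<le> 1"
        using that k by (auto simp: I_def)
      from C[OF this] show ?thesis by simp
    qed
    then show ?case by blast
  qed
  from this[of n] have *: "\<exists>C. \<forall>u\<in>I n x. nrm F (A u) \<le> C" if "x \<in> tuples n E" for x using that by simp
  have "(\<lambda>i\<in>{..<n}. \<zero>\<^bsub>E\<^esub>) \<in> tuples n E" by auto
  from *[OF this] show ?thesis by (auto simp: I_def)
qed

section \<open>Operators induced on sequences\<close>

lemma (in multilinear_map) slot_nlim:
  assumes cont: "A \<in> cont_multilinear n (\<lambda>_. E) F" and n: "i < n"
    and x: "x \<in> tuples n E" and s: "nlim E s z"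
  shows "nlim F (\<lambda>k. A (x(i := s k))) (A (x(i := z)))"
proof -
  have sk: "s k \<in> carrier E" and z: "z \<in> carrier E" for k using s by (auto simp: nlim_def)
  let ?C = "multilinear_norm n (\<lambda>_. E) F A * (\<Prod>m\<in>{..<n} - {i}. nrm E (x m))"
  show ?thesis
  proof (rule F.nlimI)
    show "A (x(i := s k)) \<in> carrier F" for k by (intro slot_closed x n sk)
    show "A (x(i := z)) \<in> carrier F" by (intro slot_closed x n z)
    show "nrm F (A (x(i := s k)) \<ominus>\<^bsub>F\<^esub> A (x(i := z))) \<le> ?C * nrm E (s k \<ominus>\<^bsub>E\<^esub> z)" for k
    proof -
      let ?y = "x(i := s k \<ominus>\<^bsub>E\<^esub> z)"
      have y: "?y \<in> tuples n E" by (intro tuples_upd x n E.M.minus_closed sk z)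
      have "A (x(i := s k)) \<ominus>\<^bsub>F\<^esub> A (x(i := z)) = A ?y" by (rule slot_minus[OF x n sk z, symmetric])
      also have "nrm F (A ?y) \<le> multilinear_norm n (\<lambda>_. E) F A * (\<Prod>m<n. nrm E (?y m))"
        using n by (intro multilinear_norm_bound cont y) auto
      also have "(\<Prod>m<n. nrm E (?y m)) = nrm E (s k \<ominus>\<^bsub>E\<^esub> z) * (\<Prod>m\<in>{..<n} - {i}. nrm E (x m))"
        using n by (subst prod.remove[of _ i]) auto
      finally show ?thesis by (simp only: mult_ac)
    qed
    have "(\<lambda>k. nrm E (s k \<ominus>\<^bsub>E\<^esub> z)) \<longlonglongrightarrow> 0" using s by (simp add: nlim_def)
    from tendsto_mult_left[OF this, of ?C]
    show "(\<lambda>k. ?C * nrm E (s k \<ominus>\<^bsub>E\<^esub> z)) \<longlonglongrightarrow> 0" by simp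
  qed
qed

locale seq_class =
  fixes X :: "('k::{real_normed_field,banach}, 'a) seq_rule"
  assumes sequence_class: "sequence_class X"

locale seq_space = seq_class X + E: banach_space E
  for X :: "('k::{real_normed_field,banach}, 'a) seq_rule" and E :: "('k, 'k + 'a) nspace"
begin

lemma banach_seq: "banach_space (X E)"
  using sequence_class E.banach_space_axioms by (auto simp: sequence_class_def)

sublocale XE: banach_space "X E"
  by (rule banach_seq)

lemma emb: "nembedded (X E) (ell_infty E)"
  using sequence_class E.banach_space_axioms by (auto simp: sequence_class_def)

lemma c00_subset: "c00 E \<subseteq> carrier (X E)"
  using sequence_class E.banach_space_axioms by (auto simp: sequence_class_def)

lemma ell_mem: "x \<in> carrier (X E) \<Longrightarrow> (\<forall>j. x j \<in> carrier E) \<and> bdd_above (range (\<lambda>j. nrm E (x j)))"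
  using emb by (auto simp: nembedded_def ell_infty_def mk_nspace_def)

lemma coord_closed [simp]: "x \<in> carrier (X E) \<Longrightarrow> x j \<in> carrier E"
  using ell_mem by blast

lemma zero_coord [simp]: "\<zero>\<^bsub>X E\<^esub> j = \<zero>\<^bsub>E\<^esub>"
  using emb by (auto simp: nembedded_def ell_infty_def mk_nspace_def)

lemma add_coord: "x \<in> carrier (X E) \<Longrightarrow> y \<in> carrier (X E) \<Longrightarrow> (x \<oplus>\<^bsub>X E\<^esub> y) j = x j \<oplus>\<^bsub>E\<^esub> y j"
  using emb by (auto simp: nembedded_def ell_infty_def mk_nspace_def)

lemma smult_coord: "x \<in> carrier (X E) \<Longrightarrow> (c \<odot>\<^bsub>X E\<^esub> x) j = c \<odot>\<^bsub>E\<^esub> x j"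
  using emb by (auto simp: nembedded_def ell_infty_def mk_nspace_def)

lemma minus_coord: "x \<in> carrier (X E) \<Longrightarrow> y \<in> carrier (X E) \<Longrightarrow> (x \<ominus>\<^bsub>X E\<^esub> y) j = x j \<ominus>\<^bsub>E\<^esub> y j"
  by (simp add: XE.minus_eq' E.minus_eq' add_coord smult_coord)

lemma nrm_coord: "x \<in> carrier (X E) \<Longrightarrow> nrm E (x j) \<le> nrm (X E) x"
proof -
  assume x: "x \<in> carrier (X E)"
  have "nrm E (x j) \<le> (SUP j. nrm E (x j))" using ell_mem[OF x] by (intro cSUP_upper) auto
  also have "\<dots> \<le> nrm (X E) x" using emb x by (auto simp: nembedded_def ell_infty_def mk_nspace_def)
  finally show ?thesis .
qed

lemma finsum_coord:
  "finite A \<Longrightarrow> f \<in> A \<rightarrow> carrier (X E) \<Longrightarrow> finsum (X E) f A j = (\<Oplus>\<^bsub>E\<^esub>i\<in>A. f i j)"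
proof (induction A rule: finite_induct)
  case (insert x A)
  then have "finsum (X E) f (insert x A) = f x \<oplus>\<^bsub>X E\<^esub> finsum (X E) f A"
    by (intro XE.M.finsum_insert) auto
  moreover have "(\<Oplus>\<^bsub>E\<^esub>i\<in>insert x A. f i j) = f x j \<oplus>\<^bsub>E\<^esub> (\<Oplus>\<^bsub>E\<^esub>i\<in>A. f i j)"
    using insert by (intro E.M.finsum_insert) (auto simp: Pi_def)
  moreover have "finsum (X E) f A \<in> carrier (X E)" "f x \<in> carrier (X E)"
    using insert by (auto intro!: XE.M.finsum_closed)
  ultimately show ?case using insert by (simp add: add_coord Pi_def)
qed simp

lemma nlim_coord: "nlim (X E) s x \<Longrightarrow> nlim E (\<lambda>k. s k j) (x j)"
  by (rule E.nlimI[where b = "\<lambda>k. nrm (X E) (s k \<ominus>\<^bsub>X E\<^esub> x)"])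
    (auto simp: nlim_def nrm_coord simp flip: minus_coord)

text \<open>Sequences with one nonzero term, \<open>(v, 0, 0, ...)\<close>: coordinate 0 of an
  induced map at such a sequence returns the value of the original map at \<open>v\<close>.\<close>

definition single :: "'k + 'a \<Rightarrow> nat \<Rightarrow> 'k + 'a" where
  "single v = (\<lambda>j. if j = 0 then v else \<zero>\<^bsub>E\<^esub>)"

lemma single_closed [simp]: "v \<in> carrier E \<Longrightarrow> single v \<in> carrier (X E)"
  using c00_subset by (auto simp: c00_def single_def intro!: exI[of _ 1])

lemma single_0 [simp]: "single v 0 = v"
  by (simp add: single_def)

end

text \<open>The assumption \<open>maps\<close> is membership without any bound; continuity of the
  induced polynomial is a conclusion.\<close>

locale seq_pair = banach_pair E F + XE: seq_space X E + YF: seq_space Y F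
  for X Y :: "('k::{real_normed_field,banach}, 'a) seq_rule" and E F :: "('k, 'k + 'a) nspace" +
  fixes n :: nat and P :: "'k + 'a \<Rightarrow> 'k + 'a"
  assumes P: "P \<in> cont_poly n E F" and n: "n \<ge> 1"
    and maps: "x \<in> carrier (X E) \<Longrightarrow> (\<lambda>j. P (x j)) \<in> carrier (Y F)"
begin

abbreviation "P' \<equiv> induced_poly X E P"
abbreviation "B \<equiv> polar n E F P"

definition row :: "(nat \<Rightarrow> nat \<Rightarrow> 'k + 'a) \<Rightarrow> nat \<Rightarrow> nat \<Rightarrow> 'k + 'a" where
  "row x j = (\<lambda>i\<in>{..<n}. x i j)"

lemma row_tuple: "x \<in> tuples n (X E) \<Longrightarrow> row x j \<in> tuples n E"
  by (auto simp: row_def)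

lemma row_upd: "i < n \<Longrightarrow> row (x(i := y)) j = (row x j)(i := y j)"
  by (auto simp: row_def)

lemma row_diag: "row (diag n x) j = diag n (x j)"
  by (auto simp: row_def)

lemma induced_closed: "x \<in> carrier (X E) \<Longrightarrow> P' x \<in> carrier (Y F)"
  using maps by (simp add: induced_poly_def)

lemma induced_coord: "x \<in> carrier (X E) \<Longrightarrow> P' x j = P (x j)"
  by (simp add: induced_poly_def)

lemma polar_induced_closed:
  assumes x: "x \<in> tuples n (X E)"
  shows "polar n (X E) (Y F) P' x \<in> carrier (Y F)"
proof -
  have "P' (\<Oplus>\<^bsub>X E\<^esub>i\<in>{..<n}. subset_sign S i \<odot>\<^bsub>X E\<^esub> x i) \<in> carrier (Y F)" for S
    using x by (intro induced_closed XE.XE.M.finsum_closed) auto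
  then show ?thesis
    using x unfolding polar_def by (simp add: YF.XE.M.finsum_closed)
qed

text \<open>Coordinates are linear, so polarizing the induced map amounts to inducing the
  polarization \<open>B\<close>. This transfers properties of \<open>B\<close> to the sequence
  spaces.\<close>

lemma polar_induced_coord:
  assumes x: "x \<in> tuples n (X E)"
  shows "polar n (X E) (Y F) P' x j = B (row x j)"
proof -
  let ?s = "\<lambda>S. \<Oplus>\<^bsub>X E\<^esub>i\<in>{..<n}. subset_sign S i \<odot>\<^bsub>X E\<^esub> x i"
  have s: "?s S \<in> carrier (X E)" for S using x by (intro XE.XE.M.finsum_closed) auto
  have sj: "?s S j = (\<Oplus>\<^bsub>E\<^esub>i\<in>{..<n}. subset_sign S i \<odot>\<^bsub>E\<^esub> row x j i)" for S
  proof -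
    have "?s S j = (\<Oplus>\<^bsub>E\<^esub>i\<in>{..<n}. (subset_sign S i \<odot>\<^bsub>X E\<^esub> x i) j)"
      using x by (intro XE.finsum_coord) auto
    also have "\<dots> = (\<Oplus>\<^bsub>E\<^esub>i\<in>{..<n}. subset_sign S i \<odot>\<^bsub>E\<^esub> row x j i)"
      using x row_tuple[OF x] by (intro E.M.finsum_cong_in) (auto simp: XE.smult_coord row_def)
    finally show ?thesis .
  qed
  have "(\<Oplus>\<^bsub>Y F\<^esub>S\<in>Pow {..<n}. (\<Prod>i<n. subset_sign S i) \<odot>\<^bsub>Y F\<^esub> P' (?s S)) j =
      (\<Oplus>\<^bsub>F\<^esub>S\<in>Pow {..<n}. ((\<Prod>i<n. subset_sign S i) \<odot>\<^bsub>Y F\<^esub> P' (?s S)) j)"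
    using induced_closed[OF s] by (intro YF.finsum_coord) auto
  also have "\<dots> = (\<Oplus>\<^bsub>F\<^esub>S\<in>Pow {..<n}. (\<Prod>i<n. subset_sign S i) \<odot>\<^bsub>F\<^esub> P (\<Oplus>\<^bsub>E\<^esub>i\<in>{..<n}. subset_sign S i \<odot>\<^bsub>E\<^esub> row x j i))"
  proof (rule F.M.finsum_cong_in[OF refl])
    fix S
    have "((\<Prod>i<n. subset_sign S i) \<odot>\<^bsub>Y F\<^esub> P' (?s S)) j = (\<Prod>i<n. subset_sign S i) \<odot>\<^bsub>F\<^esub> P (?s S j)"
      by (simp only: YF.smult_coord[OF induced_closed[OF s]] induced_coord[OF s])
    then show "((\<Prod>i<n. subset_sign S i) \<odot>\<^bsub>Y F\<^esub> P' (?s S)) j =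
      (\<Prod>i<n. subset_sign S i) \<odot>\<^bsub>F\<^esub> P (\<Oplus>\<^bsub>E\<^esub>i\<in>{..<n}. subset_sign S i \<odot>\<^bsub>E\<^esub> row x j i)" unfolding sj .
    have "P (?s S j) \<in> carrier F" by (intro cont_poly_closed[OF P] XE.coord_closed s)
    then show "(\<Prod>i<n. subset_sign S i) \<odot>\<^bsub>F\<^esub> P (\<Oplus>\<^bsub>E\<^esub>i\<in>{..<n}. subset_sign S i \<odot>\<^bsub>E\<^esub> row x j i) \<in> carrier F"
      unfolding sj by (rule F.smult_in)
  qed
  finally have eq: "(\<Oplus>\<^bsub>Y F\<^esub>S\<in>Pow {..<n}. (\<Prod>i<n. subset_sign S i) \<odot>\<^bsub>Y F\<^esub> P' (?s S)) j =
    (\<Oplus>\<^bsub>F\<^esub>S\<in>Pow {..<n}. (\<Prod>i<n. subset_sign S i) \<odot>\<^bsub>F\<^esub> P (\<Oplus>\<^bsub>E\<^esub>i\<in>{..<n}. subset_sign S i \<odot>\<^bsub>E\<^esub> row x j i))" .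
  have "(\<Oplus>\<^bsub>Y F\<^esub>S\<in>Pow {..<n}. (\<Prod>i<n. subset_sign S i) \<odot>\<^bsub>Y F\<^esub> P' (?s S)) \<in> carrier (Y F)"
    using induced_closed[OF s] by (intro YF.XE.M.finsum_closed) auto
  from YF.smult_coord[OF this] show ?thesis
    unfolding polar_def restrict_apply'[OF x] restrict_apply'[OF row_tuple[OF x]] eq[symmetric] .
qed

lemma induced_cont_poly: "P' \<in> cont_poly n (X E) (Y F)"
proof -
  interpret S: banach_pair "X E" "Y F" ..
  obtain A where A: "multilinear_map E F n A" "\<And>x. x \<in> carrier E \<Longrightarrow> P x = A (diag n x)"
    using cont_poly_multilinear[OF P] by blast
  note B = polar_cont_poly[OF P n]
  interpret B: multilinear_map E F n B
    using B(1) by (intro multilinear_mapI) (simp add: cont_multilinear_def)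
  let ?B = "polar n (X E) (Y F) P'"
  note Bc = polar_induced_closed and Bj = polar_induced_coord
  \<comment> \<open>No multilinear map representing \<open>P'\<close> is available at this point, so
    \<open>polar_multilinear\<close> cannot be applied to it. Multilinearity is checked in each
    coordinate, where \<open>?B\<close> is \<open>B\<close> on rows.\<close>
  have mult: "?B \<in> multilinear n (\<lambda>_. X E) (Y F)"
    unfolding multilinear_def
  proof (intro CollectI conjI ballI allI impI)
    show "?B \<in> tuples n (X E) \<rightarrow>\<^sub>E carrier (Y F)"
      using Bc by (intro PiE_I) (auto simp: polar_def)
  next
    fix x i y z c
    assume xy: "x \<in> tuples n (X E)" "i < n" "y \<in> carrier (X E)" "z \<in> carrier (X E)"
    have t: "x(i := y) \<in> tuples n (X E)" "x(i := z) \<in> tuples n (X E)"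
      "x(i := y \<oplus>\<^bsub>X E\<^esub> z) \<in> tuples n (X E)" "x(i := c \<odot>\<^bsub>X E\<^esub> y) \<in> tuples n (X E)"
      by (intro tuples_upd xy XE.XE.smult_in XE.XE.M.a_closed)+
    note yz = XE.coord_closed[OF xy(3)] XE.coord_closed[OF xy(4)]
    show "?B (x(i := y \<oplus>\<^bsub>X E\<^esub> z)) = ?B (x(i := y)) \<oplus>\<^bsub>Y F\<^esub> ?B (x(i := z))"
    proof
      fix j
      show "?B (x(i := y \<oplus>\<^bsub>X E\<^esub> z)) j = (?B (x(i := y)) \<oplus>\<^bsub>Y F\<^esub> ?B (x(i := z))) j"
        unfolding YF.add_coord[OF Bc[OF t(1)] Bc[OF t(2)]] Bj[OF t(1)] Bj[OF t(2)] Bj[OF t(3)] row_upd[OF xy(2)]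
          XE.add_coord[OF xy(3,4)]
        by (rule B.slot_add[OF row_tuple[OF xy(1)] xy(2) yz])
    qed
    show "?B (x(i := c \<odot>\<^bsub>X E\<^esub> y)) = c \<odot>\<^bsub>Y F\<^esub> ?B (x(i := y))"
    proof
      fix j
      show "?B (x(i := c \<odot>\<^bsub>X E\<^esub> y)) j = (c \<odot>\<^bsub>Y F\<^esub> ?B (x(i := y))) j"
        unfolding YF.smult_coord[OF Bc[OF t(1)]] Bj[OF t(1)] Bj[OF t(4)] row_upd[OF xy(2)] XE.smult_coord[OF xy(3)]
        by (rule B.slot_smult[OF row_tuple[OF xy(1)] xy(2) yz(1)])
    qed
  qed
  interpret I: multilinear_map "X E" "Y F" n ?B by (rule S.multilinear_mapI[OF mult])
  have "\<exists>C. \<forall>x\<in>tuples n (X E). (\<forall>i<n. nrm (X E) (x i) \<le> 1) \<longrightarrow> nrm (Y F) (?B x) \<le> C"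
  proof (rule I.closed_graph_multilinear)
    fix x i s z y
    assume x: "x \<in> tuples n (X E)" "i < n" and s: "nlim (X E) s z" and y: "nlim (Y F) (\<lambda>k. ?B (x(i := s k))) y"
    have sk: "s k \<in> carrier (X E)" and z: "z \<in> carrier (X E)" for k using s by (auto simp: nlim_def)
    show "y = ?B (x(i := z))"
    proof
      fix j
      have "nlim F (\<lambda>k. ?B (x(i := s k)) j) (y j)" by (rule YF.nlim_coord[OF y])
      \<comment> \<open>Continuity of \<open>P\<close> enters here, through that of its
        polarization.\<close>
      moreover have "nlim F (\<lambda>k. B ((row x j)(i := s k j))) (B ((row x j)(i := z j)))"
        by (rule B.slot_nlim[OF B(1) x(2) row_tuple[OF x(1)] XE.nlim_coord[OF s]])
      ultimately show "y j = ?B (x(i := z)) j"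
        unfolding Bj[OF tuples_upd[OF x sk]] Bj[OF tuples_upd[OF x z]] row_upd[OF x(2)] by (rule F.nlim_unique)
    qed
  qed
  then obtain C where C: "\<And>x. x \<in> tuples n (X E) \<Longrightarrow> (\<And>i. i < n \<Longrightarrow> nrm (X E) (x i) \<le> 1) \<Longrightarrow> nrm (Y F) (?B x) \<le> C"
    by blast
  have diag: "P' x = ?B (diag n x)" if x: "x \<in> carrier (X E)" for x
  proof
    fix j
    have "diag n x \<in> tuples n (X E)" using x by auto
    from Bj[OF this] show "P' x j = ?B (diag n x) j"
      by (simp only: row_diag B(3)[OF XE.coord_closed[OF x]] induced_coord[OF x])
  qed
  show ?thesis
  proof (rule S.cont_polyI[OF mult _ diag])
    show "P' \<in> carrier (X E) \<rightarrow>\<^sub>E carrier (Y F)"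
      using induced_closed by (auto simp: induced_poly_def)
    have z: "diag n \<zero>\<^bsub>X E\<^esub> \<in> tuples n (X E)" by auto
    have "0 \<le> nrm (Y F) (?B (diag n \<zero>\<^bsub>X E\<^esub>))" by (rule YF.XE.nrm_nonneg[OF Bc[OF z]])
    also have "\<dots> \<le> C" by (rule C[OF z]) simp
    finally show "0 \<le> C" .
    fix x assume x: "x \<in> carrier (X E)"
    then have d: "diag n x \<in> tuples n (X E)" by auto
    have "nrm (Y F) (?B (diag n x)) \<le> C * (\<Prod>i<n. nrm (X E) (diag n x i))" by (rule I.bound_from_ball[OF C d])
    then show "nrm (Y F) (P' x) \<le> C * nrm (X E) x ^ n" using diag[OF x] by simp
  qed
qed

lemma summing_norm_bound:
  assumes x: "x \<in> carrier (X E)"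
  shows "nrm (Y F) (\<lambda>j. P (x j)) \<le> summing_norm X Y E F P * nrm (X E) x ^ n"
proof -
  interpret S: banach_pair "X E" "Y F" ..
  from S.poly_norm_bound[OF induced_cont_poly n x] x show ?thesis
    by (simp add: summing_norm_def induced_poly_def)
qed

lemma summing_norm_nonneg: "0 \<le> summing_norm X Y E F P"
proof -
  interpret S: banach_pair "X E" "Y F" ..
  from S.poly_norm_nonneg[OF induced_cont_poly n] show ?thesis
    by (simp add: summing_norm_def)
qed

end

lemma summing_norm_le:
  assumes "seq_space X E" "seq_space Y F"
    and "\<And>x. x \<in> carrier (X E) \<Longrightarrow> nrm (X E) x \<le> 1 \<Longrightarrow> nrm (Y F) (\<lambda>j. P (x j)) \<le> C"
  shows "summing_norm X Y E F P \<le> C"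
proof -
  interpret XE: seq_space X E by fact
  interpret YF: seq_space Y F by fact
  interpret S: banach_pair "X E" "Y F" ..
  show ?thesis
    unfolding summing_norm_def by (rule S.poly_norm_le) (simp add: induced_poly_def assms(3))
qed

lemma component_summing:
  assumes "n \<ge> 1"
  shows "component (summing_poly X Y) n E F =
    {P \<in> cont_poly n E F. \<forall>x\<in>carrier (X E). (\<lambda>j. P (x j)) \<in> carrier (Y F)}"
  using assms by (auto simp: component_def summing_poly_def)

section \<open>Operations on polynomials\<close>

context banach_pair
begin

lemma multilinear_lincomb:
  assumes A: "A \<in> multilinear n (\<lambda>_. E) F" and B: "B \<in> multilinear n (\<lambda>_. E) F"
  shows "(\<lambda>x\<in>tuples n E. A x \<oplus>\<^bsub>F\<^esub> c \<odot>\<^bsub>F\<^esub> B x) \<in> multilinear n (\<lambda>_. E) F"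
proof -
  interpret A: multilinear_map E F n A by (rule multilinear_mapI[OF A])
  interpret B: multilinear_map E F n B by (rule multilinear_mapI[OF B])
  let ?C = "\<lambda>x\<in>tuples n E. A x \<oplus>\<^bsub>F\<^esub> c \<odot>\<^bsub>F\<^esub> B x"
  show ?thesis
    unfolding multilinear_def
  proof (intro CollectI conjI ballI allI impI)
    show "?C \<in> tuples n E \<rightarrow>\<^sub>E carrier F" by (intro PiE_I) auto
  next
    fix x i y z d
    assume xy: "x \<in> tuples n E" "i < n" "y \<in> carrier E" "z \<in> carrier E"
    have t: "x(i := y) \<in> tuples n E" "x(i := z) \<in> tuples n E" "x(i := y \<oplus>\<^bsub>E\<^esub> z) \<in> tuples n E" "x(i := d \<odot>\<^bsub>E\<^esub> y) \<in> tuples n E"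
      by (intro tuples_upd xy E.smult_in E.M.a_closed)+
    have ring: "(a \<oplus>\<^bsub>F\<^esub> a') \<oplus>\<^bsub>F\<^esub> c \<odot>\<^bsub>F\<^esub> (b \<oplus>\<^bsub>F\<^esub> b') = (a \<oplus>\<^bsub>F\<^esub> c \<odot>\<^bsub>F\<^esub> b) \<oplus>\<^bsub>F\<^esub> (a' \<oplus>\<^bsub>F\<^esub> c \<odot>\<^bsub>F\<^esub> b')"
      "d \<odot>\<^bsub>F\<^esub> a \<oplus>\<^bsub>F\<^esub> c \<odot>\<^bsub>F\<^esub> (d \<odot>\<^bsub>F\<^esub> b) = d \<odot>\<^bsub>F\<^esub> (a \<oplus>\<^bsub>F\<^esub> c \<odot>\<^bsub>F\<^esub> b)"
      if "a \<in> carrier F" "a' \<in> carrier F" "b \<in> carrier F" "b' \<in> carrier F" for a a' b b'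
      using that by (simp_all add: F.smult_add_right F.M.a_ac mult.commute)
    show "?C (x(i := y \<oplus>\<^bsub>E\<^esub> z)) = ?C (x(i := y)) \<oplus>\<^bsub>F\<^esub> ?C (x(i := z))"
      unfolding restrict_apply'[OF t(1)] restrict_apply'[OF t(2)] restrict_apply'[OF t(3)] A.slot_add[OF xy] B.slot_add[OF xy]
      by (intro ring A.closed B.closed t)
    show "?C (x(i := d \<odot>\<^bsub>E\<^esub> y)) = d \<odot>\<^bsub>F\<^esub> ?C (x(i := y))"
      unfolding restrict_apply'[OF t(1)] restrict_apply'[OF t(4)] A.slot_smult[OF xy(1-3)] B.slot_smult[OF xy(1-3)]
      by (rule ring(2)[OF A.closed[OF t(1)] A.closed[OF t(1)] B.closed[OF t(1)] B.closed[OF t(1)]])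
  qed
qed

lemma cont_poly_lincomb:
  assumes P: "P \<in> cont_poly n E F" and Q: "Q \<in> cont_poly n E F" and n: "n \<ge> 1"
  shows "(\<lambda>x\<in>carrier E. P x \<oplus>\<^bsub>F\<^esub> c \<odot>\<^bsub>F\<^esub> Q x) \<in> cont_poly n E F"
proof -
  obtain A where A: "multilinear_map E F n A" "\<And>x. x \<in> carrier E \<Longrightarrow> P x = A (diag n x)"
    using cont_poly_multilinear[OF P] by blast
  obtain B where B: "multilinear_map E F n B" "\<And>x. x \<in> carrier E \<Longrightarrow> Q x = B (diag n x)"
    using cont_poly_multilinear[OF Q] by blast
  let ?C = "poly_norm E F P + norm c * poly_norm E F Q"
  show ?thesis
  proof (rule cont_polyI[OF multilinear_lincomb[OF multilinear_map.multilinear[OF A(1)] multilinear_map.multilinear[OF B(1)], of c]])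
    show "0 \<le> ?C" using poly_norm_nonneg[OF P n] poly_norm_nonneg[OF Q n] by simp
    fix x assume x: "x \<in> carrier E"
    have d: "diag n x \<in> tuples n E" using x by auto
    show "(\<lambda>x\<in>carrier E. P x \<oplus>\<^bsub>F\<^esub> c \<odot>\<^bsub>F\<^esub> Q x) x = (\<lambda>x\<in>tuples n E. A x \<oplus>\<^bsub>F\<^esub> c \<odot>\<^bsub>F\<^esub> B x) (diag n x)"
      unfolding restrict_apply'[OF d] restrict_apply'[OF x] A(2)[OF x] B(2)[OF x] ..
    have "nrm F (P x \<oplus>\<^bsub>F\<^esub> c \<odot>\<^bsub>F\<^esub> Q x) \<le> nrm F (P x) + norm c * nrm F (Q x)"
      using P Q x F.nrm_triangle[of "P x" "c \<odot>\<^bsub>F\<^esub> Q x"] by (simp add: F.nrm_smult)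
    also have "\<dots> \<le> poly_norm E F P * nrm E x ^ n + norm c * (poly_norm E F Q * nrm E x ^ n)"
      by (intro add_mono mult_left_mono poly_norm_bound P Q n x) auto
    finally show "nrm F ((\<lambda>x\<in>carrier E. P x \<oplus>\<^bsub>F\<^esub> c \<odot>\<^bsub>F\<^esub> Q x) x) \<le> ?C * nrm E x ^ n"
      using x by (simp add: algebra_simps)
  qed (use P Q in auto)
qed

lemma cont_poly_const_zero: "(\<lambda>x\<in>carrier E. \<zero>\<^bsub>F\<^esub>) \<in> cont_poly n E F"
proof (rule cont_polyI)
  show "(\<lambda>x\<in>tuples n E. \<zero>\<^bsub>F\<^esub>) \<in> multilinear n (\<lambda>_. E) F"
    unfolding multilinear_def
  proof (intro CollectI conjI ballI allI impI)
    fix x i y z c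
    assume xy: "x \<in> tuples n E" "i < n" "y \<in> carrier E" "z \<in> carrier E"
    have t: "x(i := y) \<in> tuples n E" "x(i := z) \<in> tuples n E" "x(i := y \<oplus>\<^bsub>E\<^esub> z) \<in> tuples n E" "x(i := c \<odot>\<^bsub>E\<^esub> y) \<in> tuples n E"
      by (intro tuples_upd xy E.smult_in E.M.a_closed)+
    show "(\<lambda>x\<in>tuples n E. \<zero>\<^bsub>F\<^esub>) (x(i := y \<oplus>\<^bsub>E\<^esub> z)) =
        (\<lambda>x\<in>tuples n E. \<zero>\<^bsub>F\<^esub>) (x(i := y)) \<oplus>\<^bsub>F\<^esub> (\<lambda>x\<in>tuples n E. \<zero>\<^bsub>F\<^esub>) (x(i := z))"
      unfolding restrict_apply'[OF t(1)] restrict_apply'[OF t(2)] restrict_apply'[OF t(3)] by simp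
    show "(\<lambda>x\<in>tuples n E. \<zero>\<^bsub>F\<^esub>) (x(i := c \<odot>\<^bsub>E\<^esub> y)) = c \<odot>\<^bsub>F\<^esub> (\<lambda>x\<in>tuples n E. \<zero>\<^bsub>F\<^esub>) (x(i := y))"
      unfolding restrict_apply'[OF t(1)] restrict_apply'[OF t(4)] by simp
  qed auto
  show "nrm F ((\<lambda>x\<in>carrier E. \<zero>\<^bsub>F\<^esub>) x) \<le> 0 * nrm E x ^ n" if "x \<in> carrier E" for x using that by simp
  show "(\<lambda>x\<in>carrier E. \<zero>\<^bsub>F\<^esub>) x = (\<lambda>x\<in>tuples n E. \<zero>\<^bsub>F\<^esub>) (diag n x)" if x: "x \<in> carrier E" for x
  proof -
    have d: "diag n x \<in> tuples n E" using x by auto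
    show ?thesis unfolding restrict_apply'[OF d] restrict_apply'[OF x] ..
  qed
qed auto

lemma multilinear_nlim:
  assumes A: "\<And>k. A k \<in> multilinear n (\<lambda>_. E) F"
    and lim: "\<And>x. x \<in> tuples n E \<Longrightarrow> nlim F (\<lambda>k. A k x) (B x)" and B: "B \<in> extensional (tuples n E)"
  shows "B \<in> multilinear n (\<lambda>_. E) F"
  unfolding multilinear_def
proof (intro CollectI conjI ballI allI impI)
  show "B \<in> tuples n E \<rightarrow>\<^sub>E carrier F" using lim B by (intro PiE_I) (auto simp: nlim_def extensional_def)
next
  fix x i y z c
  assume xy: "x \<in> tuples n E" "i < n" "y \<in> carrier E" "z \<in> carrier E"
  have t: "x(i := y) \<in> tuples n E" "x(i := z) \<in> tuples n E" "x(i := y \<oplus>\<^bsub>E\<^esub> z) \<in> tuples n E" "x(i := c \<odot>\<^bsub>E\<^esub> y) \<in> tuples n E"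
    by (intro tuples_upd xy E.smult_in E.M.a_closed)+
  note mm = multilinear_mapI[OF A]
  show "B (x(i := y \<oplus>\<^bsub>E\<^esub> z)) = B (x(i := y)) \<oplus>\<^bsub>F\<^esub> B (x(i := z))"
    by (rule F.nlim_unique[OF lim[OF t(3), unfolded multilinear_map.slot_add[OF mm xy]] F.nlim_add[OF lim[OF t(1)] lim[OF t(2)]]])
  show "B (x(i := c \<odot>\<^bsub>E\<^esub> y)) = c \<odot>\<^bsub>F\<^esub> B (x(i := y))"
    by (rule F.nlim_unique[OF lim[OF t(4), unfolded multilinear_map.slot_smult[OF mm xy(1-3)]] F.nlim_smult[OF lim[OF t(1)]]])
qed

text \<open>Multilinear maps chosen separately for each \<open>P k\<close> would have no reason to
  converge. The polarizations converge because they are finite sums of values of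
  \<open>P k\<close>.\<close>

lemma cont_poly_nlim:
  assumes P: "\<And>k. P k \<in> cont_poly n E F" and n: "n \<ge> 1"
    and lim: "\<And>x. x \<in> carrier E \<Longrightarrow> nlim F (\<lambda>k. P k x) (Q x)" and Q: "Q \<in> extensional (carrier E)"
    and C: "\<And>x. x \<in> carrier E \<Longrightarrow> nrm F (Q x) \<le> C * nrm E x ^ n" "0 \<le> C"
  shows "Q \<in> cont_poly n E F"
proof -
  have pl: "nlim F (\<lambda>k. polar n E F (P k) x) (polar n E F Q x)" if x: "x \<in> tuples n E" for x
    unfolding polar_def restrict_apply'[OF x]
    using x by (intro F.nlim_smult F.nlim_finsum lim E.M.finsum_closed) auto
  have "polar n E F (P k) \<in> multilinear n (\<lambda>_. E) F" for k
    using polar_cont_poly(1)[OF P n] by (simp add: cont_multilinear_def)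
  moreover have "polar n E F Q \<in> extensional (tuples n E)"
    unfolding polar_def by (rule restrict_extensional)
  ultimately have "polar n E F Q \<in> multilinear n (\<lambda>_. E) F"
    by (intro multilinear_nlim[OF _ pl])
  then show ?thesis
  proof (rule cont_polyI[OF _ _ _ C])
    show "Q \<in> carrier E \<rightarrow>\<^sub>E carrier F" using lim Q by (intro PiE_I) (auto simp: nlim_def extensional_def)
    show "Q x = polar n E F Q (diag n x)" if x: "x \<in> carrier E" for x
    proof -
      have d: "diag n x \<in> tuples n E" using x by auto
      show ?thesis
        by (rule F.nlim_unique[OF lim[OF x] pl[OF d, unfolded polar_cont_poly(3)[OF P n x]]])
    qed
  qed
qed

lemma linear_cont_poly:
  assumes T: "T \<in> carrier E \<rightarrow>\<^sub>E carrier F"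
    and add: "\<And>x y. x \<in> carrier E \<Longrightarrow> y \<in> carrier E \<Longrightarrow> T (x \<oplus>\<^bsub>E\<^esub> y) = T x \<oplus>\<^bsub>F\<^esub> T y"
    and smult: "\<And>c x. x \<in> carrier E \<Longrightarrow> T (c \<odot>\<^bsub>E\<^esub> x) = c \<odot>\<^bsub>F\<^esub> T x"
    and cont: "continuous_map (ntopology E) (ntopology F) T"
  shows "T \<in> cont_poly 1 E F"
proof -
  let ?A = "\<lambda>x\<in>tuples 1 E. T (x 0)"
  have "?A \<in> multilinear 1 (\<lambda>_. E) F"
    unfolding multilinear_def
  proof (intro CollectI conjI ballI allI impI)
    show "?A \<in> tuples 1 E \<rightarrow>\<^sub>E carrier F" using T by (intro PiE_I) auto
  next
    fix x i y z c
    assume xy: "x \<in> tuples 1 E" "i < (1::nat)" "y \<in> carrier E" "z \<in> carrier E"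
    have i: "i = 0" using xy by simp
    have t: "x(i := y) \<in> tuples 1 E" "x(i := z) \<in> tuples 1 E" "x(i := y \<oplus>\<^bsub>E\<^esub> z) \<in> tuples 1 E" "x(i := c \<odot>\<^bsub>E\<^esub> y) \<in> tuples 1 E"
      by (intro tuples_upd xy E.smult_in E.M.a_closed)+
    show "?A (x(i := y \<oplus>\<^bsub>E\<^esub> z)) = ?A (x(i := y)) \<oplus>\<^bsub>F\<^esub> ?A (x(i := z))"
      unfolding restrict_apply'[OF t(1)] restrict_apply'[OF t(2)] restrict_apply'[OF t(3)] by (simp only: i fun_upd_same add[OF xy(3,4)])
    show "?A (x(i := c \<odot>\<^bsub>E\<^esub> y)) = c \<odot>\<^bsub>F\<^esub> ?A (x(i := y))"
      unfolding restrict_apply'[OF t(1)] restrict_apply'[OF t(4)] by (simp only: i fun_upd_same smult[OF xy(3)])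
  qed
  moreover have "T x = ?A (diag 1 x)" if x: "x \<in> carrier E" for x
  proof -
    have d: "diag 1 x \<in> tuples 1 E" using x by auto
    show ?thesis unfolding restrict_apply'[OF d] by simp
  qed
  ultimately show ?thesis using T cont unfolding cont_poly_def by blast
qed

lemma continuous_lipschitz:
  assumes T: "T \<in> carrier E \<rightarrow> carrier F"
    and C: "\<And>x y. x \<in> carrier E \<Longrightarrow> y \<in> carrier E \<Longrightarrow> nrm F (T x \<ominus>\<^bsub>F\<^esub> T y) \<le> C * nrm E (x \<ominus>\<^bsub>E\<^esub> y)" "C > 0"
  shows "continuous_map (ntopology E) (ntopology F) T"
  unfolding E.ntopology_eq F.ntopology_eq F.continuous_map_to_metric
proof (intro ballI allI impI)
  fix x e assume x: "x \<in> topspace E.mtopology" and e: "(e::real) > 0"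
  have "T y \<in> F.mball (T x) e" if y: "y \<in> E.mball x (e / C)" for y
  proof -
    have xy: "x \<in> carrier E" "y \<in> carrier E" "nrm E (x \<ominus>\<^bsub>E\<^esub> y) < e / C" using y by (auto simp: ndist_def)
    then have "C * nrm E (x \<ominus>\<^bsub>E\<^esub> y) < e" using C(2) by (simp add: field_simps)
    with C(1)[OF xy(1,2)] xy T show ?thesis by (auto simp: ndist_def)
  qed
  then show "\<exists>U. openin E.mtopology U \<and> x \<in> U \<and> (\<forall>y\<in>U. T y \<in> F.mball (T x) e)"
    using x e C(2) by (intro exI[of _ "E.mball x (e / C)"]) auto
qed

end

section \<open>Composition of polynomials\<close>

lemma multilinear_comp:
  fixes E :: "('k::{real_normed_field,banach}, 'v) nspace"
  assumes "banach_space E" "banach_space F" "banach_space H"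
    and A: "A \<in> multilinear n (\<lambda>_. E) F" and B: "B \<in> multilinear r (\<lambda>_. F) H"
  shows "(\<lambda>x\<in>tuples (r * n) E. B (\<lambda>i\<in>{..<r}. A (\<lambda>j\<in>{..<n}. x (i * n + j)))) \<in> multilinear (r * n) (\<lambda>_. E) H"
    (is "?C \<in> _")
proof -
  interpret EF: banach_pair E F using assms by (simp add: banach_pair_def)
  interpret FH: banach_pair F H using assms by (simp add: banach_pair_def)
  interpret A: multilinear_map E F n A by (rule EF.multilinear_mapI[OF A])
  interpret B: multilinear_map F H r B by (rule FH.multilinear_mapI[OF B])
  \<comment> \<open>The \<open>r * n\<close> slots are read as \<open>r\<close> consecutive blocks
    of length \<open>n\<close>; \<open>b x i\<close> is block \<open>i\<close>.\<close>
  define b where "b x i = (\<lambda>j\<in>{..<n}. x (i * n + j))" for x :: "nat \<Rightarrow> 'v" and i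
  define a where "a x = (\<lambda>i\<in>{..<r}. A (b x i))" for x
  have lt: "i * n + j < r * n" if "i < r" "j < n" for i j
  proof -
    have "i * n + j < (i + 1) * n" using that by simp
    also have "\<dots> \<le> r * n" using that by (intro mult_right_mono) auto
    finally show ?thesis .
  qed
  have b: "b x i \<in> tuples n E" if "x \<in> tuples (r * n) E" "i < r" for x i
    using that lt by (auto simp: b_def)
  have a: "a x \<in> tuples r F" if "x \<in> tuples (r * n) E" for x
    unfolding a_def using A.closed[OF b[OF that]] by auto
  have C: "?C x = B (a x)" if "x \<in> tuples (r * n) E" for x
    unfolding restrict_apply'[OF that] a_def b_def ..
  \<comment> \<open>Slot \<open>k\<close> lies in block \<open>k div n\<close> at place
    \<open>k mod n\<close>, so changing it affects one slot of one inner tuple and thereby one slot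
    of the outer tuple.\<close>
  have upd: "\<exists>i<r. \<exists>j<n. \<forall>y. a (x(k := y)) = (a x)(i := A ((b x i)(j := y)))" if k: "k < r * n" for x k
  proof (intro exI conjI allI)
    have n: "n > 0" using k by (cases n) auto
    show i: "k div n < r" using k n by (simp add: div_less_iff_less_mult)
    show j: "k mod n < n" using n by simp
    fix y
    have 1: "b (x(k := y)) i = b x i" if "i \<noteq> k div n" for i
      unfolding b_def using that n by (intro restrict_ext) auto
    have 2: "b (x(k := y)) (k div n) = (b x (k div n))(k mod n := y)"
    proof
      fix j
      have "k div n * n + j = k \<longleftrightarrow> j = k mod n"
        using div_mult_mod_eq[of k n] by linarith
      then show "b (x(k := y)) (k div n) j = ((b x (k div n))(k mod n := y)) j"
        using j by (simp add: b_def)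
    qed
    show "a (x(k := y)) = (a x)(k div n := A ((b x (k div n))(k mod n := y)))"
    proof
      fix i'
      show "a (x(k := y)) i' = ((a x)(k div n := A ((b x (k div n))(k mod n := y)))) i'"
      proof (cases "i' = k div n")
        case True
        then show ?thesis using i unfolding a_def True by (simp only: 2 fun_upd_same restrict_apply lessThan_iff if_True)
      next
        case False
        then show ?thesis unfolding a_def by (simp only: fun_upd_other restrict_apply 1 not_False_eq_True)
      qed
    qed
  qed
  show ?thesis
    unfolding multilinear_def
  proof (intro CollectI conjI ballI allI impI)
    show "?C \<in> tuples (r * n) E \<rightarrow>\<^sub>E carrier H"
      using B.closed[OF a] C by (intro PiE_I) auto
  next
    fix x k y z c
    assume xy: "x \<in> tuples (r * n) E" "k < r * n" "y \<in> carrier E" "z \<in> carrier E"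
    have t: "x(k := y) \<in> tuples (r * n) E" "x(k := z) \<in> tuples (r * n) E"
      "x(k := y \<oplus>\<^bsub>E\<^esub> z) \<in> tuples (r * n) E" "x(k := c \<odot>\<^bsub>E\<^esub> y) \<in> tuples (r * n) E"
      by (intro tuples_upd xy EF.E.smult_in EF.E.M.a_closed)+
    obtain i j where ij: "i < r" "j < n" and u: "\<And>y. a (x(k := y)) = (a x)(i := A ((b x i)(j := y)))"
      using upd[OF xy(2)] by blast
    note bi = b[OF xy(1) ij(1)]
    note Ac = A.slot_closed[OF bi ij(2) xy(3)] A.slot_closed[OF bi ij(2) xy(4)]
    show "?C (x(k := y \<oplus>\<^bsub>E\<^esub> z)) = ?C (x(k := y)) \<oplus>\<^bsub>H\<^esub> ?C (x(k := z))"
      unfolding C[OF t(1)] C[OF t(2)] C[OF t(3)] u A.slot_add[OF bi ij(2) xy(3,4)]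
      by (rule B.slot_add[OF a[OF xy(1)] ij(1) Ac])
    show "?C (x(k := c \<odot>\<^bsub>E\<^esub> y)) = c \<odot>\<^bsub>H\<^esub> ?C (x(k := y))"
      unfolding C[OF t(1)] C[OF t(4)] u A.slot_smult[OF bi ij(2) xy(3)]
      by (rule B.slot_smult[OF a[OF xy(1)] ij(1) Ac(1)])
  qed
qed

lemma cont_poly_comp:
  assumes "banach_space E" "banach_space F" "banach_space H"
    and P: "P \<in> cont_poly n E F" and R: "R \<in> cont_poly r F H" and n: "n \<ge> 1" and r: "r \<ge> 1"
  shows "(\<lambda>x\<in>carrier E. R (P x)) \<in> cont_poly (r * n) E H"
proof -
  interpret EF: banach_pair E F using assms by (simp add: banach_pair_def)
  interpret FH: banach_pair F H using assms by (simp add: banach_pair_def)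
  interpret EH: banach_pair E H using assms by (simp add: banach_pair_def)
  obtain A where A: "multilinear_map E F n A" "\<And>x. x \<in> carrier E \<Longrightarrow> P x = A (diag n x)"
    using EF.cont_poly_multilinear[OF P] by blast
  obtain B where B: "multilinear_map F H r B" "\<And>x. x \<in> carrier F \<Longrightarrow> R x = B (diag r x)"
    using FH.cont_poly_multilinear[OF R] by blast
  show ?thesis
  proof (rule EH.cont_polyI[OF multilinear_comp[OF assms(1-3) multilinear_map.multilinear[OF A(1)] multilinear_map.multilinear[OF B(1)]]])
    show "(\<lambda>x\<in>carrier E. R (P x)) \<in> carrier E \<rightarrow>\<^sub>E carrier H" using P R by auto
    show "0 \<le> poly_norm F H R * poly_norm E F P ^ r"
      using EF.poly_norm_nonneg[OF P n] FH.poly_norm_nonneg[OF R r] by simp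
    fix x assume x: "x \<in> carrier E"
    have d: "diag (r * n) x \<in> tuples (r * n) E" using x by auto
    have lt: "i * n + j < r * n" if "i < r" "j < n" for i j
    proof -
      have "i * n + j < (i + 1) * n" using that by simp
      also have "\<dots> \<le> r * n" using that by (intro mult_right_mono) auto
      finally show ?thesis .
    qed
    have "(\<lambda>i\<in>{..<r}. A (\<lambda>j\<in>{..<n}. diag (r * n) x (i * n + j))) = diag r (A (diag n x))"
      using lt by (intro restrict_ext arg_cong[of _ _ A]) (auto intro!: restrict_ext)
    then show "(\<lambda>x\<in>carrier E. R (P x)) x =
        (\<lambda>x\<in>tuples (r * n) E. B (\<lambda>i\<in>{..<r}. A (\<lambda>j\<in>{..<n}. x (i * n + j)))) (diag (r * n) x)"
      unfolding restrict_apply'[OF d] restrict_apply'[OF x] A(2)[OF x, symmetric]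
      by (simp only: B(2)[OF EF.cont_poly_closed[OF P x]])
    have Px: "P x \<in> carrier F" by (rule EF.cont_poly_closed[OF P x])
    have "nrm H (R (P x)) \<le> poly_norm F H R * nrm F (P x) ^ r" by (rule FH.poly_norm_bound[OF R r Px])
    also have "\<dots> \<le> poly_norm F H R * (poly_norm E F P * nrm E x ^ n) ^ r"
      by (intro mult_left_mono power_mono EF.poly_norm_bound P n x EF.F.nrm_nonneg Px FH.poly_norm_nonneg[OF R r])
    finally show "nrm H ((\<lambda>x\<in>carrier E. R (P x)) x) \<le> poly_norm F H R * poly_norm E F P ^ r * nrm E x ^ (r * n)"
      using x by (simp add: power_mult_distrib power_mult[symmetric] mult.commute[of r n])
  qed
qed

section \<open>Spaces of functions with pointwise operations\<close>

lemma pointwise_space_simps [simp]: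
  "carrier (pointwise_space E F S N) = S"
  "\<zero>\<^bsub>pointwise_space E F S N\<^esub> = (\<lambda>x\<in>carrier E. \<zero>\<^bsub>F\<^esub>)"
  "P \<oplus>\<^bsub>pointwise_space E F S N\<^esub> Q = (\<lambda>x\<in>carrier E. P x \<oplus>\<^bsub>F\<^esub> Q x)"
  "c \<odot>\<^bsub>pointwise_space E F S N\<^esub> P = (\<lambda>x\<in>carrier E. c \<odot>\<^bsub>F\<^esub> P x)"
  "nrm (pointwise_space E F S N) = N"
  by (simp_all add: pointwise_space_def mk_nspace_def)

lemma (in banach_space) cring_scalars: "cring (scalars :: 'k ring)"
  by unfold_locales

text \<open>The closure condition \<open>lincomb\<close> covers sums, with \<open>c = 1\<close>, and
  multiples, with the zero function as first argument.\<close>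

lemma (in banach_pair) pointwise_module:
  assumes S: "S \<subseteq> carrier E \<rightarrow>\<^sub>E carrier F" and zero: "(\<lambda>x\<in>carrier E. \<zero>\<^bsub>F\<^esub>) \<in> S"
    and lincomb: "\<And>P Q c. P \<in> S \<Longrightarrow> Q \<in> S \<Longrightarrow> (\<lambda>x\<in>carrier E. P x \<oplus>\<^bsub>F\<^esub> c \<odot>\<^bsub>F\<^esub> Q x) \<in> S"
  shows "Module.module scalars (pointwise_space E F S N)"
proof -
  let ?Z = "pointwise_space E F S N"
  have mem: "P x \<in> carrier F" if "P \<in> S" "x \<in> carrier E" for P x using S that by blast
  \<comment> \<open>Replaces function extensionality under the same name: members of
    \<open>S\<close> are compared on the carrier of \<open>E\<close> alone.\<close>
  have ext: "P = Q" if "P \<in> S" "Q \<in> S" "\<And>x. x \<in> carrier E \<Longrightarrow> P x = Q x" for P Q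
    using S that by (intro PiE_ext[of P "carrier E" "\<lambda>_. carrier F" Q]) auto
  have add: "(\<lambda>x\<in>carrier E. P x \<oplus>\<^bsub>F\<^esub> Q x) \<in> S" if "P \<in> S" "Q \<in> S" for P Q
  proof -
    have "(\<lambda>x\<in>carrier E. P x \<oplus>\<^bsub>F\<^esub> Q x) = (\<lambda>x\<in>carrier E. P x \<oplus>\<^bsub>F\<^esub> 1 \<odot>\<^bsub>F\<^esub> Q x)"
      using mem that by (intro restrict_ext) simp
    then show ?thesis using lincomb[OF that, of 1] by (simp only:)
  qed
  have smult: "(\<lambda>x\<in>carrier E. c \<odot>\<^bsub>F\<^esub> P x) \<in> S" if "P \<in> S" for P c
  proof -
    have "(\<lambda>x\<in>carrier E. c \<odot>\<^bsub>F\<^esub> P x) = (\<lambda>x\<in>carrier E. (\<lambda>x\<in>carrier E. \<zero>\<^bsub>F\<^esub>) x \<oplus>\<^bsub>F\<^esub> c \<odot>\<^bsub>F\<^esub> P x)"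
      using mem that by (intro restrict_ext) simp
    then show ?thesis using lincomb[OF zero that, of c] by (simp only:)
  qed
  have carr: "carrier ?Z = S" by simp
  have closed: "\<zero>\<^bsub>?Z\<^esub> \<in> S" "\<And>P Q. P \<in> S \<Longrightarrow> Q \<in> S \<Longrightarrow> P \<oplus>\<^bsub>?Z\<^esub> Q \<in> S"
      "\<And>P c. P \<in> S \<Longrightarrow> c \<odot>\<^bsub>?Z\<^esub> P \<in> S"
    unfolding pointwise_space_simps by (fact zero add smult)+
  have at: "\<zero>\<^bsub>?Z\<^esub> x = \<zero>\<^bsub>F\<^esub>" "(P \<oplus>\<^bsub>?Z\<^esub> Q) x = P x \<oplus>\<^bsub>F\<^esub> Q x" "(c \<odot>\<^bsub>?Z\<^esub> P) x = c \<odot>\<^bsub>F\<^esub> P x"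
    if "x \<in> carrier E" for x P Q c using that by simp_all
  note simps = carr closed at mem F.M.a_assoc
  note [simp del] = pointwise_space_simps
  show ?thesis
  proof (rule moduleI)
    show "abelian_group ?Z"
    proof (rule abelian_groupI; (unfold carr)?)
      fix P assume P: "P \<in> S"
      show "\<exists>Q\<in>S. Q \<oplus>\<^bsub>?Z\<^esub> P = \<zero>\<^bsub>?Z\<^esub>"
      proof (rule bexI)
        show "(- 1) \<odot>\<^bsub>?Z\<^esub> P \<in> S" using P by (rule closed)
        show "(- 1) \<odot>\<^bsub>?Z\<^esub> P \<oplus>\<^bsub>?Z\<^esub> P = \<zero>\<^bsub>?Z\<^esub>"
        proof (rule ext)
          fix x assume "x \<in> carrier E"
          then show "((- 1) \<odot>\<^bsub>?Z\<^esub> P \<oplus>\<^bsub>?Z\<^esub> P) x = \<zero>\<^bsub>?Z\<^esub> x"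
            using mem[OF P, of x] F.M.l_neg[of "P x"] by (simp add: at F.uminus_eq)
        qed (simp_all add: simps P)
      qed
      show "\<zero>\<^bsub>?Z\<^esub> \<oplus>\<^bsub>?Z\<^esub> P = P"
        using P by (intro ext) (simp_all add: simps)
      fix Q assume Q: "Q \<in> S"
      show "P \<oplus>\<^bsub>?Z\<^esub> Q = Q \<oplus>\<^bsub>?Z\<^esub> P"
        using P Q by (intro ext) (simp_all add: simps F.M.a_comm)
      fix R assume R: "R \<in> S"
      show "P \<oplus>\<^bsub>?Z\<^esub> Q \<oplus>\<^bsub>?Z\<^esub> R = P \<oplus>\<^bsub>?Z\<^esub> (Q \<oplus>\<^bsub>?Z\<^esub> R)"
        using P Q R by (intro ext) (simp_all add: simps)
    qed (simp_all add: simps)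
    show "cring (scalars :: 'k ring)" by (rule E.cring_scalars)
  next
    fix a b P Q assume "P \<in> carrier ?Z" "Q \<in> carrier ?Z"
    then have P: "P \<in> S" and Q: "Q \<in> S" by (simp_all add: simps)
    show "a \<odot>\<^bsub>?Z\<^esub> (P \<oplus>\<^bsub>?Z\<^esub> Q) = a \<odot>\<^bsub>?Z\<^esub> P \<oplus>\<^bsub>?Z\<^esub> a \<odot>\<^bsub>?Z\<^esub> Q"
      using P Q by (intro ext) (simp_all add: simps F.smult_add_right)
  next
    fix a b P assume "P \<in> carrier ?Z"
    then have P: "P \<in> S" by (simp add: simps)
    show "(a \<oplus>\<^bsub>scalars\<^esub> b) \<odot>\<^bsub>?Z\<^esub> P = a \<odot>\<^bsub>?Z\<^esub> P \<oplus>\<^bsub>?Z\<^esub> b \<odot>\<^bsub>?Z\<^esub> P"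
      using P by (intro ext) (simp_all add: simps F.smult_add_left)
    show "(a \<otimes>\<^bsub>scalars\<^esub> b) \<odot>\<^bsub>?Z\<^esub> P = a \<odot>\<^bsub>?Z\<^esub> (b \<odot>\<^bsub>?Z\<^esub> P)"
      using P by (intro ext) (simp_all add: simps)
    show "\<one>\<^bsub>scalars\<^esub> \<odot>\<^bsub>?Z\<^esub> P = P"
      using P by (intro ext) (simp_all add: simps)
    show "a \<odot>\<^bsub>?Z\<^esub> P \<in> carrier ?Z" using P by (simp add: simps)
  qed
qed

section \<open>Stable sequence classes and summing polynomials\<close>

lemma banach_pairI: "banach_space E \<Longrightarrow> banach_space F \<Longrightarrow> banach_pair E F"
  by (simp add: banach_pair_def)

lemma seq_spaceI: "sequence_class X \<Longrightarrow> banach_space E \<Longrightarrow> seq_space X E"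
  by (simp add: seq_space_def seq_class_def)

text \<open>The common consequence of the two stability conditions on \<open>Y\<close>: parts (a) and (b) differ only in \<open>K\<close>.\<close>

definition poly_stable :: "(nat \<Rightarrow> real) \<Rightarrow> ('k::{real_normed_field,banach}, 'a) seq_rule \<Rightarrow> bool" where
  "poly_stable K Y \<longleftrightarrow>
     (\<forall>r\<ge>1. \<forall>F H. banach_space F \<longrightarrow> banach_space H \<longrightarrow>
        (\<forall>R\<in>cont_poly r F H. \<forall>y\<in>carrier (Y F).
           (\<lambda>j. R (y j)) \<in> carrier (Y H) \<and>
           nrm (Y H) (\<lambda>j. R (y j)) \<le> K r * poly_norm F H R * nrm (Y F) y ^ r))"

lemma poly_stableD:
  assumes "poly_stable K Y" "r \<ge> 1" "banach_space F" "banach_space H" "R \<in> cont_poly r F H" "y \<in> carrier (Y F)"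
  shows "(\<lambda>j. R (y j)) \<in> carrier (Y H)"
    and "nrm (Y H) (\<lambda>j. R (y j)) \<le> K r * poly_norm F H R * nrm (Y F) y ^ r"
  using assms unfolding poly_stable_def by blast+

lemma polynomially_stable_imp:
  fixes Y :: "('k::{real_normed_field,banach}, 'a) seq_rule"
  assumes Y: "sequence_class Y" and "polynomially_stable Y"
  shows "poly_stable (\<lambda>_. 1) Y"
  unfolding poly_stable_def
proof (intro allI impI ballI)
  fix r :: nat and F H :: "('k, 'k + 'a) nspace" and R y
  assume r: "r \<ge> 1" and F: "banach_space F" and H: "banach_space H"
    and R: "R \<in> cont_poly r F H" and y: "y \<in> carrier (Y F)"
  interpret YF: seq_space Y F by (rule seq_spaceI[OF Y F])
  interpret YH: seq_space Y H by (rule seq_spaceI[OF Y H])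
  interpret S: banach_pair "Y F" "Y H" ..
  have I: "induced_poly Y F R \<in> cont_poly r (Y F) (Y H)"
    and norm: "poly_norm (Y F) (Y H) (induced_poly Y F R) = poly_norm F H R"
    using assms(2) r F H R by (auto simp: polynomially_stable_def)
  have eq: "induced_poly Y F R y = (\<lambda>j. R (y j))" using y by (simp add: induced_poly_def)
  show "(\<lambda>j. R (y j)) \<in> carrier (Y H) \<and> nrm (Y H) (\<lambda>j. R (y j)) \<le> 1 * poly_norm F H R * nrm (Y F) y ^ r"
    using S.cont_poly_closed[OF I y] S.poly_norm_bound[OF I r y] by (simp only: eq norm mult_1)
qed

text \<open>Stability is applied to the polarization of \<open>R\<close> and evaluated on the
  diagonal. Passing to sequences preserves the norm of the multilinear map, so the whole constant
  comes from polarizing.\<close>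

lemma multilinearly_stable_imp:
  fixes Y :: "('k::{real_normed_field,banach}, 'a) seq_rule"
  assumes Y: "sequence_class Y" and "multilinearly_stable Y"
  shows "poly_stable (\<lambda>n. real n ^ n / fact n) Y"
  unfolding poly_stable_def
proof (intro allI impI ballI)
  fix r :: nat and F H :: "('k, 'k + 'a) nspace" and R y
  assume r: "r \<ge> 1" and F: "banach_space F" and H: "banach_space H"
    and R: "R \<in> cont_poly r F H" and y: "y \<in> carrier (Y F)"
  interpret FH: banach_pair F H by (rule banach_pairI[OF F H])
  interpret YF: seq_space Y F by (rule seq_spaceI[OF Y F])
  interpret YH: seq_space Y H by (rule seq_spaceI[OF Y H])
  interpret S: banach_pair "Y F" "Y H" ..
  let ?A = "polar r F H R"
  let ?I = "induced_multilinear Y r (\<lambda>_. F) ?A"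
  note A = FH.polar_cont_poly[OF R r]
  have I: "?I \<in> cont_multilinear r (\<lambda>_. Y F) (Y H)"
    and norm: "multilinear_norm r (\<lambda>_. Y F) (Y H) ?I = multilinear_norm r (\<lambda>_. F) H ?A"
    using assms(2)[unfolded multilinearly_stable_def, rule_format, of r "\<lambda>_. F" H ?A] r F H A(1) by simp_all
  have d: "diag r y \<in> tuples r (Y F)" using y by auto
  have eq: "?I (diag r y) = (\<lambda>j. R (y j))"
  proof
    fix j
    have "(\<lambda>m\<in>{..<r}. diag r y m j) = diag r (y j)" by auto
    then show "?I (diag r y) j = R (y j)"
      unfolding induced_multilinear_def restrict_apply'[OF d] by (simp only: A(3)[OF YF.coord_closed[OF y]])
  qed
  interpret I: multilinear_map "Y F" "Y H" r ?I
    using I by (intro S.multilinear_mapI) (simp add: cont_multilinear_def)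
  have "nrm (Y H) (?I (diag r y)) \<le> multilinear_norm r (\<lambda>_. F) H ?A * (\<Prod>i<r. nrm (Y F) (diag r y i))"
    using S.multilinear_norm_bound[OF I r d] by (simp only: norm)
  also have "(\<Prod>i<r. nrm (Y F) (diag r y i)) = nrm (Y F) y ^ r" by simp
  also have "multilinear_norm r (\<lambda>_. F) H ?A * nrm (Y F) y ^ r \<le> real r ^ r / fact r * poly_norm F H R * nrm (Y F) y ^ r"
    using A(2) YF.XE.nrm_nonneg[OF y] by (intro mult_right_mono) auto
  finally show "(\<lambda>j. R (y j)) \<in> carrier (Y H) \<and>
      nrm (Y H) (\<lambda>j. R (y j)) \<le> real r ^ r / fact r * poly_norm F H R * nrm (Y F) y ^ r"
    using I.closed[OF d] by (simp only: eq)
qed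

section \<open>The ideal axioms for summing polynomials\<close>

locale summing =
  fixes X Y :: "('k::{real_normed_field,banach}, 'a) seq_rule" and K :: "nat \<Rightarrow> real"
  assumes X: "sequence_class X" and Y: "sequence_class Y"
    and X_stable: "poly_stable (\<lambda>_. 1) X" and Y_stable: "poly_stable K Y"
    and power: "n \<ge> 1 \<Longrightarrow> power_embedded n X Y"
    and K: "n \<ge> 1 \<Longrightarrow> K n \<ge> 1" "K 1 = 1"
begin

abbreviation "Q \<equiv> component (summing_poly X Y)"
abbreviation "N \<equiv> summing_norm X Y"
abbreviation "\<K> \<equiv> scalar_space :: ('k, 'k + 'a) nspace"

lemma mem_Q: "n \<ge> 1 \<Longrightarrow> P \<in> Q n E F \<longleftrightarrow> P \<in> cont_poly n E F \<and> (\<forall>x\<in>carrier (X E). (\<lambda>j. P (x j)) \<in> carrier (Y F))"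
  by (simp add: component_summing)

lemma seq_pairI:
  assumes "banach_space E" "banach_space F" "n \<ge> 1" "P \<in> Q n E F"
  shows "seq_pair X Y E F n P"
  using assms X Y
  by (auto simp: seq_pair_def seq_pair_axioms_def mem_Q banach_pairI seq_spaceI)

lemma N_le:
  assumes "banach_space E" "banach_space F"
    and "\<And>x. x \<in> carrier (X E) \<Longrightarrow> nrm (X E) x \<le> 1 \<Longrightarrow> nrm (Y F) (\<lambda>j. P (x j)) \<le> C"
  shows "N E F P \<le> C"
  by (rule summing_norm_le[OF seq_spaceI[OF X assms(1)] seq_spaceI[OF Y assms(2)] assms(3)])

text \<open>\<open>S\<close> takes \<open>X\<close>-sequences to \<open>X\<close>-sequences at no
  cost, \<open>P\<close> takes these to \<open>Y\<close>-sequences at the cost of its summing norm,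
  and \<open>R\<close> stays among \<open>Y\<close>-sequences at the cost of \<open>K r\<close>. The
  exponents record that \<open>R\<close> and \<open>P\<close> are homogeneous.\<close>

lemma comp_Q:
  assumes "banach_space E" "banach_space F" "banach_space G" "banach_space H"
    and m: "m \<ge> 1" and n: "n \<ge> 1" and r: "r \<ge> 1"
    and P: "P \<in> Q n E F" and S: "S \<in> cont_poly m G E" and R: "R \<in> cont_poly r F H"
  shows "(\<lambda>x\<in>carrier G. R (P (S x))) \<in> Q (r * m * n) G H"
    and "N G H (\<lambda>x\<in>carrier G. R (P (S x))) \<le> K r * poly_norm F H R * N E F P ^ r * poly_norm G E S ^ (r * n)"
proof -
  interpret P: seq_pair X Y E F n P by (rule seq_pairI[OF assms(1,2) n P])
  interpret XG: seq_space X G by (rule seq_spaceI[OF X assms(3)])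
  interpret YH: seq_space Y H by (rule seq_spaceI[OF Y assms(4)])
  interpret GE: banach_pair G E by (rule banach_pairI[OF assms(3,1)])
  interpret FH: banach_pair F H by (rule banach_pairI[OF assms(2,4)])
  have eq: "(\<lambda>j. (\<lambda>x\<in>carrier G. R (P (S x))) (x j)) = (\<lambda>j. R (P (S (x j))))" if "x \<in> carrier (X G)" for x
    using that by simp
  note Sx = poly_stableD[OF X_stable m assms(3,1) S]
  note Px = P.maps[OF Sx(1)]
  note Rx = poly_stableD[OF Y_stable r assms(2,4) R Px]
  \<comment> \<open>Grouping the composition as \<open>R\<close> and \<open>P\<close> first, then
    \<open>S\<close>, yields the degree with its factors in another order and a nested restriction;
    both are removed below.\<close>
  have "(\<lambda>x\<in>carrier G. (\<lambda>x\<in>carrier E. R (P x)) (S x)) \<in> cont_poly (r * n * m) G H"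
    using r n by (intro cont_poly_comp[OF assms(3,1,4) S] cont_poly_comp[OF assms(1,2,4) P.P R] m) auto
  moreover have "(\<lambda>x\<in>carrier G. (\<lambda>x\<in>carrier E. R (P x)) (S x)) = (\<lambda>x\<in>carrier G. R (P (S x)))"
    using GE.cont_poly_closed[OF S] by (intro restrict_ext) simp
  moreover have "r * n * m = r * m * n" by simp
  ultimately have "(\<lambda>x\<in>carrier G. R (P (S x))) \<in> cont_poly (r * m * n) G H" by (simp only:)
  then show "(\<lambda>x\<in>carrier G. R (P (S x))) \<in> Q (r * m * n) G H"
    using m n r Rx(1) by (subst mem_Q) (simp_all only: eq, auto)
  show "N G H (\<lambda>x\<in>carrier G. R (P (S x))) \<le> K r * poly_norm F H R * N E F P ^ r * poly_norm G E S ^ (r * n)"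
  proof (rule N_le[OF assms(3,4)], unfold eq)
    fix x assume x: "x \<in> carrier (X G)" "nrm (X G) x \<le> 1"
    let ?s = "\<lambda>j. S (x j)"
    have S0: "0 \<le> poly_norm G E S" by (rule GE.poly_norm_nonneg[OF S m])
    have R0: "0 \<le> K r * poly_norm F H R" using K(1)[OF r] FH.poly_norm_nonneg[OF R r] by simp
    have "poly_norm G E S * nrm (X G) x ^ m \<le> poly_norm G E S * 1"
      using x XG.XE.nrm_nonneg[OF x(1)] S0 by (intro mult_left_mono power_le_one) auto
    then have s: "nrm (X E) ?s \<le> poly_norm G E S" using Sx(2)[OF x(1)] by simp
    have "nrm (Y F) (\<lambda>j. P (?s j)) \<le> N E F P * nrm (X E) ?s ^ n" by (rule P.summing_norm_bound[OF Sx(1)[OF x(1)]])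
    also have "\<dots> \<le> N E F P * poly_norm G E S ^ n"
      by (intro mult_left_mono power_mono s P.summing_norm_nonneg P.XE.XE.nrm_nonneg Sx(1) x)
    finally have p: "nrm (Y F) (\<lambda>j. P (?s j)) \<le> N E F P * poly_norm G E S ^ n" .
    have "nrm (Y H) (\<lambda>j. R (P (?s j))) \<le> K r * poly_norm F H R * nrm (Y F) (\<lambda>j. P (?s j)) ^ r"
      by (rule Rx(2)[OF x(1)])
    also have "\<dots> \<le> K r * poly_norm F H R * (N E F P * poly_norm G E S ^ n) ^ r"
      by (intro mult_left_mono power_mono p R0 P.YF.XE.nrm_nonneg Px x)
    also have "\<dots> = K r * poly_norm F H R * N E F P ^ r * poly_norm G E S ^ (r * n)"
      by (simp add: power_mult_distrib power_mult[symmetric] mult.commute[of n r])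
    finally show "nrm (Y H) (\<lambda>j. R (P (S (x j)))) \<le> K r * poly_norm F H R * N E F P ^ r * poly_norm G E S ^ (r * n)" .
  qed
qed

text \<open>The line through \<open>b\<close>. It serves twice: to bound the norms of sequences with
  one nonzero term, and as the outer factor of polynomials of finite type.\<close>

lemma scalar_mult_cont_poly:
  assumes F: "banach_space F" and b: "b \<in> carrier F"
  shows "(\<lambda>t\<in>carrier \<K>. projl t \<odot>\<^bsub>F\<^esub> b) \<in> cont_poly 1 \<K> F"
    and "poly_norm \<K> F (\<lambda>t\<in>carrier \<K>. projl t \<odot>\<^bsub>F\<^esub> b) \<le> nrm F b"
proof -
  interpret KF: banach_pair \<K> F by (rule banach_pairI[OF scalar_space_banach F])
  let ?T = "\<lambda>t\<in>carrier \<K>. projl t \<odot>\<^bsub>F\<^esub> b"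
  have mi: "Inl s \<ominus>\<^bsub>\<K>\<^esub> Inl t = Inl (s - t)" for s t
    by (simp add: KF.E.minus_eq')
  show "?T \<in> cont_poly 1 \<K> F"
  proof (rule KF.linear_cont_poly)
    show "?T \<in> carrier \<K> \<rightarrow>\<^sub>E carrier F" using b by auto
    show "?T (x \<oplus>\<^bsub>\<K>\<^esub> y) = ?T x \<oplus>\<^bsub>F\<^esub> ?T y" if "x \<in> carrier \<K>" "y \<in> carrier \<K>" for x y
      using that b by (auto simp: KF.F.smult_add_left)
    show "?T (c \<odot>\<^bsub>\<K>\<^esub> x) = c \<odot>\<^bsub>F\<^esub> ?T x" if "x \<in> carrier \<K>" for c x
      using that b by auto
    show "continuous_map (ntopology \<K>) (ntopology F) ?T"
    proof (rule KF.continuous_lipschitz)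
      show "?T \<in> carrier \<K> \<rightarrow> carrier F" using b by auto
      \<comment> \<open>The summand 1 keeps the Lipschitz constant positive for
        \<open>b = 0\<close>.\<close>
      show "0 < nrm F b + 1" using KF.F.nrm_nonneg[OF b] by simp
      fix x y assume "x \<in> carrier \<K>" "y \<in> carrier \<K>"
      then obtain s t where st: "x = Inl s" "y = Inl t" by auto
      have "s \<odot>\<^bsub>F\<^esub> b \<ominus>\<^bsub>F\<^esub> t \<odot>\<^bsub>F\<^esub> b = (s - t) \<odot>\<^bsub>F\<^esub> b"
        using b KF.F.smult_add_left[of b s "- t"] by (simp add: KF.F.minus_eq')
      then have "nrm F (?T x \<ominus>\<^bsub>F\<^esub> ?T y) = norm (s - t) * nrm F b"
        using b by (simp add: st KF.F.nrm_smult)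
      also have "\<dots> \<le> (nrm F b + 1) * norm (s - t)" by (simp add: algebra_simps)
      finally show "nrm F (?T x \<ominus>\<^bsub>F\<^esub> ?T y) \<le> (nrm F b + 1) * nrm \<K> (x \<ominus>\<^bsub>\<K>\<^esub> y)"
        by (simp only: st mi scalar_space_simps)
    qed
  qed
  show "poly_norm \<K> F ?T \<le> nrm F b"
  proof (rule KF.poly_norm_le)
    fix x assume "x \<in> carrier \<K>" "nrm \<K> x \<le> 1"
    then obtain t where t: "x = Inl t" "norm t \<le> 1" by auto
    then have "norm t * nrm F b \<le> 1 * nrm F b" using KF.F.nrm_nonneg[OF b] by (intro mult_right_mono) auto
    then show "nrm F (?T x) \<le> nrm F b" using b by (simp add: t KF.F.nrm_smult)
  qed
qed

lemma e0: "(\<lambda>i::nat. Inl (if i = 0 then 1 else 0)) \<in> carrier (Z \<K>)"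
    "nrm (Z \<K>) (\<lambda>i. Inl (if i = 0 then 1 else 0)) = 1"
  if "sequence_class Z"
proof -
  interpret seq_space Z \<K> by (rule seq_spaceI[OF that scalar_space_banach])
  have "(\<lambda>i::nat. Inl (if i = 0 then 1 else 0)) \<in> c00 \<K>" by (auto simp: c00_def intro!: exI[of _ 1])
  then show "(\<lambda>i::nat. Inl (if i = 0 then 1 else 0)) \<in> carrier (Z \<K>)" using c00_subset by blast
  show "nrm (Z \<K>) (\<lambda>i. Inl (if i = 0 then 1 else 0)) = 1"
    using that by (auto simp: sequence_class_def)
qed

text \<open>The sequence is the image of \<open>e_0\<close> under the map induced by
  \<open>t -> t v\<close>. As \<open>e_0\<close> has norm 1 in the scalar case, stability of
  \<open>X\<close> in degree 1 gives the bound.\<close>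

lemma nrm_single:
  assumes E: "banach_space E" and v: "v \<in> carrier E"
  shows "nrm (X E) (seq_space.single E v) \<le> nrm E v"
proof -
  interpret XE: seq_space X E by (rule seq_spaceI[OF X E])
  let ?T = "\<lambda>t\<in>carrier \<K>. projl t \<odot>\<^bsub>E\<^esub> v"
  note T = scalar_mult_cont_poly[OF E v]
  have "(\<lambda>j. ?T ((\<lambda>i::nat. Inl (if i = 0 then 1 else 0)) j)) = XE.single v"
    using v by (auto simp: XE.single_def)
  then show ?thesis
    using poly_stableD(2)[OF X_stable _ scalar_space_banach E T(1) e0(1)[OF X]] T(2) by (simp add: e0(2)[OF X])
qed

text \<open>Compatibility of \<open>X\<close> and \<open>Y\<close>, taken with \<open>n\<close>
  equal sequences, gives membership and norm at most 1; testing on \<open>e_0\<close> gives norm at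
  least 1.\<close>

lemma power_Q:
  assumes n: "n \<ge> 1"
  shows "(\<lambda>x\<in>carrier \<K>. Inl (projl x ^ n)) \<in> Q n \<K> \<K>"
    and "N \<K> \<K> (\<lambda>x\<in>carrier \<K>. Inl (projl x ^ n)) = 1"
proof -
  let ?I = "\<lambda>x\<in>carrier \<K>. Inl (projl x ^ n)"
  interpret KK: banach_pair \<K> \<K> by (rule banach_pairI[OF scalar_space_banach scalar_space_banach])
  interpret XK: seq_space X \<K> by (rule seq_spaceI[OF X scalar_space_banach])
  interpret YK: seq_space Y \<K> by (rule seq_spaceI[OF Y scalar_space_banach])
  let ?A = "\<lambda>x\<in>tuples n \<K>. Inl (\<Prod>i<n. projl (x i))"
  have A: "?A \<in> multilinear n (\<lambda>_. \<K>) \<K>"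
    unfolding multilinear_def
  proof (intro CollectI conjI ballI allI impI)
    show "?A \<in> tuples n \<K> \<rightarrow>\<^sub>E carrier \<K>" by (intro PiE_I) auto
  next
    fix x i y z c
    assume xy: "x \<in> tuples n \<K>" "i < n" "y \<in> carrier \<K>" "z \<in> carrier \<K>"
    have t: "x(i := y) \<in> tuples n \<K>" "x(i := z) \<in> tuples n \<K>" "x(i := y \<oplus>\<^bsub>\<K>\<^esub> z) \<in> tuples n \<K>" "x(i := c \<odot>\<^bsub>\<K>\<^esub> y) \<in> tuples n \<K>"
      by (intro tuples_upd xy KK.E.smult_in KK.E.M.a_closed)+
    have pr: "(\<Prod>m<n. projl ((x(i := w)) m)) = projl w * (\<Prod>m\<in>{..<n} - {i}. projl (x m))" for w
      using xy(2) by (subst prod.remove[of _ i]) auto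
    show "?A (x(i := y \<oplus>\<^bsub>\<K>\<^esub> z)) = ?A (x(i := y)) \<oplus>\<^bsub>\<K>\<^esub> ?A (x(i := z))"
      unfolding restrict_apply'[OF t(1)] restrict_apply'[OF t(2)] restrict_apply'[OF t(3)] pr
      using xy(3,4) by (auto simp: distrib_right)
    show "?A (x(i := c \<odot>\<^bsub>\<K>\<^esub> y)) = c \<odot>\<^bsub>\<K>\<^esub> ?A (x(i := y))"
      unfolding restrict_apply'[OF t(1)] restrict_apply'[OF t(4)] pr
      using xy(3) by auto
  qed
  have I: "?I \<in> cont_poly n \<K> \<K>"
  proof (rule KK.cont_polyI[OF A])
    show "?I \<in> carrier \<K> \<rightarrow>\<^sub>E carrier \<K>" by auto
    show "?I x = ?A (diag n x)" if x: "x \<in> carrier \<K>" for x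
    proof -
      have d: "diag n x \<in> tuples n \<K>" using x by auto
      show ?thesis unfolding restrict_apply'[OF d] using x by simp
    qed
    show "nrm \<K> (?I x) \<le> 1 * nrm \<K> x ^ n" if "x \<in> carrier \<K>" for x
      using that by (auto simp: norm_power)
  qed simp
  have X_range: "\<exists>a. x = (\<lambda>j. Inl (a j))" if "x \<in> carrier (X \<K>)" for x
  proof -
    have "\<forall>j. \<exists>a. x j = Inl a" using XK.coord_closed[OF that] by auto
    then show ?thesis by metis
  qed
  have pw: "(\<lambda>j. ?I (x j)) \<in> carrier (Y \<K>)" "nrm (Y \<K>) (\<lambda>j. ?I (x j)) \<le> nrm (X \<K>) x ^ n"
    if x: "x \<in> carrier (X \<K>)" for x
  proof -
    obtain a where a: "x = (\<lambda>j. Inl (a j))" using X_range[OF x] by blast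
    have "(\<lambda>j. Inl (\<Prod>m<n. a j)) \<in> carrier (Y \<K>) \<and>
        nrm (Y \<K>) (\<lambda>j. Inl (\<Prod>m<n. a j)) \<le> (\<Prod>m<n. nrm (X \<K>) (\<lambda>j. Inl (a j)))"
      using power[OF n] x unfolding power_embedded_def a by (elim allE[of _ "\<lambda>_. a"]) simp
    moreover have "(\<lambda>j. ?I (x j)) = (\<lambda>j. Inl (\<Prod>m<n. a j))" by (simp add: a)
    ultimately show "(\<lambda>j. ?I (x j)) \<in> carrier (Y \<K>)" "nrm (Y \<K>) (\<lambda>j. ?I (x j)) \<le> nrm (X \<K>) x ^ n"
      by (simp_all add: a)
  qed
  show IQ: "?I \<in> Q n \<K> \<K>" using I pw(1) by (subst mem_Q[OF n]) blast
  interpret I: seq_pair X Y \<K> \<K> n ?I by (rule seq_pairI[OF scalar_space_banach scalar_space_banach n IQ])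
  show "N \<K> \<K> ?I = 1"
  proof (rule antisym)
    show "N \<K> \<K> ?I \<le> 1"
    proof (rule N_le[OF scalar_space_banach scalar_space_banach])
      fix x assume x: "x \<in> carrier (X \<K>)" "nrm (X \<K>) x \<le> 1"
      have "nrm (X \<K>) x ^ n \<le> 1" by (intro power_le_one x XK.XE.nrm_nonneg)
      with pw(2)[OF x(1)] show "nrm (Y \<K>) (\<lambda>j. ?I (x j)) \<le> 1" by linarith
    qed
    \<comment> \<open>The sequence \<open>e_0\<close> is fixed by the power map, because
      \<open>0 ^ n = 0\<close> for positive \<open>n\<close>, and it has norm 1 in both
      classes.\<close>
    define z :: "nat \<Rightarrow> 'k + 'a" where "z = (\<lambda>i. Inl (if i = 0 then 1 else 0))"
    have z: "z \<in> carrier (X \<K>)" "nrm (X \<K>) z = 1" "nrm (Y \<K>) z = 1"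
      unfolding z_def by (fact e0[OF X] e0[OF Y])+
    have "(\<lambda>j. ?I (z j)) = z" using n by (auto simp: z_def power_0_left)
    then have "nrm (Y \<K>) z \<le> N \<K> \<K> ?I * nrm (X \<K>) z ^ n" using I.summing_norm_bound[OF z(1)] by metis
    then show "1 \<le> N \<K> \<K> ?I" by (simp only: z(2,3) power_one mult_1_right)
  qed
qed

section \<open>The normed space of summing polynomials of fixed degree between fixed spaces, and its
  completeness\<close>

context
  fixes E F :: "('k, 'k + 'a) nspace" and n :: nat
  assumes E: "banach_space E" and F: "banach_space F" and n: "n \<ge> 1"
begin

interpretation EF: banach_pair E F by (rule banach_pairI[OF E F])
interpretation XE: seq_space X E by (rule seq_spaceI[OF X E])
interpretation YF: seq_space Y F by (rule seq_spaceI[OF Y F])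

private lemma Q_cont: "P \<in> Q n E F \<Longrightarrow> P \<in> cont_poly n E F"
  and Q_maps: "P \<in> Q n E F \<Longrightarrow> x \<in> carrier (X E) \<Longrightarrow> (\<lambda>j. P (x j)) \<in> carrier (Y F)"
  by (simp_all add: mem_Q[OF n])

private lemma Q_bound:
  assumes P: "P \<in> Q n E F" and x: "x \<in> carrier (X E)"
  shows "nrm (Y F) (\<lambda>j. P (x j)) \<le> N E F P * nrm (X E) x ^ n"
  by (rule seq_pair.summing_norm_bound[OF seq_pairI[OF E F n P] x])

private lemma Q_bound_ball:
  assumes P: "P \<in> Q n E F" and x: "x \<in> carrier (X E)" "nrm (X E) x \<le> 1"
  shows "nrm (Y F) (\<lambda>j. P (x j)) \<le> N E F P"
proof -
  have "N E F P * nrm (X E) x ^ n \<le> N E F P * 1"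
    using seq_pair.summing_norm_nonneg[OF seq_pairI[OF E F n P]] XE.XE.nrm_nonneg[OF x(1)] x(2)
    by (intro mult_left_mono power_le_one)
  with Q_bound[OF P x(1)] show ?thesis by simp
qed

text \<open>Read off coordinate 0 of the induced map at \<open>single v\<close>. This makes
  \<open>N\<close> definite and bounds the limit of a Cauchy sequence.\<close>

private lemma Q_pointwise:
  assumes P: "P \<in> Q n E F" and v: "v \<in> carrier E"
  shows "nrm F (P v) \<le> N E F P * nrm E v ^ n"
proof -
  have "nrm F (P (XE.single v 0)) \<le> nrm (Y F) (\<lambda>j. P (XE.single v j))"
    by (rule YF.nrm_coord[OF Q_maps[OF P XE.single_closed[OF v]]])
  also have "\<dots> \<le> N E F P * nrm (X E) (XE.single v) ^ n" by (rule Q_bound[OF P XE.single_closed[OF v]])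
  also have "\<dots> \<le> N E F P * nrm E v ^ n"
    using nrm_single[OF E v] seq_pair.summing_norm_nonneg[OF seq_pairI[OF E F n P]] XE.XE.nrm_nonneg[OF XE.single_closed[OF v]]
    by (intro mult_left_mono power_mono)
  finally show ?thesis by simp
qed

private lemma lincomb_coord:
  assumes "P \<in> Q n E F" "R \<in> Q n E F" "x \<in> carrier (X E)"
  shows "(\<lambda>j. (\<lambda>v\<in>carrier E. P v \<oplus>\<^bsub>F\<^esub> c \<odot>\<^bsub>F\<^esub> R v) (x j)) = (\<lambda>j. P (x j)) \<oplus>\<^bsub>Y F\<^esub> c \<odot>\<^bsub>Y F\<^esub> (\<lambda>j. R (x j))"
  using assms by (auto simp: fun_eq_iff YF.add_coord YF.smult_coord Q_maps)

lemma lincomb_Q: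
  assumes P: "P \<in> Q n E F" and R: "R \<in> Q n E F"
  shows "(\<lambda>v\<in>carrier E. P v \<oplus>\<^bsub>F\<^esub> c \<odot>\<^bsub>F\<^esub> R v) \<in> Q n E F"
  unfolding mem_Q[OF n]
proof (intro conjI ballI)
  show "(\<lambda>v\<in>carrier E. P v \<oplus>\<^bsub>F\<^esub> c \<odot>\<^bsub>F\<^esub> R v) \<in> cont_poly n E F"
    by (intro EF.cont_poly_lincomb Q_cont P R n)
  show "(\<lambda>j. (\<lambda>v\<in>carrier E. P v \<oplus>\<^bsub>F\<^esub> c \<odot>\<^bsub>F\<^esub> R v) (x j)) \<in> carrier (Y F)" if x: "x \<in> carrier (X E)" for x
    unfolding lincomb_coord[OF P R x] by (intro YF.XE.M.a_closed YF.XE.smult_in Q_maps P R x)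
qed

private lemma zero_coord: "x \<in> carrier (X E) \<Longrightarrow> (\<lambda>j. (\<lambda>v\<in>carrier E. \<zero>\<^bsub>F\<^esub>) (x j)) = \<zero>\<^bsub>Y F\<^esub>"
  by (auto simp: fun_eq_iff)

lemma zero_Q: "(\<lambda>v\<in>carrier E. \<zero>\<^bsub>F\<^esub>) \<in> Q n E F"
  unfolding mem_Q[OF n] using EF.cont_poly_const_zero zero_coord by simp

private abbreviation "Z \<equiv> pointwise_space E F (Q n E F) (N E F)"

private lemma Z_module: "Module.module scalars Z"
proof (rule EF.pointwise_module)
  show "Q n E F \<subseteq> carrier E \<rightarrow>\<^sub>E carrier F" using Q_cont EF.cont_poly_mem by blast
qed (intro zero_Q lincomb_Q; assumption)+

private lemma Z_add_coord:
  assumes "P \<in> Q n E F" "R \<in> Q n E F" "x \<in> carrier (X E)"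
  shows "(\<lambda>j. (P \<oplus>\<^bsub>Z\<^esub> R) (x j)) = (\<lambda>j. P (x j)) \<oplus>\<^bsub>Y F\<^esub> (\<lambda>j. R (x j))"
  using assms by (auto simp: fun_eq_iff YF.add_coord Q_maps)

private lemma Z_smult_coord:
  assumes "P \<in> Q n E F" "x \<in> carrier (X E)"
  shows "(\<lambda>j. (c \<odot>\<^bsub>Z\<^esub> P) (x j)) = c \<odot>\<^bsub>Y F\<^esub> (\<lambda>j. P (x j))"
  using assms by (auto simp: fun_eq_iff YF.smult_coord Q_maps)

private lemma Z_normed: "normed_carrier Z"
proof (intro normed_carrier.intro normed_carrier_axioms.intro Z_module)
  interpret Z: Module.module scalars Z by (rule Z_module)
  have carr: "carrier Z = Q n E F" and nrm: "nrm Z = N E F" by simp_all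
  have nonneg: "0 \<le> N E F P" if "P \<in> Q n E F" for P
    by (rule seq_pair.summing_norm_nonneg[OF seq_pairI[OF E F n that]])
  then show "P \<in> carrier Z \<Longrightarrow> 0 \<le> nrm Z P" for P by simp
  have smult_Q: "c \<odot>\<^bsub>Z\<^esub> P \<in> Q n E F" if "P \<in> Q n E F" for c P
    using Z.smult_closed[of c P] that unfolding carr by simp
  have smult_le: "N E F (c \<odot>\<^bsub>Z\<^esub> P) \<le> norm c * N E F P" if P: "P \<in> Q n E F" for c P
  proof (rule N_le[OF E F])
    fix x assume x: "x \<in> carrier (X E)" "nrm (X E) x \<le> 1"
    show "nrm (Y F) (\<lambda>j. (c \<odot>\<^bsub>Z\<^esub> P) (x j)) \<le> norm c * N E F P"
      unfolding Z_smult_coord[OF P x(1)] YF.XE.nrm_smult[OF Q_maps[OF P x(1)]]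
      by (intro mult_left_mono Q_bound_ball P x) simp
  qed
  show "nrm Z (c \<odot>\<^bsub>Z\<^esub> P) = norm c * nrm Z P" if "P \<in> carrier Z" for P c
  proof (cases "c = 0")
    case True
    then show ?thesis
      using that smult_le[of P 0] nonneg[OF smult_Q[of P 0]] unfolding carr nrm by simp
  next
    case False
    have P: "P \<in> Q n E F" using that by simp
    \<comment> \<open>Applying the inequality for multiples to \<open>inverse c\<close> and the
      multiple of \<open>P\<close> reverses it.\<close>
    have "inverse c \<odot>\<^bsub>Z\<^esub> (c \<odot>\<^bsub>Z\<^esub> P) = P"
      using Z.smult_assoc1[of "inverse c" c P] Z.smult_one[of P] that False by (simp del: pointwise_space_simps)
    then have "N E F P \<le> norm (inverse c) * N E F (c \<odot>\<^bsub>Z\<^esub> P)"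
      using smult_le[OF smult_Q[OF P], of "inverse c" c] by (simp only:)
    then have "norm c * N E F P \<le> N E F (c \<odot>\<^bsub>Z\<^esub> P)"
      using False by (simp add: norm_inverse norm_divide field_simps del: pointwise_space_simps)
    then show ?thesis using smult_le[OF P, of c] unfolding nrm by linarith
  qed
  show "nrm Z (P \<oplus>\<^bsub>Z\<^esub> R) \<le> nrm Z P + nrm Z R" if "P \<in> carrier Z" "R \<in> carrier Z" for P R
    unfolding nrm
  proof (rule N_le[OF E F])
    fix x assume x: "x \<in> carrier (X E)" "nrm (X E) x \<le> 1"
    have P: "P \<in> Q n E F" and R: "R \<in> Q n E F" using that by simp_all
    have "nrm (Y F) ((\<lambda>j. P (x j)) \<oplus>\<^bsub>Y F\<^esub> (\<lambda>j. R (x j))) \<le> nrm (Y F) (\<lambda>j. P (x j)) + nrm (Y F) (\<lambda>j. R (x j))"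
      by (intro YF.XE.nrm_triangle Q_maps P R x)
    then show "nrm (Y F) (\<lambda>j. (P \<oplus>\<^bsub>Z\<^esub> R) (x j)) \<le> N E F P + N E F R"
      unfolding Z_add_coord[OF P R x(1)] using Q_bound_ball[OF P x] Q_bound_ball[OF R x] by linarith
  qed
  show "nrm Z P = 0 \<longleftrightarrow> P = \<zero>\<^bsub>Z\<^esub>" if "P \<in> carrier Z" for P
  proof
    have P: "P \<in> Q n E F" using that by simp
    assume "nrm Z P = 0"
    then have "P v = \<zero>\<^bsub>F\<^esub>" if v: "v \<in> carrier E" for v
      using Q_pointwise[OF P v] EF.F.nrm_nonneg[of "P v"] EF.F.nrm_eq_0_iff[of "P v"]
        EF.cont_poly_closed[OF Q_cont[OF P] v] by simp
    then show "P = \<zero>\<^bsub>Z\<^esub>"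
      using EF.cont_poly_mem[OF Q_cont[OF P]] by (auto simp: PiE_iff extensional_def fun_eq_iff)
  next
    assume P: "P = \<zero>\<^bsub>Z\<^esub>"
    have "N E F (\<lambda>v\<in>carrier E. \<zero>\<^bsub>F\<^esub>) \<le> 0" by (rule N_le[OF E F]) (simp only: zero_coord YF.XE.nrm_zero order.refl)
    then show "nrm Z P = 0" using nonneg[OF zero_Q] by (simp add: P)
  qed
qed

interpretation Z: normed_carrier Z by (rule Z_normed)

private lemma Z_minus_coord:
  assumes P: "P \<in> Q n E F" and R: "R \<in> Q n E F" and x: "x \<in> carrier (X E)"
  shows "(\<lambda>j. (P \<ominus>\<^bsub>Z\<^esub> R) (x j)) = (\<lambda>j. P (x j)) \<ominus>\<^bsub>Y F\<^esub> (\<lambda>j. R (x j))"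
proof -
  have R': "(- 1) \<odot>\<^bsub>Z\<^esub> R \<in> Q n E F" using Z.smult_in[of R "- 1"] R by simp
  have "P \<ominus>\<^bsub>Z\<^esub> R = P \<oplus>\<^bsub>Z\<^esub> (- 1) \<odot>\<^bsub>Z\<^esub> R" using P R by (intro Z.minus_eq') simp_all
  then show ?thesis
    by (simp only: Z_add_coord[OF P R' x] Z_smult_coord[OF R x] YF.XE.minus_eq'[OF Q_maps[OF P x] Q_maps[OF R x]])
qed

lemma banach_component: "banach_space Z"
proof (rule Z.banach_spaceI)
  fix s assume "ncauchy Z s"
  then have s: "\<And>k. s k \<in> Q n E F"
    and cauchy: "\<And>e. e > 0 \<Longrightarrow> \<exists>M. \<forall>k\<ge>M. \<forall>l\<ge>M. N E F (s k \<ominus>\<^bsub>Z\<^esub> s l) < e"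
    by (simp_all add: ncauchy_def)
  have diff_Q: "P \<ominus>\<^bsub>Z\<^esub> R \<in> Q n E F" if "P \<in> Q n E F" "R \<in> Q n E F" for P R
    using Z.M.minus_closed[of P R] that by simp
  have key: "nrm (Y F) ((\<lambda>j. s k (x j)) \<ominus>\<^bsub>Y F\<^esub> (\<lambda>j. s l (x j))) \<le> N E F (s k \<ominus>\<^bsub>Z\<^esub> s l) * nrm (X E) x ^ n"
    if "x \<in> carrier (X E)" for k l x
    unfolding Z_minus_coord[OF s s that, symmetric] by (rule Q_bound[OF diff_Q[OF s s] that])
  have "\<exists>y. nlim (Y F) (\<lambda>k j. s k (x j)) y" if x: "x \<in> carrier (X E)" for x
  proof (rule YF.XE.ncauchy_nlim)
    show "ncauchy (Y F) (\<lambda>k j. s k (x j))"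
      unfolding ncauchy_def
    proof (intro conjI allI impI Q_maps[OF s x])
      fix e :: real assume e: "e > 0"
      \<comment> \<open>The summand 1 makes the divisor positive when \<open>x\<close> is
        zero.\<close>
      let ?c = "nrm (X E) x ^ n + 1"
      have c: "?c > 0" using XE.XE.nrm_nonneg[OF x] by (simp add: add_nonneg_pos)
      obtain M where M: "\<And>k l. k \<ge> M \<Longrightarrow> l \<ge> M \<Longrightarrow> N E F (s k \<ominus>\<^bsub>Z\<^esub> s l) < e / ?c"
        using cauchy[of "e / ?c"] c e by auto
      have "nrm (Y F) ((\<lambda>j. s k (x j)) \<ominus>\<^bsub>Y F\<^esub> (\<lambda>j. s l (x j))) < e" if "k \<ge> M" "l \<ge> M" for k l
      proof -
        have "N E F (s k \<ominus>\<^bsub>Z\<^esub> s l) * nrm (X E) x ^ n \<le> N E F (s k \<ominus>\<^bsub>Z\<^esub> s l) * ?c"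
          using seq_pair.summing_norm_nonneg[OF seq_pairI[OF E F n diff_Q[OF s s]]] by (intro mult_left_mono) auto
        also have "\<dots> < e" using M[OF that] c by (simp add: pos_less_divide_eq)
        finally show ?thesis using key[OF x, of k l] by linarith
      qed
      then show "\<exists>M. \<forall>k\<ge>M. \<forall>l\<ge>M. nrm (Y F) ((\<lambda>j. s k (x j)) \<ominus>\<^bsub>Y F\<^esub> (\<lambda>j. s l (x j))) < e" by blast
    qed
  qed
  then obtain L where L: "\<And>x. x \<in> carrier (X E) \<Longrightarrow> nlim (Y F) (\<lambda>k j. s k (x j)) (L x)" by metis
  \<comment> \<open>The candidate limit is determined by the sequences with one nonzero term;
    \<open>PL\<close> then shows, coordinate by coordinate, that it induces the limit
    \<open>L x\<close> at every \<open>x\<close>.\<close>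
  define P where "P = (\<lambda>v\<in>carrier E. L (XE.single v) 0)"
  have lim: "nlim F (\<lambda>k. s k v) (P v)" if v: "v \<in> carrier E" for v
    using YF.nlim_coord[OF L[OF XE.single_closed[OF v]], of 0] v by (simp add: P_def)
  have PL: "(\<lambda>j. P (x j)) = L x" if x: "x \<in> carrier (X E)" for x
    using EF.F.nlim_unique[OF lim[OF XE.coord_closed[OF x]] YF.nlim_coord[OF L[OF x]]] by (rule ext)
  \<comment> \<open>This bounds the terms from \<open>M\<close> on, which is enough for a bound on
    the limit after a shift of the sequence.\<close>
  obtain M where M: "\<And>k. k \<ge> M \<Longrightarrow> N E F (s k \<ominus>\<^bsub>Z\<^esub> s M) < 1" using cauchy[of 1] by auto
  let ?C = "1 + N E F (s M)"
  have NM: "N E F (s (k + M)) \<le> ?C" for k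
    using Z.nrm_le_minus_add[of "s (k + M)" "s M"] s M[of "k + M"] by simp
  have "P \<in> cont_poly n E F"
  proof (rule EF.cont_poly_nlim[OF Q_cont[OF s] n lim])
    show "P \<in> extensional (carrier E)" by (simp add: P_def)
    show "0 \<le> ?C" using seq_pair.summing_norm_nonneg[OF seq_pairI[OF E F n s]] by (simp add: add_nonneg_nonneg)
    show "nrm F (P v) \<le> ?C * nrm E v ^ n" if v: "v \<in> carrier E" for v
    proof (rule EF.F.nlim_nrm_le[OF EF.F.nlim_shift[OF lim[OF v]]])
      fix k
      have "N E F (s (k + M)) * nrm E v ^ n \<le> ?C * nrm E v ^ n"
        using NM[of k] EF.E.nrm_nonneg[OF v] by (intro mult_right_mono) auto
      with Q_pointwise[OF s v, of "k + M"] show "nrm F (s (k + M) v) \<le> ?C * nrm E v ^ n" by linarith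
    qed
  qed
  moreover have "\<forall>x\<in>carrier (X E). (\<lambda>j. P (x j)) \<in> carrier (Y F)"
    using PL L by (simp add: nlim_def)
  ultimately have P: "P \<in> Q n E F" by (simp add: mem_Q[OF n])
  have "(\<lambda>k. N E F (s k \<ominus>\<^bsub>Z\<^esub> P)) \<longlonglongrightarrow> 0"
  proof (rule LIMSEQ_I)
    fix e :: real assume e: "0 < e"
    obtain M where M: "\<And>k l. k \<ge> M \<Longrightarrow> l \<ge> M \<Longrightarrow> N E F (s k \<ominus>\<^bsub>Z\<^esub> s l) < e / 2"
      using cauchy[of "e / 2"] e by auto
    \<comment> \<open>With \<open>k\<close> and \<open>x\<close> fixed, the second index of the
      Cauchy estimate tends to infinity. Since \<open>M\<close> does not depend on \<open>x\<close>,
      the bound is uniform on the unit ball; it is no longer strict, whence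
      \<open>e / 2\<close>.\<close>
    have "N E F (s k \<ominus>\<^bsub>Z\<^esub> P) \<le> e / 2" if k: "k \<ge> M" for k
    proof (rule N_le[OF E F])
      fix x assume x: "x \<in> carrier (X E)" "nrm (X E) x \<le> 1"
      have "nlim (Y F) (\<lambda>l. (\<lambda>j. s k (x j)) \<ominus>\<^bsub>Y F\<^esub> (\<lambda>j. s (l + M) (x j))) ((\<lambda>j. s k (x j)) \<ominus>\<^bsub>Y F\<^esub> L x)"
        by (rule YF.XE.nlim_minus[OF YF.XE.nlim_const[OF Q_maps[OF s x(1)]] YF.XE.nlim_shift[OF L[OF x(1)]]])
      then have "nrm (Y F) ((\<lambda>j. s k (x j)) \<ominus>\<^bsub>Y F\<^esub> L x) \<le> e / 2"
      proof (rule YF.XE.nlim_nrm_le)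
        fix l
        have "nrm (Y F) (\<lambda>j. (s k \<ominus>\<^bsub>Z\<^esub> s (l + M)) (x j)) \<le> N E F (s k \<ominus>\<^bsub>Z\<^esub> s (l + M))"
          by (rule Q_bound_ball[OF diff_Q[OF s s] x])
        then show "nrm (Y F) ((\<lambda>j. s k (x j)) \<ominus>\<^bsub>Y F\<^esub> (\<lambda>j. s (l + M) (x j))) \<le> e / 2"
          unfolding Z_minus_coord[OF s s x(1)] using M[OF k, of "l + M"] by linarith
      qed
      then show "nrm (Y F) (\<lambda>j. (s k \<ominus>\<^bsub>Z\<^esub> P) (x j)) \<le> e / 2"
        unfolding Z_minus_coord[OF s P x(1)] PL[OF x(1)] .
    qed
    then have "norm (N E F (s k \<ominus>\<^bsub>Z\<^esub> P) - 0) < e" if "k \<ge> M" for k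
      using that e seq_pair.summing_norm_nonneg[OF seq_pairI[OF E F n diff_Q[OF s P]], of k] by fastforce
    then show "\<exists>M. \<forall>k\<ge>M. norm (N E F (s k \<ominus>\<^bsub>Z\<^esub> P) - 0) < e" by blast
  qed
  then have "nlim Z s P" using s P by (simp add: nlim_def)
  then show "\<exists>P. nlim Z s P" by blast
qed

section \<open>Polynomials of finite type\<close>

lemma dual_cont_poly:
  assumes "\<phi> \<in> dual E"
  shows "(\<lambda>x\<in>carrier E. Inl (\<phi> x)) \<in> cont_poly 1 E \<K>"
proof -
  interpret EK: banach_pair E \<K> by (rule banach_pairI[OF E scalar_space_banach])
  let ?T = "\<lambda>x\<in>carrier E. Inl (\<phi> x) :: 'k + 'a"
  have phi: "\<phi> (x \<oplus>\<^bsub>E\<^esub> y) = \<phi> x + \<phi> y" "\<phi> (c \<odot>\<^bsub>E\<^esub> x) = c * \<phi> x"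
    if "x \<in> carrier E" "y \<in> carrier E" for x y c
    using assms that by (auto simp: dual_def)
  have cont: "continuous_map (ntopology E) euclidean \<phi>" using assms by (simp add: dual_def)
  have mi: "nrm \<K> (Inl s \<ominus>\<^bsub>\<K>\<^esub> Inl t) = dist s t" for s t
    by (simp add: EK.F.minus_eq' dist_norm)
  show ?thesis
  proof (rule EK.linear_cont_poly)
    show "continuous_map (ntopology E) (ntopology \<K>) ?T"
      unfolding EK.F.ntopology_eq EK.F.continuous_map_to_metric
    proof (intro ballI allI impI)
      fix x and e :: real assume x: "x \<in> topspace (ntopology E)" and e: "e > 0"
      let ?U = "{y \<in> topspace (ntopology E). \<phi> y \<in> ball (\<phi> x) e}"
      have "openin (ntopology E) ?U"
        by (rule openin_continuous_map_preimage[OF cont]) (simp flip: open_openin)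
      moreover have "x \<in> ?U" using x e by simp
      moreover have "?T y \<in> EK.F.mball (?T x) e" if "y \<in> ?U" for y
        unfolding EK.F.in_mball using that x by (simp add: ndist_def mi)
      ultimately show "\<exists>U. openin (ntopology E) U \<and> x \<in> U \<and> (\<forall>y\<in>U. ?T y \<in> EK.F.mball (?T x) e)" by blast
    qed
  qed (auto simp: phi)
qed

text \<open>In the application of \<open>comp_Q\<close> the power map is the summing factor; the
  factors on either side have degree 1, so the degree remains \<open>n\<close>.\<close>

lemma power_dual_Q:
  assumes phi: "\<phi> \<in> dual E" and b: "b \<in> carrier F"
  shows "(\<lambda>x\<in>carrier E. (\<phi> x ^ n) \<odot>\<^bsub>F\<^esub> b) \<in> Q n E F"
proof -
  have "(\<lambda>x\<in>carrier E. (\<lambda>t\<in>carrier \<K>. projl t \<odot>\<^bsub>F\<^esub> b) ((\<lambda>t\<in>carrier \<K>. Inl (projl t ^ n)) ((\<lambda>x\<in>carrier E. Inl (\<phi> x)) x)))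
      \<in> Q (1 * 1 * n) E F"
    by (rule comp_Q[OF scalar_space_banach scalar_space_banach E F order.refl n order.refl power_Q(1)[OF n]
        dual_cont_poly[OF phi] scalar_mult_cont_poly(1)[OF F b]])
  then show ?thesis by (simp cong: restrict_cong)
qed

lemma finite_type_Q: "finite_type_poly n E F \<subseteq> Q n E F"
proof
  fix P assume "P \<in> finite_type_poly n E F"
  then obtain l c \<phi> b where P: "P = (\<lambda>x\<in>carrier E. \<Oplus>\<^bsub>F\<^esub>i\<in>{..<l::nat}. c i \<odot>\<^bsub>F\<^esub> ((\<phi> i x) ^ n \<odot>\<^bsub>F\<^esub> b i))"
    and l: "\<forall>i<l. \<phi> i \<in> dual E \<and> b i \<in> carrier F"
    unfolding finite_type_poly_def by blast
  \<comment> \<open>Induction on the number of terms; \<open>m \<le> l\<close> keeps to the indices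
    whose functionals and vectors are known to be admissible.\<close>
  have "(\<lambda>x\<in>carrier E. \<Oplus>\<^bsub>F\<^esub>i\<in>{..<m}. c i \<odot>\<^bsub>F\<^esub> ((\<phi> i x) ^ n \<odot>\<^bsub>F\<^esub> b i)) \<in> Q n E F" if "m \<le> l" for m
    using that
  proof (induction m)
    case 0
    show ?case using zero_Q by (simp only: lessThan_0 EF.F.M.finsum_empty)
  next
    case (Suc m)
    let ?f = "\<lambda>m. \<lambda>x\<in>carrier E. \<Oplus>\<^bsub>F\<^esub>i\<in>{..<m}. c i \<odot>\<^bsub>F\<^esub> ((\<phi> i x) ^ n \<odot>\<^bsub>F\<^esub> b i)"
    let ?g = "\<lambda>x\<in>carrier E. (\<phi> m x ^ n) \<odot>\<^bsub>F\<^esub> b m"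
    have m: "\<phi> m \<in> dual E" "b m \<in> carrier F" using l Suc.prems by auto
    have "?f (Suc m) = (\<lambda>x\<in>carrier E. ?f m x \<oplus>\<^bsub>F\<^esub> c m \<odot>\<^bsub>F\<^esub> ?g x)"
    proof (rule restrict_ext)
      fix x assume x: "x \<in> carrier E"
      have closed: "c i \<odot>\<^bsub>F\<^esub> ((\<phi> i x) ^ n \<odot>\<^bsub>F\<^esub> b i) \<in> carrier F" if "i < Suc m" for i
        using l Suc.prems that by auto
      have "(\<Oplus>\<^bsub>F\<^esub>i\<in>{..<Suc m}. c i \<odot>\<^bsub>F\<^esub> ((\<phi> i x) ^ n \<odot>\<^bsub>F\<^esub> b i)) =
          c m \<odot>\<^bsub>F\<^esub> ((\<phi> m x) ^ n \<odot>\<^bsub>F\<^esub> b m) \<oplus>\<^bsub>F\<^esub> (\<Oplus>\<^bsub>F\<^esub>i\<in>{..<m}. c i \<odot>\<^bsub>F\<^esub> ((\<phi> i x) ^ n \<odot>\<^bsub>F\<^esub> b i))"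
        unfolding lessThan_Suc using closed by (intro EF.F.M.finsum_insert) auto
      also have "\<dots> = (\<Oplus>\<^bsub>F\<^esub>i\<in>{..<m}. c i \<odot>\<^bsub>F\<^esub> ((\<phi> i x) ^ n \<odot>\<^bsub>F\<^esub> b i)) \<oplus>\<^bsub>F\<^esub> c m \<odot>\<^bsub>F\<^esub> ((\<phi> m x) ^ n \<odot>\<^bsub>F\<^esub> b m)"
        using closed by (intro EF.F.M.a_comm EF.F.M.finsum_closed) auto
      finally show "(\<Oplus>\<^bsub>F\<^esub>i\<in>{..<Suc m}. c i \<odot>\<^bsub>F\<^esub> ((\<phi> i x) ^ n \<odot>\<^bsub>F\<^esub> b i)) = ?f m x \<oplus>\<^bsub>F\<^esub> c m \<odot>\<^bsub>F\<^esub> ?g x"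
        unfolding restrict_apply'[OF x] .
    qed
    then show ?case using lincomb_Q[OF Suc.IH[OF Suc_leD[OF Suc.prems]] power_dual_Q[OF m]] by (simp only:)
  qed
  from this[OF order.refl] show "P \<in> Q n E F" unfolding P .
qed

end

section \<open>The ideal property and its instances for the two stability conditions\<close>

theorem two_sided_ideal: "polynomial_two_sided_ideal (\<lambda>_. 1) K (summing_poly X Y) N"
  unfolding polynomial_two_sided_ideal_def
proof (intro conjI allI impI ballI)
  show "summing_poly X Y E F \<subseteq> (\<Union>n\<in>{1..}. cont_poly n E F)" for E F
    by (auto simp: summing_poly_def)
next
  fix m n r :: nat and E F G H :: "('k, 'k + 'a) nspace" and P S R
  assume *: "1 \<le> m" "1 \<le> n" "1 \<le> r" "banach_space E" "banach_space F" "banach_space G" "banach_space H"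
    "P \<in> Q n E F" "S \<in> cont_poly m G E" "R \<in> cont_poly r F H"
  note c = comp_Q[OF *(4-7) *(1-3) *(8-10)]
  show "(\<lambda>x\<in>carrier G. R (P (S x))) \<in> Q (r * m * n) G H" by (rule c(1))
  show "N G H (\<lambda>x\<in>carrier G. R (P (S x))) \<le> K r * 1 ^ (r * n) * poly_norm F H R * N E F P ^ r * poly_norm G E S ^ (r * n)"
    using c(2) by simp
qed (use K banach_component finite_type_Q power_Q(2) in \<open>simp_all\<close>)

end

theorem theorem3p8:
  fixes X Y :: "('k::{real_normed_field,banach}, 'a) seq_rule"
  assumes "sequence_class X" and "sequence_class Y"
    and "polynomially_stable X"
    and "\<forall>n\<ge>1. power_embedded n X Y"
  shows "(multilinearly_stable Y \<longrightarrow>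
            polynomial_two_sided_ideal (\<lambda>_. 1) (\<lambda>n. real n ^ n / fact n)
              (summing_poly X Y) (summing_norm X Y)) \<and>
         (polynomially_stable Y \<longrightarrow>
            polynomial_two_sided_ideal (\<lambda>_. 1) (\<lambda>_. 1)
              (summing_poly X Y) (summing_norm X Y))"
proof (intro conjI impI)
  note X_stable = polynomially_stable_imp[OF assms(1,3)]
  assume "multilinearly_stable Y"
  from multilinearly_stable_imp[OF assms(2) this]
  have "summing X Y (\<lambda>n. real n ^ n / fact n)"
  proof (unfold_locales; (intro assms X_stable | assumption)?)
    show "power_embedded n X Y" if "1 \<le> n" for n using assms(4) that by blast
    show "1 \<le> real n ^ n / fact n" for n
    proof -
      have "fact n \<le> (of_nat (n ^ n) :: real)" by (rule fact_le_power)
      then show ?thesis by simp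
    qed
  qed simp
  then show "polynomial_two_sided_ideal (\<lambda>_. 1) (\<lambda>n. real n ^ n / fact n) (summing_poly X Y) (summing_norm X Y)"
    by (rule summing.two_sided_ideal)
next
  note X_stable = polynomially_stable_imp[OF assms(1,3)]
  assume "polynomially_stable Y"
  from polynomially_stable_imp[OF assms(2) this]
  have "summing X Y (\<lambda>_. 1)"
  proof (unfold_locales; (intro assms X_stable | assumption)?)
    show "power_embedded n X Y" if "1 \<le> n" for n using assms(4) that by blast
  qed simp_all
  then show "polynomial_two_sided_ideal (\<lambda>_. 1) (\<lambda>_. 1) (summing_poly X Y) (summing_norm X Y)"
    by (rule summing.two_sided_ideal)
qed

end
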